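(* Let $(M^{2n+1},\varphi,\xi,\eta,g)$ be a paracontact metric manifold. The condition $Q\xi=(\mathrm{tr}\,l)\xi$ is invariant under $\mathbb D$-homothetic transformations: for every real number $\alpha>0$, if $(\overline\varphi,\overline\xi,\overline\eta,\overline g)$ is the paracontact metric structure on $M^{2n+1}$ given by $$\overline\eta=\alpha\eta,\qquad \overline\xi=\tfrac1\alpha\xi,\qquad \overline\varphi=\varphi,\qquad \overline g=\alpha g+\alpha(\alpha-1)\,\eta\otimes\eta,$$ and $\overline Q$, $\overline l$ denote its operators $Q$, $l$, then $Q\xi=(\mathrm{tr}\,l)\xi$ holds if and only if $\overline Q\,\overline\xi=(\mathrm{tr}\,\overline l)\,\overline\xi$ holds.
   Context: An almost paracontact structure on a smooth $(2n+1)$-manifold $M$ is a triple $(\varphi,\xi,\eta)$ of a $(1,1)$-tensor field, a vector field and a 1-form with $\varphi\xi=0$, $\eta\circ\varphi=0$, $\eta(\xi)=1$, $\varphi^2=\mathrm{id}-\eta\otimes\xi$, and such that $\varphi$ induces an almost paracomplex structure on the distribution $\mathbb D=\ker\eta$ (its $\pm1$-eigendistributions in $\mathbb D$ have equal rank $n$). A compatible metric is a pseudo-Riemannian metric $g$ with $g(\varphi X,\varphi Y)=-g(X,Y)+\eta(X)\eta(Y)$; it has signature $(n+1,n)$ and $\eta(X)=g(X,\xi)$. The structure $(\varphi,\xi,\eta,g)$ is a paracontact metric structure, and $M$ a paracontact metric manifold (also called a paracontact pseudo-Riemannian manifold), if in addition $g(X,\varphi Y)=d\eta(X,Y)$, where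 $d\eta(X,Y)=\frac12\big(X\eta(Y)-Y\eta(X)-\eta([X,Y])\big)$. Notation: for a paracontact metric structure with Levi-Civita connection $\nabla$ of $g$, $R(X,Y)Z=\nabla_X\nabla_YZ-\nabla_Y\nabla_XZ-\nabla_{[X,Y]}Z$; $lX=R(X,\xi)\xi$; $\mathrm{Ric}(Y,Z)$ is the trace of $X\mapsto R(X,Y)Z$; the Ricci operator $Q$ is defined by $g(QX,Y)=\mathrm{Ric}(X,Y)$; $\mathrm{tr}$ is the trace of an endomorphism. The change of structure displayed in the claim is called a $\mathbb D$-homothetic transformation, and it yields again a paracontact metric structure. *)

theory Defs
  imports "HOL-Analysis.Analysis" "HOL-Library.Function_Algebras"
begin

section \<open>Functions as a real vector space\<close>

(* HOL-Library.Function_Algebras supplies the pointwise +, -, * and 0 on functions; only the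
   pointwise scalar multiplication is missing. *)

instantiation "fun" :: (type, scaleR) scaleR
begin
definition scaleR_fun_def: "scaleR c f = (\<lambda>x. c *\<^sub>R f x)"
instance ..
end

instance "fun" :: (type, real_vector) real_vector
  by standard (simp_all add: scaleR_fun_def fun_eq_iff algebra_simps)

definition linear_between ::
  "'a::real_vector set \<Rightarrow> 'b::real_vector set \<Rightarrow> ('a \<Rightarrow> 'b) \<Rightarrow> bool" where
  "linear_between V W h \<longleftrightarrow> (\<forall>u\<in>V. h u \<in> W) \<and>
     (\<forall>u\<in>V. \<forall>v\<in>V. h (u + v) = h u + h v) \<and> (\<forall>c. \<forall>u\<in>V. h (c *\<^sub>R u) = c *\<^sub>R h u)"

definition bilinear_form_on :: "'a::real_vector set \<Rightarrow> ('a \<Rightarrow> 'a \<Rightarrow> real) \<Rightarrow> bool" where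
  "bilinear_form_on V b \<longleftrightarrow>
     (\<forall>u\<in>V. linear_between V UNIV (b u)) \<and> (\<forall>v\<in>V. linear_between V UNIV (\<lambda>u. b u v))"

(* Trace of an endomorphism h of a finite-dimensional subspace V: the sum of the diagonal
   entries of the matrix of h in some basis of V (the choice is immaterial). *)
definition trace_on :: "'a::real_vector set \<Rightarrow> ('a \<Rightarrow> 'a) \<Rightarrow> real" where
  "trace_on V h =
     (let B = (SOME B. independent B \<and> span B = V) in \<Sum>b\<in>B. representation B (h b) b)"


section \<open>Smooth manifolds\<close>

(* C^k and C^infinity maps on an open subset S of a Euclidean space, by iterated directional
   derivatives. *)
fun Ck_on :: "nat \<Rightarrow> 'a::euclidean_space set \<Rightarrow> ('a \<Rightarrow> 'b::real_normed_vector) \<Rightarrow> bool" where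
  "Ck_on 0 S f \<longleftrightarrow> continuous_on S f"
| "Ck_on (Suc k) S f \<longleftrightarrow> (\<forall>x\<in>S. f differentiable (at x)) \<and>
     (\<forall>v. Ck_on k S (\<lambda>x. frechet_derivative f (at x) v))"

definition smooth_on :: "'a::euclidean_space set \<Rightarrow> ('a \<Rightarrow> 'b::real_normed_vector) \<Rightarrow> bool" where
  "smooth_on S f \<longleftrightarrow> (\<forall>k. Ck_on k S f)"

(* A chart is a pair of its domain U and a map that is a homeomorphism of U onto an open subset
   of the Euclidean model space 'e; values of the map outside U are irrelevant. *)
type_synonym ('m, 'e) chart = "'m set \<times> ('m \<Rightarrow> 'e)"

definition is_chart :: "('m::topological_space, 'e::euclidean_space) chart \<Rightarrow> bool" where
  "is_chart = (\<lambda>(U, x). open U \<and> open (x ` U) \<and> inj_on x U \<and>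
     homeomorphism U (x ` U) x (inv_into U x))"

(* The underlying manifold is the whole type 'm; a smooth atlas A, not necessarily maximal,
   determines its smooth structure. *)
definition smooth_manifold ::
  "('m::{t2_space,second_countable_topology}, 'e::euclidean_space) chart set \<Rightarrow> bool" where
  "smooth_manifold A \<longleftrightarrow> (\<forall>c\<in>A. is_chart c) \<and> (\<Union>c\<in>A. fst c) = UNIV \<and>
     (\<forall>(U, x)\<in>A. \<forall>(V, y)\<in>A. smooth_on (x ` (U \<inter> V)) (y \<circ> inv_into U x))"

definition smooth_functions :: "('m, 'e::euclidean_space) chart set \<Rightarrow> ('m \<Rightarrow> real) set" where
  "smooth_functions A = {f. \<forall>(U, x)\<in>A. smooth_on (x ` U) (f \<circ> inv_into U x)}"


section \<open>Tangent vectors and tensor fields\<close>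

(* A tangent vector at p is a derivation at p of the algebra of smooth functions. Since HOL
   functions are total it is made 0 on non-smooth functions, so that equality of tangent vectors
   is equality of derivations. *)
type_synonym 'm tvec = "('m \<Rightarrow> real) \<Rightarrow> real"

definition tangent_space :: "('m, 'e::euclidean_space) chart set \<Rightarrow> 'm \<Rightarrow> 'm tvec set" where
  "tangent_space A p = {v.
     linear_between (smooth_functions A) UNIV v \<and>
     (\<forall>f\<in>smooth_functions A. \<forall>h\<in>smooth_functions A. v (f * h) = f p * v h + v f * h p) \<and>
     (\<forall>f. f \<notin> smooth_functions A \<longrightarrow> v f = 0)}"

type_synonym 'm vfield = "'m \<Rightarrow> 'm tvec"

definition act :: "'m vfield \<Rightarrow> ('m \<Rightarrow> real) \<Rightarrow> ('m \<Rightarrow> real)" where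
  "act X f = (\<lambda>p. X p f)"

definition vector_fields :: "('m, 'e::euclidean_space) chart set \<Rightarrow> 'm vfield set" where
  "vector_fields A = {X. (\<forall>p. X p \<in> tangent_space A p) \<and>
     (\<forall>f\<in>smooth_functions A. act X f \<in> smooth_functions A)}"

definition fscale :: "('m \<Rightarrow> real) \<Rightarrow> 'm vfield \<Rightarrow> 'm vfield" where
  "fscale f X = (\<lambda>p. f p *\<^sub>R X p)"

definition lie_bracket :: "'m vfield \<Rightarrow> 'm vfield \<Rightarrow> 'm vfield" where
  "lie_bracket X Y = (\<lambda>p f. X p (act Y f) - Y p (act X f))"

(* Tensor fields are families of (multi)linear maps on the tangent spaces that send smooth vector
   fields to smooth objects. Their values on arguments outside the tangent spaces are irrelevant. *)

definition one_form :: "('m, 'e::euclidean_space) chart set \<Rightarrow> ('m \<Rightarrow> 'm tvec \<Rightarrow> real) \<Rightarrow> bool" where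
  "one_form A \<eta> \<longleftrightarrow> (\<forall>p. linear_between (tangent_space A p) UNIV (\<eta> p)) \<and>
     (\<forall>X\<in>vector_fields A. (\<lambda>p. \<eta> p (X p)) \<in> smooth_functions A)"

definition tensor_field_11 ::
  "('m, 'e::euclidean_space) chart set \<Rightarrow> ('m \<Rightarrow> 'm tvec \<Rightarrow> 'm tvec) \<Rightarrow> bool" where
  "tensor_field_11 A \<phi> \<longleftrightarrow>
     (\<forall>p. linear_between (tangent_space A p) (tangent_space A p) (\<phi> p)) \<and>
     (\<forall>X\<in>vector_fields A. (\<lambda>p. \<phi> p (X p)) \<in> vector_fields A)"

type_synonym 'm bform = "'m \<Rightarrow> 'm tvec \<Rightarrow> 'm tvec \<Rightarrow> real"

definition tensor_field_02 :: "('m, 'e::euclidean_space) chart set \<Rightarrow> 'm bform \<Rightarrow> bool" where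
  "tensor_field_02 A g \<longleftrightarrow> (\<forall>p. bilinear_form_on (tangent_space A p) (g p)) \<and>
     (\<forall>X\<in>vector_fields A. \<forall>Y\<in>vector_fields A. (\<lambda>p. g p (X p) (Y p)) \<in> smooth_functions A)"

definition metric_index :: "('m, 'e::euclidean_space) chart set \<Rightarrow> 'm bform \<Rightarrow> 'm \<Rightarrow> nat" where
  "metric_index A g p = (GREATEST k. \<exists>W. subspace W \<and> W \<subseteq> tangent_space A p \<and> dim W = k \<and>
     (\<forall>u\<in>W. u \<noteq> 0 \<longrightarrow> g p u u < 0))"

definition pseudo_riemannian_metric ::
  "('m, 'e::euclidean_space) chart set \<Rightarrow> 'm bform \<Rightarrow> bool" where
  "pseudo_riemannian_metric A g \<longleftrightarrow> tensor_field_02 A g \<and>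
     (\<forall>p. \<forall>u\<in>tangent_space A p. \<forall>v\<in>tangent_space A p. g p u v = g p v u) \<and>
     (\<forall>p. \<forall>u\<in>tangent_space A p. (\<forall>v\<in>tangent_space A p. g p u v = 0) \<longrightarrow> u = 0) \<and>
     (\<forall>p q. metric_index A g p = metric_index A g q)"


section \<open>Levi-Civita connection and curvature\<close>

type_synonym 'm connection = "'m vfield \<Rightarrow> 'm vfield \<Rightarrow> 'm vfield"

definition affine_connection ::
  "('m, 'e::euclidean_space) chart set \<Rightarrow> 'm connection \<Rightarrow> bool" where
  "affine_connection A D \<longleftrightarrow>
     (\<forall>X\<in>vector_fields A. \<forall>Y\<in>vector_fields A. D X Y \<in> vector_fields A) \<and>
     (\<forall>X\<in>vector_fields A. \<forall>Y\<in>vector_fields A. \<forall>Z\<in>vector_fields A.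
        D (X + Y) Z = D X Z + D Y Z \<and> D X (Y + Z) = D X Y + D X Z) \<and>
     (\<forall>f\<in>smooth_functions A. \<forall>X\<in>vector_fields A. \<forall>Y\<in>vector_fields A.
        D (fscale f X) Y = fscale f (D X Y) \<and>
        D X (fscale f Y) = fscale (act X f) Y + fscale f (D X Y))"

definition levi_civita ::
  "('m, 'e::euclidean_space) chart set \<Rightarrow> 'm bform \<Rightarrow> 'm connection \<Rightarrow> bool" where
  "levi_civita A g D \<longleftrightarrow> affine_connection A D \<and>
     (\<forall>X\<in>vector_fields A. \<forall>Y\<in>vector_fields A. D X Y - D Y X = lie_bracket X Y) \<and>
     (\<forall>X\<in>vector_fields A. \<forall>Y\<in>vector_fields A. \<forall>Z\<in>vector_fields A. \<forall>p.
        X p (\<lambda>q. g q (Y q) (Z q)) = g p (D X Y p) (Z p) + g p (Y p) (D X Z p))"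

definition curvature ::
  "'m connection \<Rightarrow> 'm vfield \<Rightarrow> 'm vfield \<Rightarrow> 'm vfield \<Rightarrow> 'm vfield" where
  "curvature D X Y Z = D X (D Y Z) - D Y (D X Z) - D (lie_bracket X Y) Z"

(* The curvature on tangent vectors at p is evaluated on smooth vector fields extending them; by
   tensoriality the choice of the extensions is immaterial. *)
definition extension :: "('m, 'e::euclidean_space) chart set \<Rightarrow> 'm \<Rightarrow> 'm tvec \<Rightarrow> 'm vfield" where
  "extension A p u = (SOME X. X \<in> vector_fields A \<and> X p = u)"

definition curvature_at ::
  "('m, 'e::euclidean_space) chart set \<Rightarrow> 'm connection \<Rightarrow> 'm \<Rightarrow>
   'm tvec \<Rightarrow> 'm tvec \<Rightarrow> 'm tvec \<Rightarrow> 'm tvec" where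
  "curvature_at A D p u v w =
     curvature D (extension A p u) (extension A p v) (extension A p w) p"

definition ricci :: "('m, 'e::euclidean_space) chart set \<Rightarrow> 'm connection \<Rightarrow> 'm bform" where
  "ricci A D p v w = trace_on (tangent_space A p) (\<lambda>u. curvature_at A D p u v w)"

definition ricci_operator ::
  "('m, 'e::euclidean_space) chart set \<Rightarrow> 'm bform \<Rightarrow> 'm connection \<Rightarrow>
   'm \<Rightarrow> 'm tvec \<Rightarrow> 'm tvec" where
  "ricci_operator A g D p u =
     (THE w. w \<in> tangent_space A p \<and> (\<forall>v\<in>tangent_space A p. g p w v = ricci A D p u v))"

definition jacobi_operator ::
  "('m, 'e::euclidean_space) chart set \<Rightarrow> 'm connection \<Rightarrow> 'm vfield \<Rightarrow>
   'm \<Rightarrow> 'm tvec \<Rightarrow> 'm tvec" where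
  "jacobi_operator A D \<xi> p u = curvature_at A D p u (\<xi> p) (\<xi> p)"


section \<open>Paracontact metric structures\<close>

definition almost_paracontact ::
  "('m, 'e::euclidean_space) chart set \<Rightarrow> nat \<Rightarrow>
   ('m \<Rightarrow> 'm tvec \<Rightarrow> 'm tvec) \<Rightarrow> 'm vfield \<Rightarrow> ('m \<Rightarrow> 'm tvec \<Rightarrow> real) \<Rightarrow> bool" where
  "almost_paracontact A n \<phi> \<xi> \<eta> \<longleftrightarrow>
     tensor_field_11 A \<phi> \<and> \<xi> \<in> vector_fields A \<and> one_form A \<eta> \<and>
     (\<forall>p. \<phi> p (\<xi> p) = 0 \<and> \<eta> p (\<xi> p) = 1 \<and>
       (\<forall>u\<in>tangent_space A p. \<eta> p (\<phi> p u) = 0 \<and> \<phi> p (\<phi> p u) = u - \<eta> p u *\<^sub>R \<xi> p) \<and>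
       dim {u\<in>tangent_space A p. \<eta> p u = 0 \<and> \<phi> p u = u} = n \<and>
       dim {u\<in>tangent_space A p. \<eta> p u = 0 \<and> \<phi> p u = - u} = n)"

definition compatible_metric ::
  "('m, 'e::euclidean_space) chart set \<Rightarrow> ('m \<Rightarrow> 'm tvec \<Rightarrow> 'm tvec) \<Rightarrow>
   ('m \<Rightarrow> 'm tvec \<Rightarrow> real) \<Rightarrow> 'm bform \<Rightarrow> bool" where
  "compatible_metric A \<phi> \<eta> g \<longleftrightarrow> pseudo_riemannian_metric A g \<and>
     (\<forall>p. \<forall>u\<in>tangent_space A p. \<forall>v\<in>tangent_space A p.
        g p (\<phi> p u) (\<phi> p v) = - g p u v + \<eta> p u * \<eta> p v)"

(* Exterior derivative of a 1-form, in the convention with the factor 1/2. *)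
definition ext_deriv ::
  "('m \<Rightarrow> 'm tvec \<Rightarrow> real) \<Rightarrow> 'm vfield \<Rightarrow> 'm vfield \<Rightarrow> 'm \<Rightarrow> real" where
  "ext_deriv \<eta> X Y p = (1 / 2) *
     (X p (\<lambda>q. \<eta> q (Y q)) - Y p (\<lambda>q. \<eta> q (X q)) - \<eta> p (lie_bracket X Y p))"

definition paracontact_metric ::
  "('m, 'e::euclidean_space) chart set \<Rightarrow> nat \<Rightarrow> ('m \<Rightarrow> 'm tvec \<Rightarrow> 'm tvec) \<Rightarrow>
   'm vfield \<Rightarrow> ('m \<Rightarrow> 'm tvec \<Rightarrow> real) \<Rightarrow> 'm bform \<Rightarrow> bool" where
  "paracontact_metric A n \<phi> \<xi> \<eta> g \<longleftrightarrow>
     almost_paracontact A n \<phi> \<xi> \<eta> \<and> compatible_metric A \<phi> \<eta> g \<and>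
     (\<forall>X\<in>vector_fields A. \<forall>Y\<in>vector_fields A. \<forall>p.
        g p (X p) (\<phi> p (Y p)) = ext_deriv \<eta> X Y p)"

definition ricci_xi_condition ::
  "('m, 'e::euclidean_space) chart set \<Rightarrow> 'm bform \<Rightarrow> 'm connection \<Rightarrow> 'm vfield \<Rightarrow> bool" where
  "ricci_xi_condition A g D \<xi> \<longleftrightarrow> (\<forall>p. ricci_operator A g D p (\<xi> p) =
     trace_on (tangent_space A p) (jacobi_operator A D \<xi> p) *\<^sub>R \<xi> p)"

end

theory Submission
  imports Defs
begin

text \<open>Since \<open>Ric(\<xi>, \<xi>) = tr l\<close>, the condition says that \<open>Ric(\<xi>, v) = 0\<close> for all \<open>v\<close> in \<open>ker \<eta>\<close>. With
  \<open>b = \<alpha> - 1\<close>, the deformed connection is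
  \<open>\<nabla>'\<^sub>X Y = \<nabla>\<^sub>X Y + (b / \<alpha>) g(\<nabla>\<^sub>X \<xi> + \<phi> X, Y) \<xi> - b (\<eta>(Y) \<phi> X + \<eta>(X) \<phi> Y)\<close>, and for a field \<open>V\<close> in
  \<open>ker \<eta>\<close> one finds \<open>R'(X, \<xi>) V = R(X, \<xi>) V - b (\<nabla>\<^sub>X \<phi>) V + b \<eta>(X) (\<nabla>\<^sub>\<xi> \<phi>) V\<close> modulo \<open>\<xi>\<close>. The \<open>\<xi>\<close>-component
  vanishes at \<open>X = \<xi>\<close>, so it does not contribute to the trace over \<open>X\<close>; the last term is traceless because
  \<open>(\<nabla>\<^sub>\<xi> \<phi>) V\<close> is orthogonal to \<open>\<xi>\<close>, and the divergence of \<open>\<phi>\<close> vanishes on \<open>ker \<eta>\<close> because \<open>d\<eta>\<close> is closed.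
  Hence \<open>Ric'(\<xi>, v) = Ric(\<xi>, v)\<close> on \<open>ker \<eta>\<close>.\<close>

section \<open>Smooth maps on Euclidean spaces\<close>

text \<open>Tangent vectors are derivations of the algebra of global smooth functions, so finite
  dimension of the tangent spaces, extension of a tangent vector to a field, and pointwise
  dependence of tensors all have to be derived. Bump functions and Hadamard's lemma supply the three
  facts. The metric is indefinite, so traces are contracted with the \<open>g\<close>-dual of an
  arbitrary basis instead of an orthonormal one. \<open>D'\<close> is only known to be a Levi-Civita
  connection of \<open>g'\<close>; its formula comes from uniqueness. The constants in that formula
  arise as follows. Differentiating the added term of \<open>g'\<close> produces the covariant
  derivative of \<eta> with factor \<open>\<alpha> * b\<close>. Its skew part is
  \<open>d\<eta> = g(., \<phi> .)\<close> and is absorbed by the \<phi>-terms, on which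
  \<open>g'\<close> is \<open>\<alpha> * g\<close>, whence the factor \<open>b\<close>. Its
  symmetric part goes into the direction of \<xi>, where
  \<open>g'(\<xi>, Z) = \<alpha>^2 * \<eta>(Z)\<close>, whence \<open>b / \<alpha>\<close>.\<close>

lemma Ck_on_subset: "Ck_on k S f \<Longrightarrow> T \<subseteq> S \<Longrightarrow> Ck_on k T f"
  by (induction k arbitrary: f) (auto intro: continuous_on_subset)

section \<open>Calculus of iterated directional derivatives\<close>

text \<open>Openness of \<open>S\<close> carries the result: two functions equal on \<open>S\<close>
  agree near each of its points, so their derivatives agree on \<open>S\<close> and the induction
  continues.\<close>

lemma Ck_on_cong:
  assumes "open S" "\<And>x. x \<in> S \<Longrightarrow> f x = g x" "Ck_on k S f"
  shows "Ck_on k S g"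
  using assms(2,3)
proof (induction k arbitrary: f g)
  case 0
  then show ?case by (simp cong: continuous_on_cong)
next
  case (Suc k)
  have diff: "f differentiable (at x)" if "x \<in> S" for x
    using Suc.prems(2) that by simp
  have eq: "frechet_derivative f (at x) = frechet_derivative g (at x)" if "x \<in> S" for x
    using frechet_derivative_transform_within_open[OF diff[OF that] assms(1) that] Suc.prems(1) by blast
  have "g differentiable (at x)" if "x \<in> S" for x
    using diff[OF that] has_derivative_transform_within_open[OF _ assms(1) that] Suc.prems(1)
    unfolding differentiable_def by metis
  moreover have "Ck_on k S (\<lambda>x. frechet_derivative g (at x) v)" for v
    by (rule Suc.IH[of "\<lambda>x. frechet_derivative f (at x) v"]) (use Suc.prems(2) eq in auto)
  ultimately show ?case by simp
qed

text \<open>Lets any explicitly known derivative stand in for \<open>frechet_derivative\<close>, in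
  terms of which \<open>Ck_on\<close> is defined.\<close>

lemma Ck_on_SucI:
  assumes "open S" "\<And>x. x \<in> S \<Longrightarrow> (f has_derivative f' x) (at x)" "\<And>v. Ck_on k S (\<lambda>x. f' x v)"
  shows "Ck_on (Suc k) S f"
proof -
  have eq: "f' x = frechet_derivative f (at x)" if "x \<in> S" for x
    using frechet_derivative_at[OF assms(2)[OF that]] .
  have "Ck_on k S (\<lambda>x. frechet_derivative f (at x) v)" for v
    by (rule Ck_on_cong[OF assms(1) _ assms(3)[of v]]) (simp add: eq)
  then show ?thesis using assms(2) unfolding Ck_on.simps differentiable_def by blast
qed

lemma Ck_on_SucD:
  assumes "Ck_on (Suc k) S f"
  shows "Ck_on k S f"
  using assms
proof (induction k arbitrary: f)
  case 0
  then show ?case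
    by (auto intro!: continuous_at_imp_continuous_on differentiable_imp_continuous_within)
next
  case (Suc k)
  then show ?case by simp
qed

lemma Ck_on_has_derivative:
  "Ck_on (Suc k) S f \<Longrightarrow> x \<in> S \<Longrightarrow> (f has_derivative frechet_derivative f (at x)) (at x)"
  using frechet_derivative_works by auto

text \<open>Used to glue: a function on a chart image may be checked on different open
  pieces.\<close>

lemma Ck_on_local:
  assumes "\<And>x. x \<in> S \<Longrightarrow> \<exists>T. open T \<and> x \<in> T \<and> Ck_on k T f"
  shows "Ck_on k S f"
  using assms
proof (induction k arbitrary: f)
  case 0
  show ?case unfolding Ck_on.simps
  proof (rule continuous_at_imp_continuous_on, rule ballI)
    fix x assume "x \<in> S"
    then obtain T where "open T" "x \<in> T" "continuous_on T f" using 0 by auto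
    then show "continuous (at x) f" using continuous_on_eq_continuous_at by blast
  qed
next
  case (Suc k)
  have "f differentiable (at x)" if "x \<in> S" for x
    using Suc.prems[OF that] by auto
  moreover have "Ck_on k S (\<lambda>x. frechet_derivative f (at x) v)" for v
    by (rule Suc.IH) (use Suc.prems in \<open>unfold Ck_on.simps, blast\<close>)
  ultimately show ?case by simp
qed

lemma Ck_on_const [simp]: "Ck_on k S (\<lambda>x. c)"
proof (induction k arbitrary: c)
  case (Suc k)
  then show ?case by (auto simp: frechet_derivative_const)
qed simp

lemma Ck_on_bounded_linear:
  assumes "bounded_linear L" "open S" "Ck_on k S f"
  shows "Ck_on k S (\<lambda>x. L (f x))"
  using assms(3)
proof (induction k arbitrary: f)
  case 0
  then show ?case using bounded_linear.continuous_on[OF assms(1)] by auto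
next
  case (Suc k)
  show ?case
  proof (rule Ck_on_SucI[OF assms(2)])
    show "((\<lambda>x. L (f x)) has_derivative (\<lambda>v. L (frechet_derivative f (at x) v))) (at x)" if "x \<in> S" for x
      by (rule bounded_linear.has_derivative[OF assms(1) Ck_on_has_derivative[OF Suc.prems that]])
  qed (use Suc in auto)
qed

lemma Ck_on_add:
  assumes "open S" "Ck_on k S f" "Ck_on k S g"
  shows "Ck_on k S (\<lambda>x. f x + g x)"
  using assms(2,3)
proof (induction k arbitrary: f g)
  case 0
  then show ?case by (auto intro: continuous_on_add)
next
  case (Suc k)
  show ?case
  proof (rule Ck_on_SucI[OF assms(1)])
    show "((\<lambda>x. f x + g x) has_derivative
        (\<lambda>v. frechet_derivative f (at x) v + frechet_derivative g (at x) v)) (at x)" if "x \<in> S" for x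
      by (intro has_derivative_add Ck_on_has_derivative[OF Suc.prems(1) that]
          Ck_on_has_derivative[OF Suc.prems(2) that])
  qed (use Suc in auto)
qed

lemma Ck_on_sum:
  assumes "open S" "\<And>i. i \<in> I \<Longrightarrow> Ck_on k S (f i)"
  shows "Ck_on k S (\<lambda>x. \<Sum>i\<in>I. f i x)"
  using assms(2)
  by (induction I rule: infinite_finite_induct) (auto intro: Ck_on_add[OF assms(1)])

lemma Ck_on_bilinear:
  assumes "bounded_bilinear B" "open S" "Ck_on k S f" "Ck_on k S g"
  shows "Ck_on k S (\<lambda>x. B (f x) (g x))"
  using assms(3,4)
proof (induction k arbitrary: f g)
  case 0
  then show ?case using bounded_bilinear.continuous_on[OF assms(1)] by auto
next
  case (Suc k)
  show ?case
  proof (rule Ck_on_SucI[OF assms(2)])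
    show "((\<lambda>x. B (f x) (g x)) has_derivative
        (\<lambda>v. B (f x) (frechet_derivative g (at x) v) + B (frechet_derivative f (at x) v) (g x))) (at x)"
      if "x \<in> S" for x
      by (intro bounded_bilinear.FDERIV[OF assms(1)] Ck_on_has_derivative[OF Suc.prems(1) that]
          Ck_on_has_derivative[OF Suc.prems(2) that])
  next
    show "Ck_on k S (\<lambda>x. B (f x) (frechet_derivative g (at x) v) + B (frechet_derivative f (at x) v) (g x))" for v
      using Suc.prems Ck_on_SucD[OF Suc.prems(1)] Ck_on_SucD[OF Suc.prems(2)]
      by (intro Ck_on_add[OF assms(2)] Suc.IH) simp_all
  qed
qed

lemma Ck_on_compose:
  fixes f :: "'a::euclidean_space \<Rightarrow> 'b::euclidean_space" and h :: "'b \<Rightarrow> 'c::real_normed_vector"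
  assumes "open S" "open T" "f ` S \<subseteq> T" "Ck_on k S f" "Ck_on k T h"
  shows "Ck_on k S (\<lambda>x. h (f x))"
  using assms(4,5)
proof (induction k arbitrary: h)
  case 0
  then show ?case using continuous_on_compose2[OF _ _ assms(3)] by auto
next
  case (Suc k)
  \<comment> \<open>In the chain rule the direction in which \<open>h\<close> is differentiated
    varies with \<open>x\<close>, whereas \<open>Ck_on\<close> controls fixed directions only.
    Expanding it in \<open>Basis\<close> turns the derivative into a sum of products of
    fixed-direction derivatives.\<close>
  let ?F = "\<lambda>x v. \<Sum>b\<in>Basis. (frechet_derivative f (at x) v \<bullet> b) *\<^sub>R frechet_derivative h (at (f x)) b"
  show ?case
  proof (rule Ck_on_SucI[OF assms(1)])
    fix x assume x: "x \<in> S"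
    have h: "(h has_derivative frechet_derivative h (at (f x))) (at (f x))"
      using Ck_on_has_derivative[OF Suc.prems(2)] assms(3) x by blast
    have comp: "((\<lambda>x. h (f x)) has_derivative (\<lambda>v. frechet_derivative h (at (f x)) (frechet_derivative f (at x) v))) (at x)"
      by (rule has_derivative_compose[OF Ck_on_has_derivative[OF Suc.prems(1) x] h])
    have expand: "frechet_derivative h (at (f x)) w = (\<Sum>b\<in>Basis. (w \<bullet> b) *\<^sub>R frechet_derivative h (at (f x)) b)" for w
    proof -
      note lin = has_derivative_linear[OF h]
      have "frechet_derivative h (at (f x)) (\<Sum>b\<in>Basis. (w \<bullet> b) *\<^sub>R b) =
          (\<Sum>b\<in>Basis. (w \<bullet> b) *\<^sub>R frechet_derivative h (at (f x)) b)"
        by (simp only: linear_sum[OF lin] linear_scale[OF lin])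
      then show ?thesis by (simp only: euclidean_representation)
    qed
    have "(\<lambda>v. frechet_derivative h (at (f x)) (frechet_derivative f (at x) v)) = ?F x"
      by (rule ext) (rule expand)
    then show "((\<lambda>x. h (f x)) has_derivative ?F x) (at x)" using comp by (simp only:)
  next
    fix v
    show "Ck_on k S (\<lambda>x. ?F x v)"
    proof (rule Ck_on_sum[OF assms(1)])
      fix b :: 'b assume "b \<in> Basis"
      have "Ck_on k S (\<lambda>x. frechet_derivative f (at x) v)"
        using Suc.prems(1) by simp
      then have 1: "Ck_on k S (\<lambda>x. frechet_derivative f (at x) v \<bullet> b)"
        by (rule Ck_on_bounded_linear[OF bounded_linear_inner_left assms(1)])
      have 2: "Ck_on k S (\<lambda>x. frechet_derivative h (at (f x)) b)"
        using Suc.IH[of "\<lambda>y. frechet_derivative h (at y) b"] Ck_on_SucD[OF Suc.prems(1)] Suc.prems(2)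
        by simp
      show "Ck_on k S (\<lambda>x. (frechet_derivative f (at x) v \<bullet> b) *\<^sub>R frechet_derivative h (at (f x)) b)"
        by (rule Ck_on_bilinear[OF bounded_bilinear_scaleR assms(1) 1 2])
    qed
  qed
qed

lemma Ck_on_ident: "open S \<Longrightarrow> Ck_on k S (\<lambda>x. x)"
proof (induction k)
  case (Suc k)
  then show ?case by (intro Ck_on_SucI[where f'="\<lambda>x v. v"]) auto
qed (simp)

lemma smooth_on_subset: "smooth_on S f \<Longrightarrow> T \<subseteq> S \<Longrightarrow> smooth_on T f"
  unfolding smooth_on_def using Ck_on_subset by blast

lemma smooth_on_cong: "open S \<Longrightarrow> (\<And>x. x \<in> S \<Longrightarrow> f x = g x) \<Longrightarrow> smooth_on S f \<Longrightarrow> smooth_on S g"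
  unfolding smooth_on_def using Ck_on_cong by blast

lemma smooth_on_local:
  assumes "\<And>x. x \<in> S \<Longrightarrow> \<exists>T. open T \<and> x \<in> T \<and> smooth_on T f"
  shows "smooth_on S f"
  unfolding smooth_on_def
proof
  fix k show "Ck_on k S f"
    by (rule Ck_on_local) (use assms in \<open>unfold smooth_on_def, blast\<close>)
qed

lemma smooth_on_const [simp]: "smooth_on S (\<lambda>x. c)"
  by (simp add: smooth_on_def)

lemma smooth_on_ident: "open S \<Longrightarrow> smooth_on S (\<lambda>x. x)"
  by (simp add: smooth_on_def Ck_on_ident)

lemma smooth_on_add: "open S \<Longrightarrow> smooth_on S f \<Longrightarrow> smooth_on S g \<Longrightarrow> smooth_on S (\<lambda>x. f x + g x)"
  by (simp add: smooth_on_def Ck_on_add)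

lemma smooth_on_bounded_linear:
  "bounded_linear L \<Longrightarrow> open S \<Longrightarrow> smooth_on S f \<Longrightarrow> smooth_on S (\<lambda>x. L (f x))"
  by (simp add: smooth_on_def Ck_on_bounded_linear)

lemma smooth_on_bilinear:
  "bounded_bilinear B \<Longrightarrow> open S \<Longrightarrow> smooth_on S f \<Longrightarrow> smooth_on S g \<Longrightarrow> smooth_on S (\<lambda>x. B (f x) (g x))"
  by (simp add: smooth_on_def Ck_on_bilinear)

lemmas smooth_on_mult = smooth_on_bilinear[OF bounded_bilinear_mult]

lemma smooth_on_compose:
  fixes f :: "'a::euclidean_space \<Rightarrow> 'b::euclidean_space"
  shows "open S \<Longrightarrow> open T \<Longrightarrow> f ` S \<subseteq> T \<Longrightarrow> smooth_on S f \<Longrightarrow> smooth_on T h \<Longrightarrow> smooth_on S (\<lambda>x. h (f x))"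
  unfolding smooth_on_def using Ck_on_compose by blast

lemma smooth_on_frechet_derivative:
  "smooth_on S f \<Longrightarrow> smooth_on S (\<lambda>x. frechet_derivative f (at x) v)"
  unfolding smooth_on_def using Ck_on.simps(2)[of _ S f] by blast

lemma smooth_on_has_derivative:
  "smooth_on S f \<Longrightarrow> x \<in> S \<Longrightarrow> (f has_derivative frechet_derivative f (at x)) (at x)"
  unfolding smooth_on_def using Ck_on_has_derivative by blast

lemma smooth_on_continuous: "smooth_on S f \<Longrightarrow> continuous_on S f"
  unfolding smooth_on_def using Ck_on.simps(1)[of S f] by blast

section \<open>Smooth bump functions\<close>

text \<open>The powers of \<open>t\<close> in the denominator make the family closed under
  differentiation: the derivative of one member is a combination of two others, so smoothness is an
  induction on the order for all \<open>m\<close> at once.\<close>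

definition flat_exp :: "nat \<Rightarrow> real \<Rightarrow> real" where
  "flat_exp m t = (if t > 0 then exp (- 1 / t) / t ^ m else 0)"

lemma flat_exp_has_derivative:
  "(flat_exp m has_derivative (\<lambda>v. (- real m * flat_exp (Suc m) t + flat_exp (m + 2) t) * v)) (at t)"
proof -
  consider "t > 0" | "t < 0" | "t = 0" by linarith
  then show ?thesis
  proof cases
    case 1
    have "((\<lambda>t. exp (- 1 / t) / t ^ m) has_real_derivative
        (- real m * (exp (- 1 / t) / t ^ Suc m) + exp (- 1 / t) / t ^ (m + 2))) (at t)"
    proof (cases m)
      case 0
      then show ?thesis using 1
        by (auto intro!: derivative_eq_intros simp: field_simps power2_eq_square)
    next
      case (Suc l)
      then show ?thesis using 1
        by (auto intro!: derivative_eq_intros simp del: power_Suc)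
          (simp add: field_simps power2_eq_square)
    qed
    then have "(flat_exp m has_real_derivative
        (- real m * (exp (- 1 / t) / t ^ Suc m) + exp (- 1 / t) / t ^ (m + 2))) (at t)"
      by (rule has_field_derivative_transform_within_open[of _ _ _ "{0<..}"]) (use 1 in \<open>auto simp: flat_exp_def\<close>)
    then show ?thesis using 1 by (simp add: has_field_derivative_def flat_exp_def)
  next
    case 2
    have "((\<lambda>t. 0::real) has_derivative (\<lambda>v. 0)) (at t)" by simp
    then have "(flat_exp m has_derivative (\<lambda>v. 0)) (at t)"
      by (rule has_derivative_transform_within_open[of _ _ _ _ "{..<0}"]) (use 2 in \<open>auto simp: flat_exp_def\<close>)
    then show ?thesis using 2 by (simp add: flat_exp_def)
  next
    case 3
    have lim: "((\<lambda>h. flat_exp m h / h) \<longlongrightarrow> 0) (at 0)"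
    proof (rule filterlim_split_at)
      show "((\<lambda>h. flat_exp m h / h) \<longlongrightarrow> 0) (at_left 0)"
        by (rule tendsto_eventually) (auto simp: flat_exp_def eventually_at_filter)
      have "((\<lambda>h::real. exp (- 1 / h) / h ^ m / h) \<longlongrightarrow> 0) (at_right 0)"
      proof -
        \<comment> \<open>With \<open>s = 1 / h\<close> the difference quotient at 0 becomes
          \<open>s ^ Suc m / exp s\<close>, which tends to 0 at infinity.\<close>
        have "((\<lambda>h::real. inverse h ^ Suc m / exp (inverse h)) \<longlongrightarrow> 0) (at_right 0)"
          by (rule filterlim_compose[OF tendsto_power_div_exp_0 filterlim_inverse_at_top_right])
        then show ?thesis
          by (rule Lim_transform_eventually)
            (auto simp: eventually_at_filter exp_minus field_simps)
      qed
      then show "((\<lambda>h. flat_exp m h / h) \<longlongrightarrow> 0) (at_right 0)"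
        by (rule Lim_transform_eventually) (auto simp: flat_exp_def eventually_at_filter)
    qed
    have "(flat_exp m has_real_derivative 0) (at 0)"
      unfolding DERIV_def using lim by (simp add: flat_exp_def)
    then show ?thesis using 3 by (simp add: has_field_derivative_def flat_exp_def lambda_zero)
  qed
qed

lemma flat_exp_Ck: "Ck_on k UNIV (flat_exp m)"
proof (induction k arbitrary: m)
  case 0
  then show ?case
    using has_derivative_continuous[OF flat_exp_has_derivative]
    by (simp add: continuous_at_imp_continuous_on)
next
  case (Suc k)
  note mult = Ck_on_bilinear[OF bounded_bilinear_mult open_UNIV]
  show ?case
  proof (rule Ck_on_SucI[OF open_UNIV flat_exp_has_derivative])
    show "Ck_on k UNIV (\<lambda>t. (- real m * flat_exp (Suc m) t + flat_exp (m + 2) t) * v)" for v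
      by (rule mult[OF Ck_on_add[OF open_UNIV mult[OF Ck_on_const Suc] Suc] Ck_on_const])
  qed
qed

text \<open>The squared distance is smooth at the centre as well. There is no plateau where the
  value is 1: later arguments use only that the value at the centre is nonzero and divide by it, or
  cancel the derivatives of the bump.\<close>

definition bump :: "'a::euclidean_space \<Rightarrow> real \<Rightarrow> 'a \<Rightarrow> real" where
  "bump z0 r z = flat_exp 0 (r\<^sup>2 - (z - z0) \<bullet> (z - z0))"

lemma smooth_on_bump: "open S \<Longrightarrow> smooth_on S (bump z0 r)"
proof -
  have 1: "smooth_on UNIV (\<lambda>z::'a. z + - z0)"
    by (intro smooth_on_add smooth_on_ident) auto
  have "smooth_on UNIV (\<lambda>z::'a. r\<^sup>2 + (- 1) * ((z + - z0) \<bullet> (z + - z0)))"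
    by (intro smooth_on_add smooth_on_mult smooth_on_bilinear[OF bounded_bilinear_inner] 1) auto
  moreover have "smooth_on UNIV (flat_exp 0)" by (simp add: smooth_on_def flat_exp_Ck)
  ultimately have "smooth_on UNIV (\<lambda>z::'a. flat_exp 0 (r\<^sup>2 + (- 1) * ((z + - z0) \<bullet> (z + - z0))))"
    by (rule smooth_on_compose[OF open_UNIV open_UNIV subset_UNIV])
  moreover have "(\<lambda>z::'a. flat_exp 0 (r\<^sup>2 + (- 1) * ((z + - z0) \<bullet> (z + - z0)))) = bump z0 r"
    by (simp add: bump_def fun_eq_iff)
  ultimately show "smooth_on S (bump z0 r)" using smooth_on_subset by (metis subset_UNIV)
qed

lemma bump_center: "r > 0 \<Longrightarrow> bump z0 r z0 \<noteq> 0"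
  by (simp add: bump_def flat_exp_def)

lemma bump_outside: "r > 0 \<Longrightarrow> z \<notin> cball z0 r \<Longrightarrow> bump z0 r z = 0"
proof -
  assume "r > 0" "z \<notin> cball z0 r"
  then have "r\<^sup>2 \<le> (norm (z - z0))\<^sup>2"
    by (intro power_mono) (auto simp: dist_norm norm_minus_commute)
  then show ?thesis by (simp add: bump_def flat_exp_def dot_square_norm)
qed


section \<open>Radial integrals and Hadamard's lemma\<close>

lemma radial_point_in_ball:
  fixes z0 :: "'a::real_normed_vector"
  assumes "z \<in> ball z0 r" "t \<in> {0..1}"
  shows "z0 + t *\<^sub>R (z - z0) \<in> ball z0 r"
proof -
  have "norm (t *\<^sub>R (z - z0)) \<le> norm (z - z0)"
    using assms(2) by (simp add: mult_left_le_one_le)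
  also have "\<dots> < r" using assms(1) by (simp add: dist_norm norm_minus_commute)
  finally show ?thesis by (simp add: dist_norm)
qed

lemma continuous_on_radial:
  fixes f :: "'a::real_normed_vector \<Rightarrow> real"
  assumes "continuous_on (ball z0 r) f"
  shows "continuous_on (ball z0 r \<times> cbox 0 1) (\<lambda>(z, t). t ^ m * f (z0 + t *\<^sub>R (z - z0)))"
proof -
  have "continuous_on (ball z0 r \<times> cbox 0 1) (\<lambda>p. f (z0 + snd p *\<^sub>R (fst p - z0)))"
    by (rule continuous_on_compose2[OF assms])
      (auto intro!: continuous_intros radial_point_in_ball simp del: mem_ball)
  then show ?thesis
    unfolding split_beta by (intro continuous_intros)
qed

text \<open>The weight \<open>t ^ m\<close> is there for differentiation under the integral: the
  inner derivative contributes a factor \<open>t\<close>, so the derivative is again a radial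
  integral, with \<open>Suc m\<close>.\<close>

definition radial_integral :: "'a::euclidean_space \<Rightarrow> ('a \<Rightarrow> real) \<Rightarrow> nat \<Rightarrow> 'a \<Rightarrow> real" where
  "radial_integral z0 f m z = integral (cbox 0 1) (\<lambda>t. t ^ m * f (z0 + t *\<^sub>R (z - z0)))"

lemma radial_integral_has_derivative:
  fixes f :: "'a::euclidean_space \<Rightarrow> real"
  assumes "smooth_on (ball z0 r) f" "z \<in> ball z0 r"
  shows "(radial_integral z0 f m has_derivative
    (\<lambda>v. radial_integral z0 (\<lambda>y. frechet_derivative f (at y) v) (Suc m) z)) (at z)"
proof -
  \<comment> \<open>The Leibniz rule asks for the partial derivative as a continuous map into
    bounded linear functions, so the derivative is packaged as one.\<close>
  define L :: "'a \<Rightarrow> real \<Rightarrow> 'a \<Rightarrow>\<^sub>L real" where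
    "L z t = Blinfun (\<lambda>v. t ^ Suc m * frechet_derivative f (at (z0 + t *\<^sub>R (z - z0))) v)" for z t
  have deriv: "(f has_derivative frechet_derivative f (at (z0 + t *\<^sub>R (z - z0)))) (at (z0 + t *\<^sub>R (z - z0)))"
    if "z \<in> ball z0 r" "t \<in> {0..1}" for z t
    using smooth_on_has_derivative[OF assms(1) radial_point_in_ball[OF that]] .
  have L: "blinfun_apply (L z t) = (\<lambda>v. t ^ Suc m * frechet_derivative f (at (z0 + t *\<^sub>R (z - z0))) v)"
    if "z \<in> ball z0 r" "t \<in> {0..1}" for z t
    unfolding L_def
    by (intro bounded_linear_Blinfun_apply bounded_linear_const_mult
        has_derivative_bounded_linear[OF deriv[OF that]])
  have cont: "continuous_on (ball z0 r \<times> cbox 0 1) (\<lambda>(z, t). L z t)"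
  \<comment> \<open>In finite dimension, continuity in the operator norm reduces to continuity of
    the directional derivatives.\<close>
  proof (rule continuous_on_blinfun_componentwise)
    fix i :: 'a
    have "continuous_on (ball z0 r) (\<lambda>y. frechet_derivative f (at y) i)"
      by (intro smooth_on_continuous smooth_on_frechet_derivative assms(1))
    from continuous_on_radial[OF this, of "Suc m"]
    show "continuous_on (ball z0 r \<times> cbox 0 1) (\<lambda>x. blinfun_apply (case x of (z, t) \<Rightarrow> L z t) i)"
      by (rule continuous_on_eq) (auto simp: L)
  qed
  have slice: "continuous_on (cbox 0 1) (\<lambda>t. h z t)"
    if "continuous_on (ball z0 r \<times> cbox (0::real) 1) (\<lambda>(z, t). h z t)" "z \<in> ball z0 r"
    for z and h :: "'a \<Rightarrow> real \<Rightarrow> 'b::real_normed_vector"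
  proof -
    have "continuous_on (cbox (0::real) 1) (\<lambda>t. (\<lambda>(z, t). h z t) (z, t))"
      by (rule continuous_on_compose2[OF that(1)]) (use that(2) in \<open>auto intro!: continuous_intros\<close>)
    then show ?thesis by simp
  qed
  have "((\<lambda>z. integral (cbox 0 1) (\<lambda>t. t ^ m * f (z0 + t *\<^sub>R (z - z0)))) has_derivative
      blinfun_apply (integral (cbox 0 1) (L z))) (at z within ball z0 r)"
  proof (rule leibniz_rule[OF _ _ cont assms(2) convex_ball])
    fix z :: 'a and t :: real assume zt: "z \<in> ball z0 r" "t \<in> cbox 0 1"
    have "((\<lambda>z. f (z0 + t *\<^sub>R (z - z0))) has_derivative
        (\<lambda>v. frechet_derivative f (at (z0 + t *\<^sub>R (z - z0))) (t *\<^sub>R v))) (at z)"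
      by (rule has_derivative_compose[where f="\<lambda>z. z0 + t *\<^sub>R (z - z0)", OF _ deriv])
        (use zt in \<open>auto intro!: derivative_eq_intros\<close>)
    moreover have "frechet_derivative f (at (z0 + t *\<^sub>R (z - z0))) (t *\<^sub>R v) =
        t * frechet_derivative f (at (z0 + t *\<^sub>R (z - z0))) v" for v
      using linear_scale[OF has_derivative_linear[OF deriv]] zt by simp
    ultimately have "((\<lambda>z. t ^ m * f (z0 + t *\<^sub>R (z - z0))) has_derivative blinfun_apply (L z t)) (at z)"
      using zt by (auto simp: L algebra_simps intro!: derivative_eq_intros)
    then show "((\<lambda>z. t ^ m * f (z0 + t *\<^sub>R (z - z0))) has_derivative blinfun_apply (L z t))
        (at z within ball z0 r)"
      by (rule has_derivative_at_withinI)
  next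
    fix z :: 'a assume "z \<in> ball z0 r"
    then show "(\<lambda>t. t ^ m * f (z0 + t *\<^sub>R (z - z0))) integrable_on cbox 0 1"
      by (intro integrable_continuous slice
          continuous_on_radial[OF smooth_on_continuous[OF assms(1)]])
  qed
  moreover have "blinfun_apply (integral (cbox 0 1) (L z)) =
      (\<lambda>v. radial_integral z0 (\<lambda>y. frechet_derivative f (at y) v) (Suc m) z)"
  proof
    fix v
    have "blinfun_apply (integral (cbox 0 1) (L z)) v = integral (cbox 0 1) (\<lambda>t. blinfun_apply (L z t) v)"
      by (intro blinfun_apply_integral integrable_continuous slice[OF cont assms(2)])
    also have "\<dots> = radial_integral z0 (\<lambda>y. frechet_derivative f (at y) v) (Suc m) z"
      unfolding radial_integral_def by (rule integral_cong) (use assms(2) L in simp)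
    finally show "blinfun_apply (integral (cbox 0 1) (L z)) v =
      radial_integral z0 (\<lambda>y. frechet_derivative f (at y) v) (Suc m) z" .
  qed
  ultimately show ?thesis
    using at_within_open[OF assms(2) open_ball]
    unfolding radial_integral_def[abs_def] by simp
qed

lemma smooth_on_radial_integral:
  assumes "smooth_on (ball z0 r) f"
  shows "smooth_on (ball z0 r) (radial_integral z0 f m)"
  unfolding smooth_on_def
proof
  fix k
  show "Ck_on k (ball z0 r) (radial_integral z0 f m)"
    using assms
  proof (induction k arbitrary: f m)
    case 0
    have "continuous_on (ball z0 r) (\<lambda>z. integral (cbox 0 1) (\<lambda>t. t ^ m * f (z0 + t *\<^sub>R (z - z0))))"
      by (rule integral_continuous_on_param) (rule continuous_on_radial[OF smooth_on_continuous[OF 0]])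
    then show ?case by (simp add: radial_integral_def[abs_def])
  next
    case (Suc k)
    show ?case
      by (rule Ck_on_SucI[OF open_ball radial_integral_has_derivative[OF Suc.prems]])
        (auto intro: Suc.IH smooth_on_frechet_derivative[OF Suc.prems])
  qed
qed

text \<open>The fundamental theorem of calculus on the segment from \<open>z0\<close> to
  \<open>z\<close> writes \<open>f z - f z0\<close> as the integral of the derivative in direction
  \<open>z - z0\<close>; \<open>h i\<close> is the average of the \<open>i\<close>-th partial
  derivative along that segment, hence smooth in \<open>z\<close>, and at \<open>z0\<close> it is
  the partial derivative itself.\<close>

lemma hadamard:
  fixes f :: "'a::euclidean_space \<Rightarrow> real"
  assumes "smooth_on (ball z0 r) f" "r > 0"
  obtains h where "\<And>i. smooth_on (ball z0 r) (h i)"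
    "\<And>i. h i z0 = frechet_derivative f (at z0) i"
    "\<And>z. z \<in> ball z0 r \<Longrightarrow> f z = f z0 + (\<Sum>i\<in>Basis. ((z - z0) \<bullet> i) * h i z)"
proof
  let ?D = "\<lambda>i y. frechet_derivative f (at y) i"
  let ?h = "\<lambda>i. radial_integral z0 (?D i) 0"
  have Dsm: "smooth_on (ball z0 r) (?D i)" for i
    by (rule smooth_on_frechet_derivative[OF assms(1)])
  show "smooth_on (ball z0 r) (?h i)" for i
    by (rule smooth_on_radial_integral[OF Dsm])
  show "?h i z0 = frechet_derivative f (at z0) i" for i
    by (simp add: radial_integral_def)
  fix z assume z: "z \<in> ball z0 r"
  have deriv: "(f has_derivative frechet_derivative f (at (z0 + t *\<^sub>R (z - z0)))) (at (z0 + t *\<^sub>R (z - z0)))"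
    if "t \<in> {0..1}" for t
    using smooth_on_has_derivative[OF assms(1) radial_point_in_ball[OF z that]] .
  have expand: "?D w y = (\<Sum>i\<in>Basis. (w \<bullet> i) * ?D i y)" if "y \<in> ball z0 r" for w y
  proof -
    note lin = has_derivative_linear[OF smooth_on_has_derivative[OF assms(1) that]]
    have "?D (\<Sum>i\<in>Basis. (w \<bullet> i) *\<^sub>R i) y = (\<Sum>i\<in>Basis. (w \<bullet> i) * ?D i y)"
      by (simp only: linear_sum[OF lin] linear_scale[OF lin] real_scaleR_def)
    then show ?thesis by (simp only: euclidean_representation)
  qed
  have int: "((\<lambda>t. ?D (z - z0) (z0 + t *\<^sub>R (z - z0))) has_integral
      f (z0 + 1 *\<^sub>R (z - z0)) - f (z0 + 0 *\<^sub>R (z - z0))) {0..1}"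
  proof (rule fundamental_theorem_of_calculus)
    fix t :: real assume t: "t \<in> {0..1}"
    have "((\<lambda>t. f (z0 + t *\<^sub>R (z - z0))) has_derivative (\<lambda>s. ?D (s *\<^sub>R (z - z0)) (z0 + t *\<^sub>R (z - z0)))) (at t)"
      by (rule has_derivative_compose[where f="\<lambda>t. z0 + t *\<^sub>R (z - z0)", OF _ deriv[OF t]])
        (auto intro!: derivative_eq_intros)
    then show "((\<lambda>t. f (z0 + t *\<^sub>R (z - z0))) has_vector_derivative ?D (z - z0) (z0 + t *\<^sub>R (z - z0)))
        (at t within {0..1})"
      using linear_scale[OF has_derivative_linear[OF deriv[OF t]]]
      by (simp add: has_vector_derivative_def has_derivative_at_withinI)
  qed simp
  have "((\<lambda>t. t ^ 0 * ?D i (z0 + t *\<^sub>R (z - z0))) has_integral ?h i z) (cbox 0 1)" for i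
  proof -
    have "continuous_on (cbox (0::real) 1) (\<lambda>t. (\<lambda>(z, t). t ^ 0 * ?D i (z0 + t *\<^sub>R (z - z0))) (z, t))"
      by (rule continuous_on_compose2[OF continuous_on_radial[OF smooth_on_continuous[OF Dsm]]])
        (use z in \<open>auto intro!: continuous_intros\<close>)
    then show ?thesis
      unfolding radial_integral_def by (intro integrable_integral integrable_continuous) simp
  qed
  then have "((\<lambda>t. \<Sum>i\<in>Basis. ((z - z0) \<bullet> i) * (t ^ 0 * ?D i (z0 + t *\<^sub>R (z - z0)))) has_integral
      (\<Sum>i\<in>Basis. ((z - z0) \<bullet> i) * ?h i z)) {0..1}"
    by (intro has_integral_sum has_integral_mult_right) auto
  then have "((\<lambda>t. ?D (z - z0) (z0 + t *\<^sub>R (z - z0))) has_integral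
      (\<Sum>i\<in>Basis. ((z - z0) \<bullet> i) * ?h i z)) {0..1}"
    by (rule has_integral_eq[rotated]) (simp add: expand[OF radial_point_in_ball[OF z], symmetric])
  from has_integral_unique[OF this int]
  show "f z = f z0 + (\<Sum>i\<in>Basis. ((z - z0) \<bullet> i) * ?h i z)" by simp
qed


section \<open>Vector fields on a manifold and tensoriality\<close>

lemma tangent_space_D:
  assumes "v \<in> tangent_space A p"
  shows "f \<in> smooth_functions A \<Longrightarrow> h \<in> smooth_functions A \<Longrightarrow> v (\<lambda>q. f q + h q) = v f + v h"
    and "f \<in> smooth_functions A \<Longrightarrow> v (\<lambda>q. c * f q) = c * v f"
    and "f \<in> smooth_functions A \<Longrightarrow> h \<in> smooth_functions A \<Longrightarrow>
      v (\<lambda>q. f q * h q) = f p * v h + v f * h p"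
    and "f \<notin> smooth_functions A \<Longrightarrow> v f = 0"
  using assms unfolding tangent_space_def linear_between_def
  by (auto simp: plus_fun_def times_fun_def scaleR_fun_def)

lemma tangent_space_I:
  assumes "\<And>f h. f \<in> smooth_functions A \<Longrightarrow> h \<in> smooth_functions A \<Longrightarrow> v (\<lambda>q. f q + h q) = v f + v h"
    and "\<And>f c. f \<in> smooth_functions A \<Longrightarrow> v (\<lambda>q. c * f q) = c * v f"
    and "\<And>f h. f \<in> smooth_functions A \<Longrightarrow> h \<in> smooth_functions A \<Longrightarrow>
      v (\<lambda>q. f q * h q) = f p * v h + v f * h p"
    and "\<And>f. f \<notin> smooth_functions A \<Longrightarrow> v f = 0"
  shows "v \<in> tangent_space A p"
  using assms unfolding tangent_space_def linear_between_def
  by (auto simp: plus_fun_def times_fun_def scaleR_fun_def)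

lemma subspace_tangent_space: "subspace (tangent_space A p)"
  unfolding subspace_def
  by (auto intro!: tangent_space_I simp: tangent_space_D plus_fun_def scaleR_fun_def algebra_simps zero_fun_def)

section \<open>Localisation in charts and coordinate fields\<close>

definition coord_deriv :: "'m set \<Rightarrow> ('m \<Rightarrow> 'e::euclidean_space) \<Rightarrow> 'e \<Rightarrow> ('m \<Rightarrow> real) \<Rightarrow> 'm \<Rightarrow> real" where
  "coord_deriv U x i f q = frechet_derivative (f \<circ> inv_into U x) (at (x q)) i"

definition cutoff ::
  "'m set \<Rightarrow> ('m \<Rightarrow> 'e::euclidean_space) \<Rightarrow> 'e \<Rightarrow> real \<Rightarrow> ('e \<Rightarrow> real) \<Rightarrow> 'm \<Rightarrow> real" where
  "cutoff U x z0 r u q = (if q \<in> U then bump z0 r (x q) * u (x q) else 0)"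

lemma sum_fun_apply: "(\<Sum>i\<in>I. g i) x = (\<Sum>i\<in>I. g i x)"
  by (induction I rule: infinite_finite_induct) (auto simp: zero_fun_def plus_fun_def)

locale manifold =
  fixes A :: "('m::{t2_space,second_countable_topology}, 'e::euclidean_space) chart set"
  assumes smooth_manifold: "smooth_manifold A"
begin

abbreviation "\<F> \<equiv> smooth_functions A"
abbreviation "T \<equiv> tangent_space A"
abbreviation "\<X> \<equiv> vector_fields A"

lemma chart_D:
  assumes "(U, x) \<in> A"
  shows "open U" "open (x ` U)" "inj_on x U" "homeomorphism U (x ` U) x (inv_into U x)"
    "continuous_on U x" "continuous_on (x ` U) (inv_into U x)"
proof -
  have "is_chart (U, x)" using assms smooth_manifold unfolding smooth_manifold_def by blast
  then have *: "open U \<and> open (x ` U) \<and> inj_on x U \<and> homeomorphism U (x ` U) x (inv_into U x)"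
    unfolding is_chart_def prod.case .
  show "open U" "open (x ` U)" "inj_on x U" "homeomorphism U (x ` U) x (inv_into U x)"
    using * by blast+
  show "continuous_on U x" "continuous_on (x ` U) (inv_into U x)"
    using * homeomorphism_cont1 homeomorphism_cont2 by blast+
qed

lemma chart_inverse: "(U, x) \<in> A \<Longrightarrow> q \<in> U \<Longrightarrow> inv_into U x (x q) = q"
  using chart_D(3) by simp

lemma chart_exists: obtains U x where "(U, x) \<in> A" "q \<in> U"
proof -
  have "q \<in> (\<Union>c\<in>A. fst c)" using smooth_manifold unfolding smooth_manifold_def by simp
  then obtain c where "c \<in> A" "q \<in> fst c" by blast
  then show ?thesis using that[of "fst c" "snd c"] by simp
qed

lemma open_chart_image:
  assumes "(U, x) \<in> A" "open W" "W \<subseteq> U"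
  shows "open (x ` W)"
proof -
  have "openin (top_of_set (x ` U)) (x ` W)"
    by (rule homeomorphism_imp_open_map[OF chart_D(4)[OF assms(1)]])
      (rule open_subset[OF assms(3,2)])
  then show ?thesis using openin_open_trans chart_D(2)[OF assms(1)] by blast
qed

lemma transition_smooth:
  "(U, x) \<in> A \<Longrightarrow> (V, y) \<in> A \<Longrightarrow> smooth_on (x ` (U \<inter> V)) (y \<circ> inv_into U x)"
  using smooth_manifold unfolding smooth_manifold_def by blast

lemma smooth_functionsD: "f \<in> \<F> \<Longrightarrow> (U, x) \<in> A \<Longrightarrow> smooth_on (x ` U) (f \<circ> inv_into U x)"
  unfolding smooth_functions_def by auto

lemma smooth_functionsI:
  "(\<And>U x. (U, x) \<in> A \<Longrightarrow> smooth_on (x ` U) (\<lambda>z. f (inv_into U x z))) \<Longrightarrow> f \<in> \<F>"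
  unfolding smooth_functions_def by (auto simp: comp_def)

lemma smooth_functions_const [simp]: "(\<lambda>q. c) \<in> \<F>"
  by (rule smooth_functionsI) simp

lemma smooth_functions_add: "f \<in> \<F> \<Longrightarrow> h \<in> \<F> \<Longrightarrow> (\<lambda>q. f q + h q) \<in> \<F>"
  by (rule smooth_functionsI)
    (use smooth_functionsD in \<open>auto intro!: smooth_on_add chart_D(2) simp: comp_def\<close>)

lemma smooth_functions_mult: "f \<in> \<F> \<Longrightarrow> h \<in> \<F> \<Longrightarrow> (\<lambda>q. f q * h q) \<in> \<F>"
  by (rule smooth_functionsI)
    (use smooth_functionsD in \<open>auto intro!: smooth_on_mult chart_D(2) simp: comp_def\<close>)

lemma smooth_functions_uminus: "f \<in> \<F> \<Longrightarrow> (\<lambda>q. - f q) \<in> \<F>"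
  using smooth_functions_mult[OF smooth_functions_const[of "- 1"], of f] by simp

lemma smooth_functions_diff: "f \<in> \<F> \<Longrightarrow> h \<in> \<F> \<Longrightarrow> (\<lambda>q. f q - h q) \<in> \<F>"
  using smooth_functions_add[OF _ smooth_functions_uminus, of f h] by simp

lemma smooth_functions_sum: "(\<And>i. i \<in> I \<Longrightarrow> f i \<in> \<F>) \<Longrightarrow> (\<lambda>q. \<Sum>i\<in>I. f i q) \<in> \<F>"
  by (induction I rule: infinite_finite_induct) (auto intro: smooth_functions_add)

lemma tangent_const: "v \<in> T p \<Longrightarrow> v (\<lambda>q. c) = 0"
  using tangent_space_D(3)[of v A p "\<lambda>q. 1" "\<lambda>q. 1"] tangent_space_D(2)[of v A p "\<lambda>q. 1" c] by simp

lemma tangent_diff: "v \<in> T p \<Longrightarrow> f \<in> \<F> \<Longrightarrow> h \<in> \<F> \<Longrightarrow> v (\<lambda>q. f q - h q) = v f - v h"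
  using tangent_space_D(1)[of v A p f "\<lambda>q. (- 1) * h q"] tangent_space_D(2)[of v A p h "- 1"]
    smooth_functions_uminus[of h] by simp

lemma tangent_sum:
  "v \<in> T p \<Longrightarrow> (\<And>i. i \<in> I \<Longrightarrow> f i \<in> \<F>) \<Longrightarrow> v (\<lambda>q. \<Sum>i\<in>I. f i q) = (\<Sum>i\<in>I. v (f i))"
proof (induction I rule: infinite_finite_induct)
  case (insert j I)
  then show ?case
    using tangent_space_D(1)[OF insert.prems(1), of "f j" "\<lambda>q. \<Sum>i\<in>I. f i q"] smooth_functions_sum[of I f]
    by auto
qed (auto simp: tangent_const)

text \<open>The manifold is covered by two open sets: the points of \<open>U\<close> with
  coordinates in \<open>N\<close>, where the function is a smooth expression in the chart
  \<open>x\<close>, and the complement of the preimage \<open>K\<close> of the closed ball, where it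
  is 0. In another chart \<open>y\<close> each piece is then smooth.\<close>

lemma cutoff_smooth:
  assumes c: "(U, x) \<in> A" and N: "open N" "cball z0 r \<subseteq> N" "N \<subseteq> x ` U" and "r > 0" and u: "smooth_on N u"
  shows "cutoff U x z0 r u \<in> \<F>"
proof (rule smooth_functionsI)
  fix V y assume d: "(V, y) \<in> A"
  define K where "K = inv_into U x ` cball z0 r"
  have "compact K"
    unfolding K_def by (rule compact_continuous_image[OF continuous_on_subset[OF chart_D(6)[OF c]]]) (use N in auto)
  \<comment> \<open>The Hausdorff property enters here: without it the extension by 0 could fail to
    be smooth at the boundary of \<open>U\<close>.\<close>
  then have K: "closed K" by (rule compact_imp_closed)
  have KU: "K \<subseteq> U" unfolding K_def using N inv_into_into[of _ x U] by blast
  let ?N = "U \<inter> x -` N"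
  have oN: "open ?N" using continuous_open_preimage[OF chart_D(5)[OF c] chart_D(1)[OF c] N(1)] .
  show "smooth_on (y ` V) (\<lambda>z. cutoff U x z0 r u (inv_into V y z))"
  proof (rule smooth_on_local)
    fix z assume "z \<in> y ` V"
    then obtain q where q: "q \<in> V" "z = y q" by auto
    show "\<exists>W. open W \<and> z \<in> W \<and> smooth_on W (\<lambda>z. cutoff U x z0 r u (inv_into V y z))"
    proof (cases "q \<in> ?N")
      case True
      let ?W = "y ` (V \<inter> ?N)"
      have W: "open ?W" using oN chart_D(1)[OF d] by (intro open_chart_image[OF d]) auto
      have im: "(x \<circ> inv_into V y) ` ?W \<subseteq> N" using chart_inverse[OF d] by auto
      have tr: "smooth_on ?W (x \<circ> inv_into V y)"
        by (rule smooth_on_subset[OF transition_smooth[OF d c]]) auto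
      have "smooth_on N (\<lambda>z. bump z0 r z * u z)"
        by (intro smooth_on_mult N u smooth_on_bump)
      from smooth_on_compose[OF W N(1) im tr this]
      have "smooth_on ?W (\<lambda>z. cutoff U x z0 r u (inv_into V y z))"
        by (rule smooth_on_cong[OF W, rotated]) (use chart_inverse[OF d] in \<open>auto simp: cutoff_def\<close>)
      then show ?thesis using W True q by blast
    next
      case False
      let ?W = "y ` (V - K)"
      have W: "open ?W" using K chart_D(1)[OF d] by (intro open_chart_image[OF d]) auto
      have "K \<subseteq> ?N"
        unfolding K_def using N inv_into_into[of _ x U] f_inv_into_f[of _ x U]
        by (auto simp del: mem_cball) (metis subsetD)+
      then have "q \<notin> K" using False by blast
      moreover have "cutoff U x z0 r u q' = 0" if "q' \<notin> K" for q'
      proof (cases "q' \<in> U")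
        case True
        have "x q' \<notin> cball z0 r"
        proof
          assume "x q' \<in> cball z0 r"
          then have "inv_into U x (x q') \<in> K" unfolding K_def by blast
          then show False using that chart_inverse[OF c True] by simp
        qed
        then have "bump z0 r (x q') = 0" by (rule bump_outside[OF \<open>r > 0\<close>])
        then show ?thesis by (simp add: cutoff_def)
      qed (simp add: cutoff_def)
      then have "smooth_on ?W (\<lambda>z. cutoff U x z0 r u (inv_into V y z))"
        by (intro smooth_on_cong[OF W _ smooth_on_const[of _ 0]]) (use chart_inverse[OF d] in auto)
      ultimately show ?thesis using W q by blast
    qed
  qed
qed

lemma coord_deriv_algebra:
  assumes c: "(U, x) \<in> A" and q: "q \<in> U" and f: "f \<in> \<F>" and h: "h \<in> \<F>"
  shows "coord_deriv U x i (\<lambda>q. f q + h q) q = coord_deriv U x i f q + coord_deriv U x i h q"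
    and "coord_deriv U x i (\<lambda>q. k * f q) q = k * coord_deriv U x i f q"
    and "coord_deriv U x i (\<lambda>q. f q * h q) q = f q * coord_deriv U x i h q + coord_deriv U x i f q * h q"
proof -
  have d: "((\<lambda>z. f (inv_into U x z)) has_derivative (\<lambda>i. coord_deriv U x i f q)) (at (x q))" if "f \<in> \<F>" for f
    using smooth_on_has_derivative[OF smooth_functionsD[OF that c]] q
    by (auto simp: coord_deriv_def comp_def)
  note D = has_derivative_add[OF d[OF f] d[OF h]] has_derivative_mult_right[OF d[OF f], of k]
    has_derivative_mult[OF d[OF f] d[OF h]]
  note E = D[THEN frechet_derivative_at, THEN fun_cong, of i]
  show "coord_deriv U x i (\<lambda>q. f q + h q) q = coord_deriv U x i f q + coord_deriv U x i h q"
    and "coord_deriv U x i (\<lambda>q. k * f q) q = k * coord_deriv U x i f q"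
    and "coord_deriv U x i (\<lambda>q. f q * h q) q = f q * coord_deriv U x i h q + coord_deriv U x i f q * h q"
    using E by (simp_all add: coord_deriv_def[of U x i "\<lambda>q. f q + h q"]
      coord_deriv_def[of U x i "\<lambda>q. k * f q"] coord_deriv_def[of U x i "\<lambda>q. f q * h q"]
      comp_def chart_inverse[OF c q])
qed

lemma coord_deriv_cutoff:
  assumes c: "(U, x) \<in> A" and "smooth_on N u" and q: "q \<in> U" "x q \<in> N"
  shows "coord_deriv U x i (cutoff U x z0 r u) q =
    bump z0 r (x q) * frechet_derivative u (at (x q)) i + frechet_derivative (bump z0 r) (at (x q)) i * u (x q)"
proof -
  have "((\<lambda>z. bump z0 r z * u z) has_derivative (\<lambda>i. bump z0 r (x q) * frechet_derivative u (at (x q)) i +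
      frechet_derivative (bump z0 r) (at (x q)) i * u (x q))) (at (x q))"
    by (intro has_derivative_mult smooth_on_has_derivative[OF assms(2) q(2)]
        smooth_on_has_derivative[OF smooth_on_bump[OF open_UNIV]] UNIV_I)
  then have "((cutoff U x z0 r u \<circ> inv_into U x) has_derivative (\<lambda>i. bump z0 r (x q) * frechet_derivative u (at (x q)) i +
      frechet_derivative (bump z0 r) (at (x q)) i * u (x q))) (at (x q))"
    by (rule has_derivative_transform_within_open[OF _ chart_D(2)[OF c]])
      (use q chart_inverse[OF c] in \<open>auto simp: cutoff_def\<close>)
  from fun_cong[OF frechet_derivative_at[OF this], of i] show ?thesis
    by (simp add: coord_deriv_def)
qed

text \<open>The coordinate field of direction \<open>i\<close> damped by a bump, so that it is
  defined on the whole manifold. The value 0 on non-smooth functions is the convention of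
  \<open>tangent_space\<close>.\<close>

definition coord_field :: "'m set \<Rightarrow> ('m \<Rightarrow> 'e) \<Rightarrow> 'e \<Rightarrow> real \<Rightarrow> 'e \<Rightarrow> 'm vfield" where
  "coord_field U x z0 r i q f =
    (if q \<in> U \<and> f \<in> \<F> then bump z0 r (x q) * coord_deriv U x i f q else 0)"

lemma coord_field_vector_field:
  assumes c: "(U, x) \<in> A" and N: "cball z0 r \<subseteq> x ` U" "r > 0"
  shows "coord_field U x z0 r i \<in> \<X>"
  unfolding vector_fields_def mem_Collect_eq
proof (intro conjI allI ballI)
  show "coord_field U x z0 r i q \<in> T q" for q
    by (rule tangent_space_I)
      (auto simp: coord_field_def coord_deriv_algebra[OF c] smooth_functions_add smooth_functions_mult algebra_simps)
  fix f assume f: "f \<in> \<F>"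
  have "cutoff U x z0 r (\<lambda>z. frechet_derivative (f \<circ> inv_into U x) (at z) i) \<in> \<F>"
    by (rule cutoff_smooth[OF c chart_D(2)[OF c] N(1) subset_refl N(2)
        smooth_on_frechet_derivative[OF smooth_functionsD[OF f c]]])
  moreover have "cutoff U x z0 r (\<lambda>z. frechet_derivative (f \<circ> inv_into U x) (at z) i) = act (coord_field U x z0 r i) f"
    using f by (auto simp: act_def fun_eq_iff cutoff_def coord_field_def coord_deriv_def)
  ultimately show "act (coord_field U x z0 r i) f \<in> \<F>" by simp
qed

text \<open>Hadamard's lemma writes \<open>f - f q\<close> near \<open>q\<close> as a sum of
  coordinate functions vanishing at \<open>q\<close> times smooth functions. By the Leibniz rule a
  derivation at \<open>q\<close> sees only the values of the latter at \<open>q\<close>, which are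
  the partial derivatives of \<open>f\<close>.\<close>

lemma tangent_coord_expansion:
  assumes c: "(U, x) \<in> A" and q: "q \<in> U" and v: "v \<in> T q"
  shows "\<exists>c. \<forall>f\<in>\<F>. v f = (\<Sum>i\<in>Basis. c i * coord_deriv U x i f q)"
proof -
  obtain R where R: "R > 0" "cball (x q) R \<subseteq> x ` U"
    using chart_D(2)[OF c] q open_contains_cball by blast
  define N where "N = ball (x q) R"
  define r where "r = R / 2"
  define \<beta> where "\<beta> = bump (x q) r (x q)"
  have N: "open N" "cball (x q) r \<subseteq> N" "N \<subseteq> x ` U" and r: "r > 0"
    using R by (auto simp: N_def r_def)
  have \<beta>: "\<beta> \<noteq> 0" unfolding \<beta>_def by (rule bump_center[OF r])
  define k where "k i = cutoff U x (x q) r (\<lambda>z. (z + (- x q)) \<bullet> i)" for i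
  define cu where "cu = cutoff U x (x q) r (\<lambda>z. 1)"
  note cut = cutoff_smooth[OF c N r]
  have k: "k i \<in> \<F>" for i
    unfolding k_def
    by (intro cut smooth_on_bounded_linear[OF bounded_linear_inner_left] smooth_on_add smooth_on_ident N smooth_on_const)
  have cu: "cu \<in> \<F>" unfolding cu_def by (rule cut) simp
  have "v f = (\<Sum>i\<in>Basis. (v (k i) / \<beta>) * coord_deriv U x i f q)" if f: "f \<in> \<F>" for f
  proof -
    have "smooth_on N (f \<circ> inv_into U x)"
      by (rule smooth_on_subset[OF smooth_functionsD[OF f c] N(3)])
    then obtain h where h: "\<And>i. smooth_on N (h i)"
        "\<And>i. h i (x q) = frechet_derivative (f \<circ> inv_into U x) (at (x q)) i"
        "\<And>z. z \<in> N \<Longrightarrow> (f \<circ> inv_into U x) z =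
          (f \<circ> inv_into U x) (x q) + (\<Sum>i\<in>Basis. ((z - x q) \<bullet> i) * h i z)"
      unfolding N_def by (rule hadamard[OF _ R(1)]) blast
    define H where "H i = cutoff U x (x q) r (h i)" for i
    have H: "H i \<in> \<F>" for i unfolding H_def by (rule cut[OF h(1)])
    \<comment> \<open>Derivations act on global functions, so Hadamard's identity is made global.
      Each product on the right carries two bumps, one in \<open>k i\<close> and one in
      \<open>H i\<close>; hence the two factors \<open>cu\<close> on the left.\<close>
    have eq: "(\<lambda>q'. cu q' * (cu q' * (f q' - f q))) = (\<lambda>q'. \<Sum>i\<in>Basis. k i q' * H i q')"
    proof
      fix q'
      show "cu q' * (cu q' * (f q' - f q)) = (\<Sum>i\<in>Basis. k i q' * H i q')"
      proof (cases "q' \<in> U \<and> x q' \<in> N")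
        case True
        then show ?thesis
          using h(3)[of "x q'"] chart_inverse[OF c] q
          by (simp add: cu_def k_def H_def cutoff_def sum_distrib_left algebra_simps)
      next
        case False
        have "bump (x q) r (x q') = 0" if "q' \<in> U"
          using bump_outside[OF r] False N(2) that by blast
        then show ?thesis by (auto simp: cu_def k_def H_def cutoff_def)
      qed
    qed
    have cuq: "cu q = \<beta>" using q by (simp add: cu_def cutoff_def \<beta>_def)
    have fq: "(\<lambda>q'. f q' - f q) \<in> \<F>" by (rule smooth_functions_diff[OF f smooth_functions_const])
    have "v (\<lambda>q'. cu q' * (cu q' * (f q' - f q))) = \<beta> * (\<beta> * v f)"
      using tangent_space_D(3)[OF v cu smooth_functions_mult[OF cu fq]] tangent_space_D(3)[OF v cu fq]
        tangent_diff[OF v f smooth_functions_const[of "f q"]] tangent_const[OF v]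
      by (simp add: cuq)
    moreover have "v (\<lambda>q'. \<Sum>i\<in>Basis. k i q' * H i q') = (\<Sum>i\<in>Basis. \<beta> * v (k i) * coord_deriv U x i f q)"
    proof -
      \<comment> \<open>As \<open>k i\<close> vanishes at \<open>q\<close>, the Leibniz rule leaves
        only \<open>v (k i) * H i q\<close>; the factor \<beta> in \<open>H i q\<close> against
        \<beta> squared on the other side explains the coefficient
        \<open>v (k i) / \<beta>\<close>.\<close>
      have "k i q = 0" "H i q = \<beta> * coord_deriv U x i f q" for i
        using q h(2) by (auto simp: k_def H_def cutoff_def \<beta>_def coord_deriv_def)
      then show ?thesis
        by (subst tangent_sum[OF v]) (auto intro!: smooth_functions_mult k H sum.cong simp: tangent_space_D(3)[OF v k H])
    qed
    ultimately have "\<beta> * (\<beta> * v f) = \<beta> * (\<beta> * (\<Sum>i\<in>Basis. (v (k i) / \<beta>) * coord_deriv U x i f q))"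
      unfolding eq using \<beta> by (simp add: sum_distrib_left mult.assoc)
    then show "v f = (\<Sum>i\<in>Basis. (v (k i) / \<beta>) * coord_deriv U x i f q)" using \<beta> by simp
  qed
  then show ?thesis by (intro exI[of _ "\<lambda>i. v (k i) / \<beta>"] ballI)
qed

section \<open>Global generating families and tensoriality\<close>

text \<open>A global replacement for a local frame around \<open>p\<close>: after multiplication by
  one function \<open>h\<close> with \<open>h p \<noteq> 0\<close>, every field is a smooth
  combination of the globally defined \<open>E i\<close>. The final clause on coefficients vanishing
  at \<open>p\<close> is what makes tensoriality work.\<close>

definition frame_at :: "'m \<Rightarrow> ('m \<Rightarrow> real) \<Rightarrow> ('e \<Rightarrow> 'm vfield) \<Rightarrow> bool" where
  "frame_at p h E \<longleftrightarrow> h \<in> \<F> \<and> h p \<noteq> 0 \<and> (\<forall>i. E i \<in> \<X>) \<and>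
    (\<forall>v\<in>T p. \<exists>c. v = (\<Sum>i\<in>Basis. c i *\<^sub>R E i p)) \<and>
    (\<forall>X\<in>\<X>. \<exists>a. (\<forall>i. a i \<in> \<F>) \<and> fscale h X = (\<Sum>i\<in>Basis. fscale (a i) (E i)) \<and>
      (X p = 0 \<longrightarrow> (\<forall>i. a i p = 0)))"

lemma frame_exists: "\<exists>h E. frame_at p h E"
proof -
  obtain U x where c: "(U, x) \<in> A" and p: "p \<in> U" by (rule chart_exists)
  obtain r where r: "r > 0" and N: "cball (x p) r \<subseteq> x ` U"
    using chart_D(2)[OF c] p open_contains_cball by blast
  define b where "b q = bump (x p) r (x q)" for q
  note cut = cutoff_smooth[OF c chart_D(2)[OF c] N subset_refl r]
  define cu where "cu = cutoff U x (x p) r (\<lambda>z. 1)"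
  define k where "k j = cutoff U x (x p) r (\<lambda>z. z \<bullet> j)" for j
  define E where "E = coord_field U x (x p) r"
  have sm1: "smooth_on (x ` U) (\<lambda>z. 1)" by simp
  have smj: "smooth_on (x ` U) (\<lambda>z. z \<bullet> j)" for j
    by (intro smooth_on_bounded_linear[OF bounded_linear_inner_left] smooth_on_ident chart_D(2)[OF c])
  have cu: "cu \<in> \<F>" unfolding cu_def by (rule cut[OF sm1])
  have k: "k j \<in> \<F>" for j unfolding k_def by (rule cut[OF smj])
  have E: "E i \<in> \<X>" for i unfolding E_def by (rule coord_field_vector_field[OF c N r])
  have b: "b p \<noteq> 0" unfolding b_def by (rule bump_center[OF r])
  have cu_eq: "cu q = (if q \<in> U then b q else 0)" for q by (simp add: cu_def cutoff_def b_def)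
  have E_eq: "E i q f = (if q \<in> U \<and> f \<in> \<F> then b q * coord_deriv U x i f q else 0)" for i q f
    by (simp add: E_def coord_field_def b_def)
  \<comment> \<open>Three bump factors: one sits in the damped coordinate field \<open>E i\<close>,
    two in the coefficient \<open>a i\<close> below.\<close>
  have "frame_at p (\<lambda>q. cu q * (cu q * cu q)) E"
    unfolding frame_at_def
  proof (intro conjI allI ballI)
    show "(\<lambda>q. cu q * (cu q * cu q)) \<in> \<F>" by (intro smooth_functions_mult cu)
    show "cu p * (cu p * cu p) \<noteq> 0" using b p by (simp add: cu_eq)
    show "E i \<in> \<X>" for i by (rule E)
  next
    fix v assume v: "v \<in> T p"
    obtain d where d: "\<forall>f\<in>\<F>. v f = (\<Sum>i\<in>Basis. d i * coord_deriv U x i f p)"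
      using tangent_coord_expansion[OF c p v] by blast
    have "v f = (\<Sum>i\<in>Basis. (d i / b p) *\<^sub>R E i p) f" for f
      using d b p tangent_space_D(4)[OF v] by (cases "f \<in> \<F>") (simp_all add: sum_fun_apply scaleR_fun_def E_eq)
    then have "v = (\<Sum>i\<in>Basis. (d i / b p) *\<^sub>R E i p)" by (rule ext)
    then show "\<exists>c. v = (\<Sum>i\<in>Basis. c i *\<^sub>R E i p)"
      by (rule exI[of _ "\<lambda>i. d i / b p"])
  next
    fix X assume X: "X \<in> \<X>"
    then have XT: "X q \<in> T q" and XF: "f \<in> \<F> \<Longrightarrow> act X f \<in> \<F>" for q f
      by (auto simp: vector_fields_def)
    \<comment> \<open>The numerator of the quotient rule for \<open>k j / cu\<close>, which is the
      \<open>j\<close>-th coordinate on \<open>U\<close> wherever the bump is nonzero. The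
      derivatives of the bump cancel, leaving the bump squared times the \<open>j\<close>-th
      component of \<open>X\<close>, while every term is globally smooth.\<close>
    define a where "a j q = cu q * act X (k j) q - k j q * act X cu q" for j q
    have a: "a j \<in> \<F>" for j
      unfolding a_def by (intro smooth_functions_diff smooth_functions_mult XF cu k)
    have "fscale (\<lambda>q. cu q * (cu q * cu q)) X q f = (\<Sum>i\<in>Basis. fscale (a i) (E i)) q f" for q f
    proof (cases "q \<in> U \<and> f \<in> \<F>")
      case True
      then have q: "q \<in> U" and f: "f \<in> \<F>" by auto
      obtain d where d: "\<forall>f\<in>\<F>. X q f = (\<Sum>i\<in>Basis. d i * coord_deriv U x i f q)"
        using tangent_coord_expansion[OF c q XT] by blast
      let ?db = "\<lambda>i. frechet_derivative (bump (x p) r) (at (x q)) i"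
      have "coord_deriv U x i cu q = ?db i" for i
        using coord_deriv_cutoff[OF c sm1 q, of i "x p" r] q
        by (simp add: cu_def frechet_derivative_const)
      then have Xcu: "act X cu q = (\<Sum>i\<in>Basis. d i * ?db i)"
        using d cu by (simp add: act_def)
      have "frechet_derivative (\<lambda>z. z \<bullet> j) (at (x q)) i = i \<bullet> j" for i j :: 'e
        using frechet_derivative_at[OF bounded_linear_imp_has_derivative[OF bounded_linear_inner_left[of j]]]
        by metis
      then have "coord_deriv U x i (k j) q = b q * (i \<bullet> j) + ?db i * (x q \<bullet> j)" for i j
        using coord_deriv_cutoff[OF c smj q, of i "x p" r j] q by (simp add: k_def b_def)
      then have 1: "act X (k j) q = (\<Sum>i\<in>Basis. d i * (b q * (i \<bullet> j) + ?db i * (x q \<bullet> j)))" for j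
        using d k by (simp add: act_def)
      have 2: "act X (k j) q = (\<Sum>i\<in>Basis. b q * d i * (i \<bullet> j)) + (x q \<bullet> j) * act X cu q" for j
        unfolding 1 Xcu by (simp add: sum_distrib_left sum.distrib[symmetric] algebra_simps)
      have "act X (k j) q = b q * d j + (x q \<bullet> j) * act X cu q" if "j \<in> Basis" for j
        unfolding 2 using that by (simp add: inner_Basis if_distrib cong: if_cong)
      then have "a j q = b q * b q * d j" if "j \<in> Basis" for j
        using that q by (simp add: a_def cu_eq k_def cutoff_def b_def algebra_simps)
      then show ?thesis
        using d q f by (simp add: fscale_def scaleR_fun_def sum_fun_apply E_eq cu_eq sum_distrib_left mult.assoc mult.left_commute)
    next
      case False
      then show ?thesis
        using tangent_space_D(4)[OF XT, of f q] by (auto simp: fscale_def scaleR_fun_def sum_fun_apply E_eq cu_eq)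
    qed
    moreover have "a j p = 0" if "X p = 0" for j
      using that by (simp add: a_def act_def zero_fun_def)
    ultimately show "\<exists>a. (\<forall>i. a i \<in> \<F>) \<and> fscale (\<lambda>q. cu q * (cu q * cu q)) X = (\<Sum>i\<in>Basis. fscale (a i) (E i)) \<and>
        (X p = 0 \<longrightarrow> (\<forall>i. a i p = 0))"
      using a by (intro exI[of _ a]) (auto simp: fun_eq_iff)
  qed
  then show ?thesis by blast
qed

lemma vector_fieldsD: "X \<in> \<X> \<Longrightarrow> X p \<in> T p" "X \<in> \<X> \<Longrightarrow> f \<in> \<F> \<Longrightarrow> act X f \<in> \<F>"
  by (auto simp: vector_fields_def)

lemma vector_fields_add: "X \<in> \<X> \<Longrightarrow> Y \<in> \<X> \<Longrightarrow> X + Y \<in> \<X>"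
  using subspace_add[OF subspace_tangent_space[of A]] smooth_functions_add
  unfolding vector_fields_def by (simp add: act_def plus_fun_def)

lemma vector_fields_fscale: "f \<in> \<F> \<Longrightarrow> X \<in> \<X> \<Longrightarrow> fscale f X \<in> \<X>"
  using subspace_scale[OF subspace_tangent_space[of A]] smooth_functions_mult
  unfolding vector_fields_def by (simp add: act_def fscale_def scaleR_fun_def)

lemma fscale_const: "fscale (\<lambda>q. c) X = c *\<^sub>R X"
  by (simp add: fscale_def scaleR_fun_def)

lemma vector_fields_scaleR: "X \<in> \<X> \<Longrightarrow> c *\<^sub>R X \<in> \<X>"
  using vector_fields_fscale[OF smooth_functions_const, of X c] by (simp add: fscale_const)

lemma vector_fields_diff: "X \<in> \<X> \<Longrightarrow> Y \<in> \<X> \<Longrightarrow> X - Y \<in> \<X>"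
  using vector_fields_add[OF _ vector_fields_scaleR, of X Y "- 1"] by simp

lemma vector_fields_zero: "0 \<in> \<X>"
  using subspace_0[OF subspace_tangent_space]
  unfolding vector_fields_def by (auto simp: act_def zero_fun_def)

lemma vector_fields_sum: "(\<And>i. i \<in> I \<Longrightarrow> X i \<in> \<X>) \<Longrightarrow> (\<Sum>i\<in>I. X i) \<in> \<X>"
  by (induction I rule: infinite_finite_induct) (auto intro: vector_fields_add vector_fields_zero)

text \<open>Apply \<open>F\<close> to \<open>fscale h (X - Y)\<close>: one side is
  \<open>h p *\<^sub>R F (X - Y)\<close>, the other a sum with coefficients
  \<open>a i p = 0\<close>. The multiplier \<open>h\<close> takes the place of a separate locality
  argument.\<close>

lemma tensorial:
  fixes F :: "'m vfield \<Rightarrow> 'b::real_vector"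
  assumes add: "\<And>X Y. X \<in> \<X> \<Longrightarrow> Y \<in> \<X> \<Longrightarrow> F (X + Y) = F X + F Y"
    and scale: "\<And>f X. f \<in> \<F> \<Longrightarrow> X \<in> \<X> \<Longrightarrow> F (fscale f X) = f p *\<^sub>R F X"
    and X: "X \<in> \<X>" and Y: "Y \<in> \<X>" and eq: "X p = Y p"
  shows "F X = F Y"
proof -
  obtain h E where fr: "frame_at p h E" using frame_exists by blast
  then have h: "h \<in> \<F>" "h p \<noteq> 0" and E: "\<And>i. E i \<in> \<X>" by (simp_all add: frame_at_def)
  have Z: "X - Y \<in> \<X>" by (rule vector_fields_diff[OF X Y])
  have "(X - Y) p = 0" using eq by simp
  then obtain a where a: "\<And>i. a i \<in> \<F>" "fscale h (X - Y) = (\<Sum>i\<in>(Basis :: 'e set). fscale (a i) (E i))"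
      "\<And>i. a i p = 0"
    using fr Z unfolding frame_at_def by blast
  have zero: "F 0 = 0"
    using scale[OF smooth_functions_const[of 0] X] by (simp add: fscale_const)
  have sum: "finite I \<Longrightarrow> F (\<Sum>i\<in>I. fscale (a i) (E i)) = (\<Sum>i\<in>I. F (fscale (a i) (E i)))" for I
  proof (induction I rule: finite_induct)
    case (insert i I)
    have "F (\<Sum>j\<in>insert i I. fscale (a j) (E j)) = F (fscale (a i) (E i)) + F (\<Sum>j\<in>I. fscale (a j) (E j))"
      unfolding sum.insert[OF insert.hyps]
      by (intro add vector_fields_sum vector_fields_fscale a(1) E)
    then show ?case unfolding insert.IH sum.insert[OF insert.hyps] .
  qed (simp only: sum.empty zero)
  have "h p *\<^sub>R F (X - Y) = F (\<Sum>i\<in>(Basis :: 'e set). fscale (a i) (E i))"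
    using scale[OF h(1) Z] a(2) by simp
  also have "\<dots> = 0" using sum[of Basis] scale[OF a(1) E] a(3) by simp
  finally have "F (X - Y) = 0" using h(2) by simp
  moreover have "F X = F (X - Y) + F Y" using add[OF Z Y] by simp
  ultimately show ?thesis by simp
qed

text \<open>Justifies the choice operator in \<open>extension\<close>: a combination of the
  \<open>E i\<close> with constant coefficients already extends \<open>u\<close>.\<close>

lemma extension: "u \<in> T p \<Longrightarrow> extension A p u \<in> \<X>" "u \<in> T p \<Longrightarrow> extension A p u p = u"
proof -
  have "\<exists>X. X \<in> \<X> \<and> X p = u" if u: "u \<in> T p"
  proof -
    obtain h E where fr: "frame_at p h E" using frame_exists by blast
    then have E: "\<And>i. E i \<in> \<X>" by (simp add: frame_at_def)
    obtain c where "u = (\<Sum>i\<in>(Basis :: 'e set). c i *\<^sub>R E i p)" using fr u unfolding frame_at_def by blast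
    then have "(\<Sum>i\<in>(Basis :: 'e set). c i *\<^sub>R E i) p = u"
      by (simp add: sum_fun_apply scaleR_fun_def)
    moreover have "(\<Sum>i\<in>(Basis :: 'e set). c i *\<^sub>R E i) \<in> \<X>"
      by (intro vector_fields_sum vector_fields_scaleR E)
    ultimately show ?thesis by blast
  qed
  then have "u \<in> T p \<Longrightarrow> extension A p u \<in> \<X> \<and> extension A p u p = u"
    unfolding extension_def by (rule someI_ex)
  then show "u \<in> T p \<Longrightarrow> extension A p u \<in> \<X>" "u \<in> T p \<Longrightarrow> extension A p u p = u" by auto
qed

lemma tangent_space_finite_dim: "\<exists>S. finite S \<and> T p \<subseteq> span S"
proof -
  obtain h E where fr: "frame_at p h E" using frame_exists by blast
  have "v \<in> span ((\<lambda>i. E i p) ` Basis)" if v: "v \<in> T p" for v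
  proof -
    obtain c where "v = (\<Sum>i\<in>(Basis :: 'e set). c i *\<^sub>R E i p)" using fr v unfolding frame_at_def by blast
    then show ?thesis by (auto intro: span_sum span_scale span_base)
  qed
  then show ?thesis by (intro exI[of _ "(\<lambda>i. E i p) ` Basis"]) auto
qed

end


section \<open>Traces and nondegenerate forms\<close>

lemma linear_between_combination:
  assumes h: "linear_between V W h" and V: "subspace V" and v: "\<And>i. i \<in> I \<Longrightarrow> v i \<in> V" and "finite I"
  shows "h (\<Sum>i\<in>I. a i *\<^sub>R v i) = (\<Sum>i\<in>I. a i *\<^sub>R h (v i))"
  using assms(4) v
proof (induction I rule: finite_induct)
  case empty
  have "h (0 *\<^sub>R 0) = 0 *\<^sub>R h 0" using h subspace_0[OF V] unfolding linear_between_def by blast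
  then show ?case by simp
next
  case (insert i I)
  have mem: "a i *\<^sub>R v i \<in> V" "(\<Sum>j\<in>I. a j *\<^sub>R v j) \<in> V" "v i \<in> V"
    using insert.prems by (auto intro!: subspace_sum[OF V] subspace_scale[OF V])
  have "h (a i *\<^sub>R v i + (\<Sum>j\<in>I. a j *\<^sub>R v j)) = a i *\<^sub>R h (v i) + h (\<Sum>j\<in>I. a j *\<^sub>R v j)"
    using h mem unfolding linear_between_def by simp
  then show ?case using insert by simp
qed

text \<open>Linear algebra for an indefinite metric on one tangent space. Finite dimension is a
  hypothesis on the subspace because the ambient type, functionals on functions, is
  infinite-dimensional in general.\<close>

locale nondegenerate_form =
  fixes V :: "'a::real_vector set" and b :: "'a \<Rightarrow> 'a \<Rightarrow> real"
  assumes V: "subspace V"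
    and finite_dim: "\<exists>S. finite S \<and> V \<subseteq> span S"
    and bilinear: "bilinear_form_on V b"
    and symmetric: "u \<in> V \<Longrightarrow> v \<in> V \<Longrightarrow> b u v = b v u"
    and nondegenerate: "u \<in> V \<Longrightarrow> (\<And>v. v \<in> V \<Longrightarrow> b u v = 0) \<Longrightarrow> u = 0"
begin

text \<open>Literally the choice term inside \<open>trace_on\<close>, so that the trace unfolds to a
  sum over this very basis.\<close>

definition "\<B> = (SOME B. independent B \<and> span B = V)"

lemma basis: "independent \<B>" "span \<B> = V" "finite \<B>" "c \<in> \<B> \<Longrightarrow> c \<in> V"
proof -
  obtain B where B: "B \<subseteq> V" "independent B" "V \<subseteq> span B"
    by (rule maximal_independent_subset)
  have "span B = V" using B span_minimal[OF B(1) V] by blast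
  then have "independent B \<and> span B = V" using B(2) by blast
  then have *: "independent \<B> \<and> span \<B> = V" unfolding \<B>_def by (rule someI)
  then show "independent \<B>" "span \<B> = V" by blast+
  obtain S where S: "finite S" "V \<subseteq> span S" using finite_dim by blast
  have "\<B> \<subseteq> span S" using * S(2) span_superset[of \<B>] by blast
  then show "finite \<B>" using independent_span_bound[OF S(1)] * by blast
  show "c \<in> \<B> \<Longrightarrow> c \<in> V" using * span_superset[of \<B>] by blast
qed

lemma linear_left: "v \<in> V \<Longrightarrow> linear_between V UNIV (\<lambda>u. b u v)"
  and linear_right: "u \<in> V \<Longrightarrow> linear_between V UNIV (\<lambda>v. b u v)"
  using bilinear unfolding bilinear_form_on_def by blast+

lemma diff_left:
  assumes "u \<in> V" "v \<in> V" "w \<in> V"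
  shows "b (u - v) w = b u w - b v w"
proof -
  have "b (u + (- 1) *\<^sub>R v) w = b u w + b ((- 1) *\<^sub>R v) w" "b ((- 1) *\<^sub>R v) w = (- 1) *\<^sub>R b v w"
    using linear_left[OF assms(3)] assms(1,2) subspace_scale[OF V assms(2)] unfolding linear_between_def
    by blast+
  then show ?thesis by simp
qed

lemmas combination_left = linear_between_combination[OF linear_left V]
lemmas combination_right = linear_between_combination[OF linear_right V]

lemma basis_expand: "v \<in> V \<Longrightarrow> (\<Sum>c\<in>\<B>. representation \<B> v c *\<^sub>R c) = v"
  using sum_representation_eq[of \<B> v \<B>] basis by simp

lemma dual_basis_exists: "\<exists>d. \<forall>c\<in>\<B>. d c \<in> V \<and> (\<forall>e\<in>\<B>. b (d c) e = (if e = c then 1 else 0))"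
proof -
  obtain f where f: "linear f" "\<forall>c\<in>\<B>. f c = (\<Sum>e\<in>\<B>. b c e *\<^sub>R e)"
    using linear_independent_extend[OF basis(1), of "\<lambda>c. \<Sum>e\<in>\<B>. b c e *\<^sub>R e"] by blast
  have f_eq: "f v = (\<Sum>e\<in>\<B>. b v e *\<^sub>R e)" if v: "v \<in> V" for v
  proof -
    let ?r = "representation \<B> v"
    have "b v e = (\<Sum>c\<in>\<B>. ?r c * b c e)" if "e \<in> \<B>" for e
      using combination_left[OF basis(4)[OF that] basis(4) basis(3), of "\<lambda>c. c" ?r] basis_expand[OF v] by simp
    then have "(\<Sum>e\<in>\<B>. b v e *\<^sub>R e) = (\<Sum>e\<in>\<B>. \<Sum>c\<in>\<B>. ?r c *\<^sub>R b c e *\<^sub>R e)"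
      by (simp add: scaleR_sum_left)
    also have "\<dots> = (\<Sum>c\<in>\<B>. \<Sum>e\<in>\<B>. ?r c *\<^sub>R b c e *\<^sub>R e)" by (rule sum.swap)
    also have "\<dots> = (\<Sum>c\<in>\<B>. ?r c *\<^sub>R f c)" by (rule sum.cong) (simp_all add: f(2) scaleR_sum_right)
    also have "\<dots> = f (\<Sum>c\<in>\<B>. ?r c *\<^sub>R c)" by (simp only: linear_sum[OF f(1)] linear_scale[OF f(1)])
    finally show ?thesis using basis_expand[OF v] by simp
  qed
  have fV: "f v \<in> V" if "v \<in> V" for v
    unfolding f_eq[OF that] by (intro subspace_sum[OF V] subspace_scale[OF V] basis(4))
  have coeff: "a e = a' e" if eq: "(\<Sum>e\<in>\<B>. a e *\<^sub>R e) = (\<Sum>e\<in>\<B>. a' e *\<^sub>R e)" and e: "e \<in> \<B>" for a a' :: "'a \<Rightarrow> real" and e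
  proof -
    have "(\<Sum>e\<in>\<B>. (a e - a' e) *\<^sub>R e) = 0" using eq by (simp add: scaleR_left_diff_distrib sum_subtractf)
    from independentD[OF basis(1,3) subset_refl this e] show ?thesis by simp
  qed
  have ker: "v = 0" if v: "v \<in> V" and "f v = 0" for v
  proof (rule nondegenerate[OF v])
    fix w assume w: "w \<in> V"
    have "(\<Sum>e\<in>\<B>. b v e *\<^sub>R e) = (\<Sum>e\<in>\<B>. 0 *\<^sub>R e)" using that f_eq by simp
    from coeff[OF this] have "b v e = 0" if "e \<in> \<B>" for e using that .
    then show "b v w = 0"
      using combination_right[OF v basis(4) basis(3), of "\<lambda>c. c" "representation \<B> w"] basis_expand[OF w] by simp
  qed
  have inj: "inj_on f V"
  proof (rule inj_onI)
    fix u v assume uv: "u \<in> V" "v \<in> V" "f u = f v"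
    then have "f (u - v) = 0" by (simp add: linear_diff[OF f(1)])
    then show "u = v" using ker[OF subspace_diff[OF V uv(1,2)]] by simp
  qed
  have ind: "independent (f ` \<B>)"
    by (rule linear_independent_injective_image[OF f(1) basis(1)]) (simp add: basis inj)
  have card: "card (f ` \<B>) = card \<B>"
    by (rule card_image) (rule inj_on_subset[OF inj], use basis(4) in blast)
  have "c \<in> f ` V" if c: "c \<in> \<B>" for c
  proof (rule ccontr)
    assume "c \<notin> f ` V"
    then have c': "c \<notin> span (f ` \<B>)" by (simp add: linear_span_image[OF f(1)] basis)
    then have ind': "independent (insert c (f ` \<B>))" using ind by (rule independent_insertI)
    have sub: "insert c (f ` \<B>) \<subseteq> span \<B>" using basis fV c by auto
    have "card (insert c (f ` \<B>)) \<le> card \<B>"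
      using independent_span_bound[OF basis(3) ind' sub] by blast
    moreover have "c \<notin> f ` \<B>" using c' span_base[of c "f ` \<B>"] by blast
    ultimately show False using card basis(3) by simp
  qed
  then have "\<forall>c\<in>\<B>. \<exists>w. w \<in> V \<and> f w = c" by blast
  then obtain d where d: "\<forall>c\<in>\<B>. d c \<in> V \<and> f (d c) = c"
    using bchoice[of \<B> "\<lambda>c w. w \<in> V \<and> f w = c"] by blast
  have "b (d c) e = (if e = c then 1 else 0)" if c: "c \<in> \<B>" and e: "e \<in> \<B>" for c e
  proof -
    have "(\<Sum>e\<in>\<B>. b (d c) e *\<^sub>R e) = f (d c)" using f_eq d c by simp
    also have "\<dots> = (\<Sum>e\<in>\<B>. (if e = c then 1 else 0) *\<^sub>R e)"
      using d c basis(3) by (simp add: if_distrib[of "\<lambda>x. x *\<^sub>R _"] cong: if_cong)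
    finally show ?thesis using coeff[of "\<lambda>e. b (d c) e" "\<lambda>e. if e = c then 1 else 0", OF _ e] by simp
  qed
  then show ?thesis using d by blast
qed

definition "dual = (SOME d. \<forall>c\<in>\<B>. d c \<in> V \<and> (\<forall>e\<in>\<B>. b (d c) e = (if e = c then 1 else 0)))"

lemma dual: "c \<in> \<B> \<Longrightarrow> dual c \<in> V" "c \<in> \<B> \<Longrightarrow> e \<in> \<B> \<Longrightarrow> b (dual c) e = (if e = c then 1 else 0)"
  using someI_ex[OF dual_basis_exists] unfolding dual_def by blast+

lemma representation_dual:
  assumes v: "v \<in> V" and c: "c \<in> \<B>"
  shows "representation \<B> v c = b v (dual c)"
proof -
  have "b (dual c) v = (\<Sum>e\<in>\<B>. representation \<B> v e * (if e = c then 1 else 0))"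
    using combination_right[OF dual(1)[OF c] basis(4) basis(3), of "\<lambda>c. c" "representation \<B> v"]
      basis_expand[OF v] dual(2)[OF c] by simp
  also have "\<dots> = representation \<B> v c"
    using c basis(3) by (simp add: if_distrib cong: if_cong)
  finally show ?thesis using symmetric[OF v dual(1)[OF c]] by simp
qed

lemma expand: "v \<in> V \<Longrightarrow> (\<Sum>c\<in>\<B>. b v (dual c) *\<^sub>R c) = v"
  using basis_expand[of v] by (simp add: representation_dual)

section \<open>Traces computed through the dual basis\<close>

text \<open>Coordinates are pairings with dual vectors; every later rule for traces starts from this
  formula.\<close>

lemma trace_dual:
  assumes "\<And>u. u \<in> V \<Longrightarrow> h u \<in> V"
  shows "trace_on V h = (\<Sum>c\<in>\<B>. b (h c) (dual c))"
  unfolding trace_on_def Let_def \<B>_def[symmetric]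
  by (rule sum.cong) (simp_all add: representation_dual assms basis(4))

text \<open>Expanding the dual vectors in the basis, both sums become the contraction of \<beta>
  with the matrix \<open>b (dual c) (dual e)\<close>, which is symmetric.\<close>

lemma contraction_symmetric:
  assumes \<beta>: "bilinear_form_on V \<beta>"
  shows "(\<Sum>c\<in>\<B>. \<beta> c (dual c)) = (\<Sum>c\<in>\<B>. \<beta> (dual c) c)"
proof -
  have l: "linear_between V UNIV (\<lambda>u. \<beta> u v)" and r: "linear_between V UNIV (\<lambda>u. \<beta> v u)" if "v \<in> V" for v
    using \<beta> that unfolding bilinear_form_on_def by blast+
  have "\<beta> c (dual c) = (\<Sum>e\<in>\<B>. b (dual c) (dual e) * \<beta> c e)"
    and "\<beta> (dual c) c = (\<Sum>e\<in>\<B>. b (dual e) (dual c) * \<beta> e c)" if c: "c \<in> \<B>" for c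
    using linear_between_combination[OF r[OF basis(4)[OF c]] V basis(4) basis(3), of "\<lambda>c. c" "\<lambda>e. b (dual c) (dual e)"]
      linear_between_combination[OF l[OF basis(4)[OF c]] V basis(4) basis(3), of "\<lambda>c. c" "\<lambda>e. b (dual c) (dual e)"]
      expand[OF dual(1)[OF c]] symmetric[OF dual(1) dual(1)[OF c]] by simp_all
  then show ?thesis using sum.swap[of "\<lambda>c e. b (dual c) (dual e) * \<beta> c e" \<B> \<B>] by simp
qed

lemma trace_comp:
  assumes h: "linear_between V V h" and k: "linear_between V V k"
  shows "trace_on V (\<lambda>u. h (k u)) = trace_on V (\<lambda>u. k (h u))"
proof -
  have hV: "h u \<in> V" and kV: "k u \<in> V" if "u \<in> V" for u
    using h k that unfolding linear_between_def by blast+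
  have *: "b (h (k c)) (dual c) = (\<Sum>e\<in>\<B>. b (k c) (dual e) * b (h e) (dual c))"
    if h: "linear_between V V h" and k: "\<And>u. u \<in> V \<Longrightarrow> k u \<in> V" and c: "c \<in> \<B>" for h k c
  proof -
    have hV: "h e \<in> V" if "e \<in> V" for e using h that unfolding linear_between_def by blast
    have "h (k c) = (\<Sum>e\<in>\<B>. b (k c) (dual e) *\<^sub>R h e)"
      using linear_between_combination[OF h V basis(4) basis(3), of "\<lambda>c. c" "\<lambda>e. b (k c) (dual e)"]
        expand[OF k[OF basis(4)[OF c]]] by simp
    then show ?thesis
      using combination_left[OF dual(1)[OF c] hV[OF basis(4)] basis(3), of "\<lambda>c. c" "\<lambda>e. b (k c) (dual e)"] by simp
  qed
  have "trace_on V (\<lambda>u. h (k u)) = (\<Sum>c\<in>\<B>. \<Sum>e\<in>\<B>. b (k c) (dual e) * b (h e) (dual c))"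
    using *[of h k, OF h kV] by (simp add: trace_dual hV kV)
  also have "\<dots> = (\<Sum>c\<in>\<B>. \<Sum>e\<in>\<B>. b (h c) (dual e) * b (k e) (dual c))"
    by (subst sum.swap) (simp add: mult.commute)
  also have "\<dots> = trace_on V (\<lambda>u. k (h u))"
    using *[of k h, OF k hV] by (simp add: trace_dual hV kV)
  finally show ?thesis .
qed

text \<open>Every correction term of the later trace computations has this form and is evaluated
  here.\<close>

lemma trace_rank_one:
  assumes \<omega>: "linear_between V UNIV \<omega>" and w: "w \<in> V"
  shows "trace_on V (\<lambda>u. \<omega> u *\<^sub>R w) = \<omega> w"
proof -
  have s: "\<omega> c *\<^sub>R w \<in> V" for c by (rule subspace_scale[OF V w])
  have "trace_on V (\<lambda>u. \<omega> u *\<^sub>R w) = (\<Sum>c\<in>\<B>. b (\<omega> c *\<^sub>R w) (dual c))"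
    by (rule trace_dual) (rule s)
  also have "\<dots> = (\<Sum>c\<in>\<B>. b w (dual c) * \<omega> c)"
    by (rule sum.cong) (use linear_left[OF dual(1)] w in \<open>auto simp: linear_between_def\<close>)
  also have "\<dots> = \<omega> w"
    using linear_between_combination[OF \<omega> V basis(4) basis(3), of "\<lambda>c. c" "\<lambda>c. b w (dual c)"] expand[OF w] by simp
  finally show ?thesis .
qed

lemma trace_add:
  assumes "\<And>u. u \<in> V \<Longrightarrow> h u \<in> V" "\<And>u. u \<in> V \<Longrightarrow> k u \<in> V"
  shows "trace_on V (\<lambda>u. h u + k u) = trace_on V h + trace_on V k"
proof -
  have "b (h c + k c) (dual c) = b (h c) (dual c) + b (k c) (dual c)" if "c \<in> \<B>" for c
    using linear_left[OF dual(1)[OF that]] assms basis(4)[OF that] unfolding linear_between_def by blast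
  then show ?thesis
    by (simp add: trace_dual assms subspace_add[OF V] sum.distrib)
qed

lemma trace_scale:
  assumes "\<And>u. u \<in> V \<Longrightarrow> h u \<in> V"
  shows "trace_on V (\<lambda>u. a *\<^sub>R h u) = a * trace_on V h"
proof -
  have "b (a *\<^sub>R h c) (dual c) = a * b (h c) (dual c)" if "c \<in> \<B>" for c
    using linear_left[OF dual(1)[OF that]] assms basis(4)[OF that] unfolding linear_between_def by simp
  then show ?thesis
    by (simp add: trace_dual assms subspace_scale[OF V] sum_distrib_left)
qed

lemma trace_cong:
  assumes "\<And>u. u \<in> V \<Longrightarrow> h u = k u" "\<And>u. u \<in> V \<Longrightarrow> h u \<in> V"
  shows "trace_on V h = trace_on V k"
  using assms basis(4) by (simp add: trace_dual assms(1)[symmetric])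

text \<open>Exchanges the roles of basis and dual basis; with symmetry of \<open>b\<close> this says
  that \<open>h\<close> and its adjoint have equal trace.\<close>

lemma trace_adjoint:
  assumes h: "linear_between V V h"
  shows "(\<Sum>c\<in>\<B>. b c (h (dual c))) = trace_on V h"
proof -
  have hV: "h u \<in> V" if "u \<in> V" for u using h that unfolding linear_between_def by blast
  have "bilinear_form_on V (\<lambda>u v. b u (h v))"
    using h bilinear hV unfolding bilinear_form_on_def linear_between_def by simp
  from contraction_symmetric[OF this] show ?thesis
    by (simp add: trace_dual hV symmetric[OF dual(1) hV[OF basis(4)]])
qed

lemma representable:
  assumes \<omega>: "linear_between V UNIV \<omega>"
  shows "\<exists>w\<in>V. \<forall>v\<in>V. b w v = \<omega> v"
proof (rule bexI[of _ "\<Sum>c\<in>\<B>. \<omega> c *\<^sub>R dual c"], rule ballI)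
  show "(\<Sum>c\<in>\<B>. \<omega> c *\<^sub>R dual c) \<in> V" by (intro subspace_sum[OF V] subspace_scale[OF V] dual)
  fix v assume v: "v \<in> V"
  have "b (\<Sum>c\<in>\<B>. \<omega> c *\<^sub>R dual c) v = (\<Sum>c\<in>\<B>. \<omega> c * b (dual c) v)"
    using combination_left[OF v dual(1) basis(3), of "\<lambda>c. c" \<omega>] by simp
  also have "\<dots> = (\<Sum>c\<in>\<B>. b v (dual c) * \<omega> c)"
    by (rule sum.cong) (simp_all add: symmetric[OF v dual(1)])
  also have "\<dots> = \<omega> v"
    using linear_between_combination[OF \<omega> V basis(4) basis(3), of "\<lambda>c. c" "\<lambda>c. b v (dual c)"] expand[OF v] by simp
  finally show "b (\<Sum>c\<in>\<B>. \<omega> c *\<^sub>R dual c) v = \<omega> v" .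
qed

text \<open>Nondegeneracy gives existence and uniqueness of the representing vector, so the definite
  description in \<open>ricci_operator\<close> is meaningful and can be tested against a
  candidate.\<close>

lemma the_representative_eq:
  assumes "linear_between V UNIV \<omega>" "w \<in> V"
  shows "(THE w. w \<in> V \<and> (\<forall>v\<in>V. b w v = \<omega> v)) = w \<longleftrightarrow> (\<forall>v\<in>V. b w v = \<omega> v)"
proof -
  have uniq: "w = w'" if "w \<in> V" "w' \<in> V" "\<forall>v\<in>V. b w v = \<omega> v" "\<forall>v\<in>V. b w' v = \<omega> v" for w w'
  proof -
    have "w - w' = 0"
    proof (rule nondegenerate[OF subspace_diff[OF V that(1,2)]])
      show "b (w - w') v = 0" if v: "v \<in> V" for v
        using diff_left[OF \<open>w \<in> V\<close> \<open>w' \<in> V\<close> v] \<open>\<forall>v\<in>V. b w v = \<omega> v\<close> \<open>\<forall>v\<in>V. b w' v = \<omega> v\<close> v by simp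
    qed
    then show ?thesis by simp
  qed
  obtain w0 where w0: "w0 \<in> V" "\<forall>v\<in>V. b w0 v = \<omega> v" using representable[OF assms(1)] by blast
  have "(THE w. w \<in> V \<and> (\<forall>v\<in>V. b w v = \<omega> v)) = w0"
    by (rule the_equality) (use w0 uniq in blast)+
  then show ?thesis using w0 uniq[OF w0(1) assms(2) w0(2)] by auto
qed

end


section \<open>Curvature of the Levi-Civita connection\<close>

text \<open>Metric and connection are parameters because the locale is instantiated both with
  \<open>g\<close>, \<open>D\<close> and with \<open>g'\<close>, \<open>D'\<close>.\<close>

locale levi_civita_manifold = manifold A
  for A :: "('m::{t2_space,second_countable_topology}, 'e::euclidean_space) chart set" +
  fixes g :: "'m bform" and D :: "'m connection"
  assumes tensor: "tensor_field_02 A g"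
    and g_sym: "u \<in> T p \<Longrightarrow> v \<in> T p \<Longrightarrow> g p u v = g p v u"
    and g_nondegenerate: "u \<in> T p \<Longrightarrow> (\<And>v. v \<in> T p \<Longrightarrow> g p u v = 0) \<Longrightarrow> u = 0"
    and levi_civita: "levi_civita A g D"

sublocale levi_civita_manifold \<subseteq> tangent: nondegenerate_form "T p" "g p" for p
proof
  show "subspace (T p)" by (rule subspace_tangent_space)
  show "\<exists>S. finite S \<and> T p \<subseteq> span S" by (rule tangent_space_finite_dim)
  show "bilinear_form_on (T p) (g p)" using tensor unfolding tensor_field_02_def by blast
qed (rule g_sym g_nondegenerate; assumption)+

context levi_civita_manifold
begin

lemmas T_add = subspace_add[OF tangent.V]
lemmas T_diff = subspace_diff[OF tangent.V]
lemmas T_scale = subspace_scale[OF tangent.V]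
lemmas T_neg = subspace_neg[OF tangent.V]
lemmas T_zero = subspace_0[OF tangent.V]
lemmas T_simps = T_add T_diff T_scale T_neg T_zero

lemma g_scale_left: "u \<in> T p \<Longrightarrow> w \<in> T p \<Longrightarrow> g p (a *\<^sub>R u) w = a * g p u w"
  using tangent.linear_left[of w p] unfolding linear_between_def by simp

lemma g_scale_right: "u \<in> T p \<Longrightarrow> w \<in> T p \<Longrightarrow> g p w (a *\<^sub>R u) = a * g p w u"
  using tangent.linear_right[of w p] unfolding linear_between_def by simp

lemma g_linear_left:
  assumes "u \<in> T p" "v \<in> T p" "w \<in> T p"
  shows "g p (u + v) w = g p u w + g p v w" "g p (u - v) w = g p u w - g p v w"
  using tangent.linear_left[OF assms(3)] tangent.diff_left[OF assms] assms(1,2)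
  unfolding linear_between_def by simp_all

lemma g_linear_right:
  assumes "u \<in> T p" "v \<in> T p" "w \<in> T p"
  shows "g p w (u + v) = g p w u + g p w v" "g p w (u - v) = g p w u - g p w v"
  using g_linear_left[OF assms] assms by (simp_all add: g_sym[of w] T_simps)

lemma g_zero: "w \<in> T p \<Longrightarrow> g p 0 w = 0" "w \<in> T p \<Longrightarrow> g p w 0 = 0"
  using g_scale_left[OF T_zero, of w p 0] g_scale_right[OF T_zero, of w p 0] by simp_all

lemmas g_linear = g_linear_left g_linear_right g_scale_left g_scale_right g_zero

lemma g_smooth: "X \<in> \<X> \<Longrightarrow> Y \<in> \<X> \<Longrightarrow> (\<lambda>q. g q (X q) (Y q)) \<in> \<F>"
  using tensor unfolding tensor_field_02_def by blast

lemma affine: "affine_connection A D"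
  using levi_civita unfolding levi_civita_def by blast

lemma D_closed: "X \<in> \<X> \<Longrightarrow> Y \<in> \<X> \<Longrightarrow> D X Y \<in> \<X>"
  using affine unfolding affine_connection_def by blast

lemma D_add:
  assumes "X \<in> \<X>" "Y \<in> \<X>" "Z \<in> \<X>"
  shows "D (X + Y) Z = D X Z + D Y Z" "D X (Y + Z) = D X Y + D X Z"
  using affine assms unfolding affine_connection_def by blast+

lemma D_fscale:
  assumes "f \<in> \<F>" "X \<in> \<X>" "Y \<in> \<X>"
  shows "D (fscale f X) Y = fscale f (D X Y)" "D X (fscale f Y) = fscale (act X f) Y + fscale f (D X Y)"
  using affine assms unfolding affine_connection_def by blast+

lemma D_scaleR:
  assumes "X \<in> \<X>" "Y \<in> \<X>"
  shows "D (c *\<^sub>R X) Y = c *\<^sub>R D X Y" "D X (c *\<^sub>R Y) = c *\<^sub>R D X Y"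
proof -
  have "act X (\<lambda>q. c) = (\<lambda>q. 0)"
    using tangent_const[OF vector_fieldsD(1)[OF assms(1)]] by (simp add: act_def fun_eq_iff)
  then show "D (c *\<^sub>R X) Y = c *\<^sub>R D X Y" "D X (c *\<^sub>R Y) = c *\<^sub>R D X Y"
    using D_fscale[OF smooth_functions_const[of c] assms] by (simp_all add: fscale_const)
qed

lemma D_diff:
  assumes "X \<in> \<X>" "Y \<in> \<X>" "Z \<in> \<X>"
  shows "D (X - Y) Z = D X Z - D Y Z" "D X (Y - Z) = D X Y - D X Z"
  using D_add(1)[OF assms(1) vector_fields_scaleR[OF assms(2), of "- 1"] assms(3)]
    D_add(2)[OF assms(1,2) vector_fields_scaleR[OF assms(3), of "- 1"]]
    D_scaleR(1)[OF assms(2,3), of "- 1"] D_scaleR(2)[OF assms(1,3), of "- 1"]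
  by simp_all

lemma torsion_free: "X \<in> \<X> \<Longrightarrow> Y \<in> \<X> \<Longrightarrow> lie_bracket X Y = D X Y - D Y X"
  using levi_civita unfolding levi_civita_def by simp

lemma compat:
  "X \<in> \<X> \<Longrightarrow> Y \<in> \<X> \<Longrightarrow> Z \<in> \<X> \<Longrightarrow>
    X p (\<lambda>q. g q (Y q) (Z q)) = g p (D X Y p) (Z p) + g p (Y p) (D X Z p)"
  using levi_civita unfolding levi_civita_def by blast

lemma lie_bracket_closed: "X \<in> \<X> \<Longrightarrow> Y \<in> \<X> \<Longrightarrow> lie_bracket X Y \<in> \<X>"
  by (simp add: torsion_free vector_fields_diff D_closed)

lemma act_lie_bracket: "act (lie_bracket X Y) f p = X p (act Y f) - Y p (act X f)"
  by (simp add: act_def lie_bracket_def)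

lemma field_at: "X \<in> \<X> \<Longrightarrow> X p \<in> T p"
  by (rule vector_fieldsD(1))

lemma fscale_at: "fscale f X p = f p *\<^sub>R X p"
  by (simp add: fscale_def)

lemma scaleR_at: "(c *\<^sub>R X) p = c *\<^sub>R X p"
  by (simp add: scaleR_fun_def)

section \<open>Tensoriality of curvature and Ricci tensor\<close>

text \<open>Torsion-freeness removes the bracket, so that scaling \<open>X\<close> by a function is
  handled by the two rules for \<open>D\<close> alone.\<close>

lemma curvature_eq:
  assumes "X \<in> \<X>" "Y \<in> \<X>" "Z \<in> \<X>"
  shows "curvature D X Y Z = D X (D Y Z) - D Y (D X Z) - (D (D X Y) Z - D (D Y X) Z)"
  unfolding curvature_def torsion_free[OF assms(1,2)]
  by (simp only: D_diff D_closed assms)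

lemma curvature_closed:
  assumes "X \<in> \<X>" "Y \<in> \<X>" "Z \<in> \<X>"
  shows "curvature D X Y Z \<in> \<X>"
  unfolding curvature_eq[OF assms] by (intro vector_fields_diff D_closed assms)

lemma curvature_add:
  assumes "X \<in> \<X>" "X' \<in> \<X>" "Y \<in> \<X>" "Z \<in> \<X>"
  shows "curvature D (X + X') Y Z p = curvature D X Y Z p + curvature D X' Y Z p"
    and "curvature D Y Z (X + X') p = curvature D Y Z X p + curvature D Y Z X' p"
  using assms by (simp_all add: curvature_eq vector_fields_add D_add D_closed)

lemma curvature_fscale_first:
  assumes "f \<in> \<F>" "X \<in> \<X>" "Y \<in> \<X>" "Z \<in> \<X>"
  shows "curvature D (fscale f X) Y Z p = f p *\<^sub>R curvature D X Y Z p"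
  using assms
  by (simp add: curvature_eq vector_fields_fscale vector_fields_add vector_fieldsD(2) D_add D_fscale D_closed
      fscale_at algebra_simps)

text \<open>Here the bracket is kept: the second-order terms \<open>X (Y f) - Y (X f)\<close> cancel
  against the derivative of \<open>f\<close> along \<open>lie_bracket X Y\<close>.\<close>

lemma curvature_fscale_last:
  assumes "f \<in> \<F>" "X \<in> \<X>" "Y \<in> \<X>" "Z \<in> \<X>"
  shows "curvature D X Y (fscale f Z) p = f p *\<^sub>R curvature D X Y Z p"
  using assms
  by (simp add: curvature_def vector_fields_fscale vector_fields_add vector_fieldsD(2) D_add D_fscale D_closed
      lie_bracket_closed fscale_at act_lie_bracket algebra_simps) (simp add: act_def)

lemma curvature_antisym:
  assumes "X \<in> \<X>" "Y \<in> \<X>" "Z \<in> \<X>"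
  shows "curvature D X Y Z p = - curvature D Y X Z p"
  using assms by (simp add: curvature_eq)

text \<open>Tensoriality in the outer slots is direct; the middle slot is reached by
  antisymmetry.\<close>

lemma curvature_cong:
  assumes "X \<in> \<X>" "X' \<in> \<X>" "Y \<in> \<X>" "Y' \<in> \<X>" "Z \<in> \<X>" "Z' \<in> \<X>"
    and "X p = X' p" "Y p = Y' p" "Z p = Z' p"
  shows "curvature D X Y Z p = curvature D X' Y' Z' p"
proof -
  have 1: "curvature D X Y Z p = curvature D X' Y Z p" if "X \<in> \<X>" "X' \<in> \<X>" "Y \<in> \<X>" "Z \<in> \<X>" "X p = X' p" for X X' Y Z
    by (rule tensorial[where F="\<lambda>X. curvature D X Y Z p"])
      (use that in \<open>simp_all add: curvature_add curvature_fscale_first\<close>)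
  have 2: "curvature D X Y Z p = curvature D X Y Z' p" if "Z \<in> \<X>" "Z' \<in> \<X>" "X \<in> \<X>" "Y \<in> \<X>" "Z p = Z' p" for X Y Z Z'
    by (rule tensorial[where F="\<lambda>Z. curvature D X Y Z p"])
      (use that in \<open>simp_all add: curvature_add curvature_fscale_last\<close>)
  have "curvature D X Y Z p = curvature D X' Y Z p" by (rule 1) (use assms in simp_all)
  also have "\<dots> = - curvature D Y X' Z p" by (rule curvature_antisym) (use assms in simp_all)
  also have "\<dots> = - curvature D Y' X' Z p" using 1[of Y Y' X' Z] assms by simp
  also have "\<dots> = curvature D X' Y' Z p" using curvature_antisym[of X' Y' Z p] assms by simp
  also have "\<dots> = curvature D X' Y' Z' p" by (rule 2) (use assms in simp_all)
  finally show ?thesis .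
qed

text \<open>The chosen extensions in \<open>curvature_at\<close> may be replaced by any convenient
  fields with the same values at \<open>p\<close>.\<close>

lemma curvature_at_eq:
  assumes "X \<in> \<X>" "Y \<in> \<X>" "Z \<in> \<X>"
  shows "curvature_at A D p (X p) (Y p) (Z p) = curvature D X Y Z p"
  unfolding curvature_at_def
  by (rule curvature_cong) (use assms in \<open>simp_all add: extension field_at\<close>)

lemma curvature_at_closed:
  assumes "u \<in> T p" "v \<in> T p" "w \<in> T p"
  shows "curvature_at A D p u v w \<in> T p"
  unfolding curvature_at_def by (intro field_at curvature_closed extension(1)[of _ p] assms)

lemma linear_curvature_at:
  assumes "v \<in> T p" "w \<in> T p"
  shows "linear_between (T p) (T p) (\<lambda>u. curvature_at A D p u v w)"
    and "linear_between (T p) (T p) (\<lambda>u. curvature_at A D p v w u)"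
    and "linear_between (T p) (T p) (\<lambda>u. curvature_at A D p v u w)"
proof -
  let ?E = "extension A p"
  have add: "curvature_at A D p (u + u') v w = curvature_at A D p u v w + curvature_at A D p u' v w"
      "curvature_at A D p v w (u + u') = curvature_at A D p v w u + curvature_at A D p v w u'"
    if "u \<in> T p" "u' \<in> T p" "v \<in> T p" "w \<in> T p" for u u' v w
  proof -
    have E: "?E u \<in> \<X>" "?E u' \<in> \<X>" "?E v \<in> \<X>" "?E w \<in> \<X>" using extension(1)[of _ p] that by blast+
    have "curvature_at A D p ((?E u + ?E u') p) (?E v p) (?E w p) = curvature D (?E u + ?E u') (?E v) (?E w) p"
        "curvature_at A D p (?E v p) (?E w p) ((?E u + ?E u') p) = curvature D (?E v) (?E w) (?E u + ?E u') p"
      by (intro curvature_at_eq vector_fields_add E)+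
    then show "curvature_at A D p (u + u') v w = curvature_at A D p u v w + curvature_at A D p u' v w"
        "curvature_at A D p v w (u + u') = curvature_at A D p v w u + curvature_at A D p v w u'"
      unfolding curvature_add[OF E] curvature_add(2)[OF E(1,2,3,4)]
      using that by (simp_all add: extension(2) curvature_at_def[of A D p u] curvature_at_def[of A D p u']
          curvature_at_def[of A D p v w u] curvature_at_def[of A D p v w u'])
  qed
  have scale: "curvature_at A D p (c *\<^sub>R u) v w = c *\<^sub>R curvature_at A D p u v w"
      "curvature_at A D p v w (c *\<^sub>R u) = c *\<^sub>R curvature_at A D p v w u"
    if "u \<in> T p" "v \<in> T p" "w \<in> T p" for c u v w
  proof -
    have E: "?E u \<in> \<X>" "?E v \<in> \<X>" "?E w \<in> \<X>" using extension(1)[of _ p] that by blast+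
    note c = smooth_functions_const[of c]
    have "curvature_at A D p (fscale (\<lambda>q. c) (?E u) p) (?E v p) (?E w p) = curvature D (fscale (\<lambda>q. c) (?E u)) (?E v) (?E w) p"
        "curvature_at A D p (?E v p) (?E w p) (fscale (\<lambda>q. c) (?E u) p) = curvature D (?E v) (?E w) (fscale (\<lambda>q. c) (?E u)) p"
      by (intro curvature_at_eq vector_fields_fscale c E)+
    then show "curvature_at A D p (c *\<^sub>R u) v w = c *\<^sub>R curvature_at A D p u v w"
        "curvature_at A D p v w (c *\<^sub>R u) = c *\<^sub>R curvature_at A D p v w u"
      unfolding curvature_fscale_first[OF c E] curvature_fscale_last[OF c E(2,3,1)]
      using that by (simp_all add: extension(2) fscale_at curvature_at_def[of A D p u]
          curvature_at_def[of A D p v w u])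
  qed
  have anti: "curvature_at A D p v u w = - curvature_at A D p u v w" if "u \<in> T p" "v \<in> T p" "w \<in> T p" for u v w
    unfolding curvature_at_def by (rule curvature_antisym) (simp_all add: extension[of _ p] that)
  show "linear_between (T p) (T p) (\<lambda>u. curvature_at A D p u v w)"
    and "linear_between (T p) (T p) (\<lambda>u. curvature_at A D p v w u)"
    unfolding linear_between_def using assms by (simp_all add: add scale curvature_at_closed)
  show "linear_between (T p) (T p) (\<lambda>u. curvature_at A D p v u w)"
    unfolding linear_between_def using assms
    by (simp add: add scale curvature_at_closed anti[of _ v w] T_simps)
qed

lemma linear_ricci:
  assumes v: "v \<in> T p"
  shows "linear_between (T p) UNIV (ricci A D p v)"
    and "linear_between (T p) UNIV (\<lambda>u. ricci A D p u v)"
proof -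
  note lin = linear_curvature_at[unfolded linear_between_def]
  have add: "ricci A D p v (w + w') = ricci A D p v w + ricci A D p v w'"
       "ricci A D p (w + w') v = ricci A D p w v + ricci A D p w' v"
    if w: "w \<in> T p" "w' \<in> T p" for w w'
  proof -
    have "trace_on (T p) (\<lambda>u. curvature_at A D p u v (w + w')) =
        trace_on (T p) (\<lambda>u. curvature_at A D p u v w + curvature_at A D p u v w')"
      by (rule tangent.trace_cong) (use lin(2)[of _ p v] v w in \<open>simp_all add: curvature_at_closed T_simps\<close>)
    then show "ricci A D p v (w + w') = ricci A D p v w + ricci A D p v w'"
      unfolding ricci_def by (simp add: tangent.trace_add curvature_at_closed v w)
    have "trace_on (T p) (\<lambda>u. curvature_at A D p u (w + w') v) =
        trace_on (T p) (\<lambda>u. curvature_at A D p u w v + curvature_at A D p u w' v)"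
      by (rule tangent.trace_cong) (use lin(3)[of _ p v] v w in \<open>simp_all add: curvature_at_closed T_simps\<close>)
    then show "ricci A D p (w + w') v = ricci A D p w v + ricci A D p w' v"
      unfolding ricci_def by (simp add: tangent.trace_add curvature_at_closed v w)
  qed
  have scale: "ricci A D p v (c *\<^sub>R w) = c * ricci A D p v w" "ricci A D p (c *\<^sub>R w) v = c * ricci A D p w v"
    if w: "w \<in> T p" for w c
  proof -
    have "trace_on (T p) (\<lambda>u. curvature_at A D p u v (c *\<^sub>R w)) =
        trace_on (T p) (\<lambda>u. c *\<^sub>R curvature_at A D p u v w)"
      by (rule tangent.trace_cong) (use lin(2)[of _ p v] v w in \<open>simp_all add: curvature_at_closed T_simps\<close>)
    then show "ricci A D p v (c *\<^sub>R w) = c * ricci A D p v w"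
      unfolding ricci_def by (simp add: tangent.trace_scale curvature_at_closed v w)
    have "trace_on (T p) (\<lambda>u. curvature_at A D p u (c *\<^sub>R w) v) =
        trace_on (T p) (\<lambda>u. c *\<^sub>R curvature_at A D p u w v)"
      by (rule tangent.trace_cong) (use lin(3)[of _ p v] v w in \<open>simp_all add: curvature_at_closed T_simps\<close>)
    then show "ricci A D p (c *\<^sub>R w) v = c * ricci A D p w v"
      unfolding ricci_def by (simp add: tangent.trace_scale curvature_at_closed v w)
  qed
  show "linear_between (T p) UNIV (ricci A D p v)" "linear_between (T p) UNIV (\<lambda>u. ricci A D p u v)"
    unfolding linear_between_def using add scale by simp_all
qed

text \<open>Only the components orthogonal to \<open>\<xi>\<close> matter: \<open>Ric(\<xi>, \<xi>)\<close> is by definition the trace of the Jacobi operator.\<close>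

lemma ricci_xi_condition_iff:
  assumes \<xi>: "\<xi> \<in> \<X>" and unit: "\<And>p. g p (\<xi> p) (\<xi> p) = 1"
  shows "ricci_xi_condition A g D \<xi> \<longleftrightarrow>
    (\<forall>p. \<forall>v\<in>T p. g p (\<xi> p) v = 0 \<longrightarrow> ricci A D p (\<xi> p) v = 0)"
  unfolding ricci_xi_condition_def
proof (rule all_cong1)
  fix p
  let ?\<tau> = "trace_on (T p) (jacobi_operator A D \<xi> p)"
  have \<xi>p: "\<xi> p \<in> T p" by (rule field_at[OF \<xi>])
  have \<tau>: "?\<tau> = ricci A D p (\<xi> p) (\<xi> p)"
    by (simp add: ricci_def jacobi_operator_def[abs_def])
  note lin = linear_ricci(1)[OF \<xi>p, unfolded linear_between_def]
  have "ricci_operator A g D p (\<xi> p) = ?\<tau> *\<^sub>R \<xi> p \<longleftrightarrow>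
      (\<forall>v\<in>T p. g p (?\<tau> *\<^sub>R \<xi> p) v = ricci A D p (\<xi> p) v)"
    unfolding ricci_operator_def
    by (rule tangent.the_representative_eq[OF linear_ricci(1)[OF \<xi>p] T_scale[OF \<xi>p]])
  also have "\<dots> \<longleftrightarrow> (\<forall>v\<in>T p. g p (\<xi> p) v = 0 \<longrightarrow> ricci A D p (\<xi> p) v = 0)"
  proof (intro iffI ballI impI)
    fix v assume *: "\<forall>v\<in>T p. g p (?\<tau> *\<^sub>R \<xi> p) v = ricci A D p (\<xi> p) v" and v: "v \<in> T p" "g p (\<xi> p) v = 0"
    have "g p (?\<tau> *\<^sub>R \<xi> p) v = 0" using g_scale_left[OF \<xi>p v(1)] v(2) by simp
    then show "ricci A D p (\<xi> p) v = 0" using * v(1) by simp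
  next
    fix v assume *: "\<forall>v\<in>T p. g p (\<xi> p) v = 0 \<longrightarrow> ricci A D p (\<xi> p) v = 0" and v: "v \<in> T p"
    let ?a = "g p (\<xi> p) v"
    have w: "v - ?a *\<^sub>R \<xi> p \<in> T p" by (intro T_diff T_scale v \<xi>p)
    have "g p (\<xi> p) (v - ?a *\<^sub>R \<xi> p) = 0"
      using v \<xi>p by (simp add: g_linear T_simps unit)
    then have "ricci A D p (\<xi> p) (v - ?a *\<^sub>R \<xi> p) = 0" using * w by simp
    moreover have "ricci A D p (\<xi> p) ((v - ?a *\<^sub>R \<xi> p) + ?a *\<^sub>R \<xi> p) =
        ricci A D p (\<xi> p) (v - ?a *\<^sub>R \<xi> p) + ?a * ricci A D p (\<xi> p) (\<xi> p)"
      using lin w T_scale[OF \<xi>p] \<xi>p by (metis real_scaleR_def)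
    ultimately have "ricci A D p (\<xi> p) v = ?a * ?\<tau>" unfolding \<tau> by simp
    then show "g p (?\<tau> *\<^sub>R \<xi> p) v = ricci A D p (\<xi> p) v"
      using g_scale_left[OF \<xi>p v] by simp
  qed
  finally show "ricci_operator A g D p (\<xi> p) = ?\<tau> *\<^sub>R \<xi> p \<longleftrightarrow>
      (\<forall>v\<in>T p. g p (\<xi> p) v = 0 \<longrightarrow> ricci A D p (\<xi> p) v = 0)" .
qed

end


section \<open>Paracontact metric structures\<close>

locale paracontact_manifold = levi_civita_manifold A g D
  for A :: "('m::{t2_space,second_countable_topology}, 'e::euclidean_space) chart set"
    and g :: "'m bform" and D :: "'m connection" +
  fixes n :: nat and \<phi> :: "'m \<Rightarrow> 'm tvec \<Rightarrow> 'm tvec" and \<xi> :: "'m vfield" and \<eta> :: "'m \<Rightarrow> 'm tvec \<Rightarrow> real"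
  assumes paracontact: "paracontact_metric A n \<phi> \<xi> \<eta> g"
begin

lemma almost_paracontact: "almost_paracontact A n \<phi> \<xi> \<eta>"
  using paracontact unfolding paracontact_metric_def by blast

lemma \<xi>: "\<xi> \<in> \<X>" and \<phi>_\<xi>: "\<phi> p (\<xi> p) = 0" and \<eta>_\<xi>: "\<eta> p (\<xi> p) = 1"
  using almost_paracontact unfolding almost_paracontact_def by blast+

lemma \<xi>_at: "\<xi> p \<in> T p" by (rule field_at[OF \<xi>])

lemma \<eta>_\<phi>: "u \<in> T p \<Longrightarrow> \<eta> p (\<phi> p u) = 0"
  and \<phi>_\<phi>: "u \<in> T p \<Longrightarrow> \<phi> p (\<phi> p u) = u - \<eta> p u *\<^sub>R \<xi> p"
  using almost_paracontact unfolding almost_paracontact_def by blast+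

lemma linear_\<phi>: "linear_between (T p) (T p) (\<phi> p)"
  and \<phi>_field: "X \<in> \<X> \<Longrightarrow> (\<lambda>p. \<phi> p (X p)) \<in> \<X>"
  using almost_paracontact unfolding almost_paracontact_def tensor_field_11_def by blast+

lemma linear_\<eta>: "linear_between (T p) UNIV (\<eta> p)"
  and \<eta>_smooth: "X \<in> \<X> \<Longrightarrow> (\<lambda>p. \<eta> p (X p)) \<in> \<F>"
  using almost_paracontact unfolding almost_paracontact_def one_form_def by blast+

lemma \<phi>_closed: "u \<in> T p \<Longrightarrow> \<phi> p u \<in> T p"
  using linear_\<phi> unfolding linear_between_def by blast

lemma \<phi>_scale: "u \<in> T p \<Longrightarrow> \<phi> p (a *\<^sub>R u) = a *\<^sub>R \<phi> p u"
  using linear_\<phi> unfolding linear_between_def by blast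

lemma \<phi>_add: "u \<in> T p \<Longrightarrow> v \<in> T p \<Longrightarrow> \<phi> p (u + v) = \<phi> p u + \<phi> p v"
  using linear_\<phi> unfolding linear_between_def by blast

lemma \<phi>_diff:
  assumes "u \<in> T p" "v \<in> T p"
  shows "\<phi> p (u - v) = \<phi> p u - \<phi> p v"
proof -
  have "\<phi> p (u + (- 1) *\<^sub>R v) = \<phi> p u + (- 1) *\<^sub>R \<phi> p v"
    unfolding \<phi>_add[OF assms(1) T_scale[OF assms(2)]] \<phi>_scale[OF assms(2)] ..
  then show ?thesis by simp
qed

lemmas \<phi>_linear = \<phi>_scale \<phi>_add \<phi>_diff

text \<open>Compatibility with second argument \<xi>: the left side vanishes because \<phi> kills
  \<xi>.\<close>

lemma \<eta>_eq:
  assumes u: "u \<in> T p"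
  shows "\<eta> p u = g p u (\<xi> p)"
proof -
  have "g p (\<phi> p u) (\<phi> p (\<xi> p)) = - g p u (\<xi> p) + \<eta> p u * \<eta> p (\<xi> p)"
    using paracontact u \<xi>_at unfolding paracontact_metric_def compatible_metric_def by blast
  then show ?thesis by (simp add: \<phi>_\<xi> \<eta>_\<xi> g_zero \<phi>_closed u)
qed

lemma \<eta>_scale: "u \<in> T p \<Longrightarrow> \<eta> p (a *\<^sub>R u) = a * \<eta> p u"
  by (simp add: \<eta>_eq g_linear T_simps \<xi>_at)

lemma \<eta>_add: "u \<in> T p \<Longrightarrow> v \<in> T p \<Longrightarrow> \<eta> p (u + v) = \<eta> p u + \<eta> p v"
  by (simp add: \<eta>_eq g_linear T_simps \<xi>_at)

lemma \<eta>_diff: "u \<in> T p \<Longrightarrow> v \<in> T p \<Longrightarrow> \<eta> p (u - v) = \<eta> p u - \<eta> p v"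
  by (simp add: \<eta>_eq g_linear T_simps \<xi>_at)

lemmas \<eta>_linear = \<eta>_scale \<eta>_add \<eta>_diff

text \<open>Compatibility for \<open>u\<close> and \<open>\<phi> p v\<close>: expanding \<phi>
  squared leaves a \<xi>-term that is orthogonal to the image of \<phi>.\<close>

lemma g_\<phi>:
  assumes u: "u \<in> T p" and v: "v \<in> T p"
  shows "g p (\<phi> p u) v = - g p u (\<phi> p v)"
proof -
  have "g p (\<phi> p u) (\<phi> p (\<phi> p v)) = - g p u (\<phi> p v) + \<eta> p u * \<eta> p (\<phi> p v)"
    using paracontact u \<phi>_closed[OF v] unfolding paracontact_metric_def compatible_metric_def by blast
  moreover have "g p (\<phi> p u) (\<phi> p (\<phi> p v)) = g p (\<phi> p u) v"
    using \<eta>_\<phi>[OF u] by (simp add: \<phi>_\<phi> g_linear T_simps \<phi>_closed u v \<xi>_at flip: \<eta>_eq)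
  ultimately show ?thesis by (simp add: \<eta>_\<phi> v)
qed

lemma contact:
  assumes "X \<in> \<X>" "Y \<in> \<X>"
  shows "2 * g p (X p) (\<phi> p (Y p)) =
    X p (\<lambda>q. \<eta> q (Y q)) - Y p (\<lambda>q. \<eta> q (X q)) - \<eta> p (lie_bracket X Y p)"
proof -
  have "g p (X p) (\<phi> p (Y p)) = ext_deriv \<eta> X Y p"
    using paracontact assms unfolding paracontact_metric_def by blast
  then show ?thesis by (simp add: ext_deriv_def)
qed

lemma \<eta>_field: "X \<in> \<X> \<Longrightarrow> (\<lambda>q. \<eta> q (X q)) = (\<lambda>q. g q (X q) (\<xi> q))"
  by (simp add: \<eta>_eq field_at)

section \<open>First-order consequences of the contact condition\<close>

text \<open>Metric compatibility with \<xi> as third field; it identifies the covariant derivative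
  of \<eta> with \<open>g p (Y p) (D X \<xi> p)\<close>.\<close>

lemma derivative_\<eta>:
  assumes "X \<in> \<X>" "Y \<in> \<X>"
  shows "X p (\<lambda>q. \<eta> q (Y q)) = \<eta> p (D X Y p) + g p (Y p) (D X \<xi> p)"
  unfolding \<eta>_field[OF assms(2)] compat[OF assms \<xi>] \<eta>_eq[OF field_at[OF D_closed[OF assms]]] ..

lemma \<eta>_D_\<xi>:
  assumes "X \<in> \<X>"
  shows "\<eta> p (D X \<xi> p) = 0"
proof -
  have "X p (\<lambda>q. \<eta> q (\<xi> q)) = 0" by (simp add: \<eta>_\<xi> tangent_const[OF field_at[OF assms]])
  then show ?thesis
    using derivative_\<eta>[OF assms \<xi>, of p] \<eta>_eq[OF field_at[OF D_closed[OF assms \<xi>]], of p]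
      g_sym[OF \<xi>_at field_at[OF D_closed[OF assms \<xi>]], of p] by simp
qed

text \<open>For a torsion-free connection the exterior derivative is the skew part of the covariant
  derivative of \<eta>; the factor 2 undoes the convention in \<open>ext_deriv\<close>.\<close>

lemma contact_D_\<xi>:
  assumes "X \<in> \<X>" "Y \<in> \<X>"
  shows "2 * g p (X p) (\<phi> p (Y p)) = g p (Y p) (D X \<xi> p) - g p (X p) (D Y \<xi> p)"
  using contact[OF assms, of p] derivative_\<eta>[OF assms, of p] derivative_\<eta>[OF assms(2,1), of p]
  by (simp add: torsion_free assms \<eta>_linear field_at D_closed)

text \<open>The integral curves of \<xi> are geodesics: in \<open>contact_D_\<xi>\<close> with first
  field \<xi>, the left side vanishes as \<xi> is orthogonal to the image of \<phi>, and one
  right-hand term vanishes since \<xi> has constant length.\<close>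

lemma D_\<xi>_\<xi>: "D \<xi> \<xi> p = 0"
proof (rule g_nondegenerate)
  show DT: "D \<xi> \<xi> p \<in> T p" by (intro field_at D_closed \<xi>)
  fix v assume v: "v \<in> T p"
  define Y where "Y = extension A p v"
  have Y: "Y \<in> \<X>" "Y p = v" using extension[OF v] by (simp_all add: Y_def)
  have "g p (\<xi> p) (\<phi> p v) = 0" using \<eta>_\<phi>[OF v] \<eta>_eq[OF \<phi>_closed[OF v]] g_sym[OF \<xi>_at \<phi>_closed[OF v]] by simp
  moreover have "g p (\<xi> p) (D Y \<xi> p) = 0"
    using \<eta>_D_\<xi>[OF Y(1)] \<eta>_eq[of "D Y \<xi> p" p] g_sym[OF \<xi>_at, of "D Y \<xi> p"] by (simp add: field_at D_closed Y \<xi>)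
  ultimately show "g p (D \<xi> \<xi> p) v = 0"
    using contact_D_\<xi>[OF \<xi> Y(1), of p] g_sym[OF DT v] by (simp add: Y(2))
qed

section \<open>The covariant derivative of \<phi>\<close>

definition nabla_phi :: "'m vfield \<Rightarrow> 'm vfield \<Rightarrow> 'm vfield" where
  "nabla_phi X Y = D X (\<lambda>p. \<phi> p (Y p)) - (\<lambda>p. \<phi> p (D X Y p))"

lemma nabla_phi_closed: "X \<in> \<X> \<Longrightarrow> Y \<in> \<X> \<Longrightarrow> nabla_phi X Y \<in> \<X>"
  unfolding nabla_phi_def by (intro vector_fields_diff D_closed \<phi>_field)

lemma nabla_phi_add:
  assumes "X \<in> \<X>" "Y \<in> \<X>" "Z \<in> \<X>"
  shows "nabla_phi (X + Y) Z p = nabla_phi X Z p + nabla_phi Y Z p"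
    and "nabla_phi Z (X + Y) p = nabla_phi Z X p + nabla_phi Z Y p"
proof -
  have "(\<lambda>p. \<phi> p ((X + Y) p)) = (\<lambda>p. \<phi> p (X p)) + (\<lambda>p. \<phi> p (Y p))"
    using \<phi>_add field_at assms by (simp add: fun_eq_iff)
  then show "nabla_phi (X + Y) Z p = nabla_phi X Z p + nabla_phi Y Z p"
    and "nabla_phi Z (X + Y) p = nabla_phi Z X p + nabla_phi Z Y p"
    unfolding nabla_phi_def
    by (simp_all add: D_add assms \<phi>_field \<phi>_linear field_at D_closed)
qed

lemma nabla_phi_fscale:
  assumes f: "f \<in> \<F>" and "X \<in> \<X>" "Y \<in> \<X>"
  shows "nabla_phi (fscale f X) Y p = f p *\<^sub>R nabla_phi X Y p"
    and "nabla_phi X (fscale f Y) p = f p *\<^sub>R nabla_phi X Y p"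
proof -
  have "(\<lambda>p. \<phi> p (fscale f Y p)) = fscale f (\<lambda>p. \<phi> p (Y p))"
    by (rule ext) (simp add: fscale_at \<phi>_scale[OF field_at[OF assms(3)]])
  then show "nabla_phi (fscale f X) Y p = f p *\<^sub>R nabla_phi X Y p"
    and "nabla_phi X (fscale f Y) p = f p *\<^sub>R nabla_phi X Y p"
    unfolding nabla_phi_def
    by (simp_all add: D_fscale f assms \<phi>_field \<phi>_linear field_at D_closed T_simps fscale_at scaleR_right_diff_distrib)
qed

lemma nabla_phi_cong:
  assumes "X \<in> \<X>" "X' \<in> \<X>" "Y \<in> \<X>" "Y' \<in> \<X>" "X p = X' p" "Y p = Y' p"
  shows "nabla_phi X Y p = nabla_phi X' Y' p"
proof -
  have "nabla_phi X Y p = nabla_phi X' Y p"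
    by (rule tensorial[where F="\<lambda>X. nabla_phi X Y p"])
      (use assms in \<open>simp_all add: nabla_phi_add nabla_phi_fscale\<close>)
  also have "\<dots> = nabla_phi X' Y' p"
    by (rule tensorial[where F="\<lambda>Y. nabla_phi X' Y p"])
      (use assms in \<open>simp_all add: nabla_phi_add nabla_phi_fscale\<close>)
  finally show ?thesis .
qed

definition nabla_phi_at :: "'m \<Rightarrow> 'm tvec \<Rightarrow> 'm tvec \<Rightarrow> 'm tvec" where
  "nabla_phi_at p u v = nabla_phi (extension A p u) (extension A p v) p"

lemma nabla_phi_at_eq: "X \<in> \<X> \<Longrightarrow> Y \<in> \<X> \<Longrightarrow> nabla_phi_at p (X p) (Y p) = nabla_phi X Y p"
  unfolding nabla_phi_at_def by (rule nabla_phi_cong) (simp_all add: extension field_at)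

lemma nabla_phi_at_closed: "u \<in> T p \<Longrightarrow> v \<in> T p \<Longrightarrow> nabla_phi_at p u v \<in> T p"
  unfolding nabla_phi_at_def by (rule field_at[OF nabla_phi_closed]) (rule extension(1)[of _ p]; assumption)+

lemma linear_nabla_phi_at:
  assumes v: "v \<in> T p"
  shows "linear_between (T p) (T p) (\<lambda>u. nabla_phi_at p u v)"
    and "linear_between (T p) (T p) (nabla_phi_at p v)"
proof -
  let ?E = "extension A p"
  have V: "?E v \<in> \<X>" by (rule extension[OF v])
  have add: "nabla_phi_at p (u + w) v = nabla_phi_at p u v + nabla_phi_at p w v"
      "nabla_phi_at p v (u + w) = nabla_phi_at p v u + nabla_phi_at p v w"
    if u: "u \<in> T p" and w: "w \<in> T p" for u w
    using nabla_phi_at_eq[OF vector_fields_add[OF extension(1)[OF u] extension(1)[OF w]] V, of p]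
      nabla_phi_at_eq[OF V vector_fields_add[OF extension(1)[OF u] extension(1)[OF w]], of p]
    unfolding nabla_phi_add[OF extension(1)[OF u] extension(1)[OF w] V]
    by (simp_all add: extension(2) u v w nabla_phi_at_def[of p u] nabla_phi_at_def[of p w] nabla_phi_at_def[of p v u]
        nabla_phi_at_def[of p v w])
  have scale: "nabla_phi_at p (c *\<^sub>R u) v = c *\<^sub>R nabla_phi_at p u v"
      "nabla_phi_at p v (c *\<^sub>R u) = c *\<^sub>R nabla_phi_at p v u"
    if u: "u \<in> T p" for c u
    using nabla_phi_at_eq[OF vector_fields_fscale[OF smooth_functions_const[of c] extension(1)[OF u]] V, of p]
      nabla_phi_at_eq[OF V vector_fields_fscale[OF smooth_functions_const[of c] extension(1)[OF u]], of p]
    unfolding nabla_phi_fscale(1)[OF smooth_functions_const[of c] extension(1)[OF u] V]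
      nabla_phi_fscale(2)[OF smooth_functions_const[of c] V extension(1)[OF u]]
    by (simp_all add: extension(2) u v fscale_at nabla_phi_at_def[of p u] nabla_phi_at_def[of p v u])
  show "linear_between (T p) (T p) (\<lambda>u. nabla_phi_at p u v)" "linear_between (T p) (T p) (nabla_phi_at p v)"
    unfolding linear_between_def using add scale nabla_phi_at_closed v by simp_all
qed

text \<open>Differentiate the skewness relation \<open>g_\<phi>\<close> along \<open>X\<close>; the
  terms with derivatives of \<open>Y\<close> and \<open>Z\<close> cancel by skewness again.\<close>

lemma nabla_phi_skew:
  assumes "X \<in> \<X>" "Y \<in> \<X>" "Z \<in> \<X>"
  shows "g p (nabla_phi X Y p) (Z p) = - g p (Y p) (nabla_phi X Z p)"
proof -
  have "X p (\<lambda>q. g q (\<phi> q (Y q)) (Z q) + g q (Y q) (\<phi> q (Z q))) = 0"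
    using g_\<phi> field_at assms by (simp add: tangent_const[OF field_at[OF assms(1)]])
  then have "X p (\<lambda>q. g q (\<phi> q (Y q)) (Z q)) + X p (\<lambda>q. g q (Y q) (\<phi> q (Z q))) = 0"
    using tangent_space_D(1)[OF field_at[OF assms(1)] g_smooth[OF \<phi>_field[OF assms(2)] assms(3)]
        g_smooth[OF assms(2) \<phi>_field[OF assms(3)]], of p] by simp
  then show ?thesis
    using compat[OF assms(1) \<phi>_field[OF assms(2)] assms(3), of p]
      compat[OF assms(1,2) \<phi>_field[OF assms(3)], of p]
      g_\<phi>[OF field_at[OF D_closed[OF assms(1,2)]] field_at[OF assms(3)], of p]
      g_\<phi>[OF field_at[OF assms(2)] field_at[OF D_closed[OF assms(1,3)]], of p]
    by (simp add: nabla_phi_def g_linear field_at D_closed assms \<phi>_field \<phi>_closed)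
qed

lemma jacobi_identity:
  assumes "X \<in> \<X>" "Y \<in> \<X>" "Z \<in> \<X>"
  shows "lie_bracket (lie_bracket X Y) Z p + lie_bracket (lie_bracket Y Z) X p + lie_bracket (lie_bracket Z X) Y p = 0"
proof
  fix f
  show "(lie_bracket (lie_bracket X Y) Z p + lie_bracket (lie_bracket Y Z) X p +
      lie_bracket (lie_bracket Z X) Y p) f = 0 f"
  \<comment> \<open>Linearity of tangent vectors holds on smooth functions only; on the others each
    bracket vanishes by the convention for tangent vectors.\<close>
  proof (cases "f \<in> \<F>")
    case True
    have "Z p (act (lie_bracket X Y) f) = Z p (act X (act Y f)) - Z p (act Y (act X f))"
      if "X \<in> \<X>" "Y \<in> \<X>" "Z \<in> \<X>" for X Y Z
    proof -
      have "act (lie_bracket X Y) f = (\<lambda>q. act X (act Y f) q - act Y (act X f) q)"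
        by (simp add: act_def lie_bracket_def fun_eq_iff)
      then show ?thesis
        using tangent_diff[OF field_at[OF that(3)]] vector_fieldsD(2) that True by simp
    qed
    note * = this[OF assms(1,2,3)] this[OF assms(2,3,1)] this[OF assms(3,1,2)]
    show ?thesis by (simp add: lie_bracket_def[of "lie_bracket _ _"] * ) (simp add: lie_bracket_def)
  next
    case False
    then have "lie_bracket (lie_bracket X Y) Z p f = 0"
      if "X \<in> \<X>" "Y \<in> \<X>" "Z \<in> \<X>" for X Y Z
      by (rule tangent_space_D(4)[OF field_at[OF lie_bracket_closed[OF lie_bracket_closed[OF that(1,2)] that(3)]]])
    then show ?thesis using assms by simp
  qed
qed

text \<open>The cyclic identity expresses that the fundamental form \<open>g(X, \<phi> Y) = d\<eta>(X, Y)\<close> is closed.\<close>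

lemma nabla_phi_cyclic:
  assumes X: "X \<in> \<X>" and Y: "Y \<in> \<X>" and Z: "Z \<in> \<X>"
  shows "g p (Y p) (nabla_phi X Z p) + g p (Z p) (nabla_phi Y X p) + g p (X p) (nabla_phi Z Y p) = 0"
proof -
  define \<Phi> where "\<Phi> X Y q = g q (X q) (\<phi> q (Y q))" for X Y q
  have 1: "g p (Y p) (nabla_phi X Z p) = X p (\<Phi> Y Z) - \<Phi> (D X Y) Z p - \<Phi> Y (D X Z) p"
    if "X \<in> \<X>" "Y \<in> \<X>" "Z \<in> \<X>" for X Y Z
    using compat[OF that(1,2) \<phi>_field[OF that(3)], of p]
    by (simp add: \<Phi>_def[abs_def] nabla_phi_def g_linear field_at D_closed that \<phi>_field \<phi>_closed)
  have skew: "\<Phi> X Y q = - \<Phi> Y X q" if "X \<in> \<X>" "Y \<in> \<X>" for X Y q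
    using g_\<phi>[OF field_at[OF that(2)] field_at[OF that(1)], of q]
      g_sym[OF field_at[OF that(1)] \<phi>_closed[OF field_at[OF that(2)]], of q]
    by (simp add: \<Phi>_def)
  have diff: "\<Phi> (X - Y) Z p = \<Phi> X Z p - \<Phi> Y Z p" if "X \<in> \<X>" "Y \<in> \<X>" "Z \<in> \<X>" for X Y Z
    by (simp add: \<Phi>_def g_linear field_at \<phi>_closed that)
  \<comment> \<open>This is the bracket formula for the exterior derivative of \<Phi>: skewness of
    \<Phi> pairs the connection terms into brackets.\<close>
  have 2: "g p (Y p) (nabla_phi X Z p) + g p (Z p) (nabla_phi Y X p) + g p (X p) (nabla_phi Z Y p) =
      (X p (\<Phi> Y Z) + Y p (\<Phi> Z X) + Z p (\<Phi> X Y)) -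
      (\<Phi> (lie_bracket X Y) Z p + \<Phi> (lie_bracket Y Z) X p + \<Phi> (lie_bracket Z X) Y p)"
    using skew[OF Y D_closed[OF X Z], of p] skew[OF Z D_closed[OF Y X], of p] skew[OF X D_closed[OF Z Y], of p]
    by (simp add: 1 X Y Z torsion_free diff D_closed)
  let ?h = "\<lambda>X q. \<eta> q (X q)"
  have 3: "X p (\<Phi> Y Z) = (X p (act Y (?h Z)) - X p (act Z (?h Y)) - X p (?h (lie_bracket Y Z))) / 2"
    if "X \<in> \<X>" "Y \<in> \<X>" "Z \<in> \<X>" for X Y Z
  proof -
    have "(\<lambda>q. 2 * \<Phi> Y Z q) = (\<lambda>q. (act Y (?h Z) q - act Z (?h Y) q) - ?h (lie_bracket Y Z) q)"
      using contact[OF that(2,3)] by (simp add: \<Phi>_def act_def)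
    moreover have "X p (\<lambda>q. 2 * \<Phi> Y Z q) = 2 * X p (\<Phi> Y Z)"
      using tangent_space_D(2)[OF field_at[OF that(1)], of "\<Phi> Y Z" p 2] g_smooth[OF that(2) \<phi>_field[OF that(3)]]
      by (simp add: \<Phi>_def[abs_def])
    moreover have "act Y (?h Z) \<in> \<F>" "act Z (?h Y) \<in> \<F>" "?h (lie_bracket Y Z) \<in> \<F>"
      using that by (simp_all add: vector_fieldsD(2) \<eta>_smooth lie_bracket_closed)
    then have "X p (\<lambda>q. (act Y (?h Z) q - act Z (?h Y) q) - ?h (lie_bracket Y Z) q) =
        X p (act Y (?h Z)) - X p (act Z (?h Y)) - X p (?h (lie_bracket Y Z))"
      by (simp only: tangent_diff[OF field_at[OF that(1)]] smooth_functions_diff)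
    ultimately show ?thesis by simp
  qed
  have 4: "\<Phi> (lie_bracket X Y) Z p =
      (X p (act Y (?h Z)) - Y p (act X (?h Z)) - Z p (?h (lie_bracket X Y)) - \<eta> p (lie_bracket (lie_bracket X Y) Z p)) / 2"
    if "X \<in> \<X>" "Y \<in> \<X>" "Z \<in> \<X>" for X Y Z
  proof -
    have "lie_bracket X Y p (?h Z) = X p (act Y (?h Z)) - Y p (act X (?h Z))"
      by (simp add: lie_bracket_def)
    then show ?thesis
      using contact[OF lie_bracket_closed[OF that(1,2)] that(3), of p] by (simp add: \<Phi>_def)
  qed
  \<comment> \<open>After inserting \<open>contact\<close> everywhere, second derivatives and
    single-bracket derivatives cancel in the cyclic sum; the double brackets remain and fall to the
    Jacobi identity.\<close>
  have "\<eta> p (lie_bracket (lie_bracket X Y) Z p) + \<eta> p (lie_bracket (lie_bracket Y Z) X p) +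
      \<eta> p (lie_bracket (lie_bracket Z X) Y p) = \<eta> p (0 *\<^sub>R \<xi> p)"
    using arg_cong[OF jacobi_identity[OF X Y Z, of p], of "\<eta> p"]
    by (simp add: \<eta>_linear field_at lie_bracket_closed X Y Z T_simps)
  also have "\<dots> = 0" by (simp only: \<eta>_scale[OF \<xi>_at])
  finally show ?thesis
    unfolding 2 3[OF X Y Z] 3[OF Y Z X] 3[OF Z X Y] 4[OF X Y Z] 4[OF Y Z X] 4[OF Z X Y]
    by (simp add: field_simps)
qed

text \<open>The covariant derivative of the identity for \<phi> squared: the right-hand side is that
  of \<open>- \<eta> \<otimes> \<xi>\<close>.\<close>

lemma nabla_phi_\<phi>:
  assumes X: "X \<in> \<X>" and Y: "Y \<in> \<X>"
  shows "nabla_phi X (\<lambda>q. \<phi> q (Y q)) p + \<phi> p (nabla_phi X Y p) =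
    - (g p (Y p) (D X \<xi> p) *\<^sub>R \<xi> p + \<eta> p (Y p) *\<^sub>R D X \<xi> p)"
proof -
  have eq: "(\<lambda>q. \<phi> q (\<phi> q (Y q))) = Y - fscale (\<lambda>q. \<eta> q (Y q)) \<xi>"
    using \<phi>_\<phi> field_at[OF Y] by (simp add: fun_eq_iff fscale_at)
  have "D X (\<lambda>q. \<phi> q (\<phi> q (Y q))) p =
      D X Y p - (X p (\<lambda>q. \<eta> q (Y q)) *\<^sub>R \<xi> p + \<eta> p (Y p) *\<^sub>R D X \<xi> p)"
    unfolding eq
    by (simp add: D_diff D_fscale X Y \<xi> \<eta>_smooth vector_fields_fscale fscale_at) (simp add: act_def)
  then show ?thesis
    by (simp add: nabla_phi_def \<phi>_linear \<phi>_\<phi> field_at D_closed \<phi>_field X Y \<phi>_closed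
        derivative_\<eta> algebra_simps)
qed

text \<open>Writing \<open>M u = (\<nabla>\<^sub>u \<phi>) Z\<close> and \<open>N = \<nabla>\<^sub>Z \<phi>\<close>, the cyclic identity
  says \<open>N = M - M\<^sup>*\<close>; as \<open>\<phi>\<close> is skew, composing with \<open>\<phi>\<close> gives \<open>2 tr (\<phi> M) = tr (N \<phi>)\<close>, and the
  right-hand side vanishes by differentiating \<open>\<phi>\<^sup>2\<close>.\<close>

lemma divergence_\<phi>:
  assumes v: "v \<in> T p" and "\<eta> p v = 0"
  shows "trace_on (T p) (\<lambda>u. nabla_phi_at p u v) = 0"
proof -
  \<comment> \<open>As \<open>v\<close> lies in the kernel of \<eta>, \<open>\<phi> p z = v\<close>.
    The divergence in direction \<open>v\<close> is thus reached from \<open>\<phi> p (M u)\<close>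
    by \<open>nabla_phi_\<phi>\<close>.\<close>
  define z where "z = \<phi> p v"
  define M N where "M u = nabla_phi_at p u z" and "N u = nabla_phi_at p z u" for u
  have z: "z \<in> T p" unfolding z_def by (rule \<phi>_closed[OF v])
  define Z where "Z = extension A p z"
  have Z: "Z \<in> \<X>" "Z p = z" unfolding Z_def by (rule extension[OF z])+
  have linM: "linear_between (T p) (T p) M" and linN: "linear_between (T p) (T p) N"
    unfolding M_def N_def by (rule linear_nabla_phi_at[OF z])+
  have MT: "M u \<in> T p" and NT: "N u \<in> T p" if "u \<in> T p" for u
    unfolding M_def N_def using that z by (simp_all add: nabla_phi_at_closed)
  have B0: "g p w (D Z \<xi> p) *\<^sub>R \<xi> p \<in> T p" "\<eta> p w *\<^sub>R D Z \<xi> p \<in> T p" for w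
    by (intro T_scale \<xi>_at field_at D_closed Z \<xi>)+
  have cyc: "- g p w (\<phi> p (M u)) + - g p (M (\<phi> p w)) u + g p (N (\<phi> p w)) u = 0" if u: "u \<in> T p" and w: "w \<in> T p" for u w
  proof -
    define X Y where "X = extension A p u" and "Y = extension A p (\<phi> p w)"
    have X: "X \<in> \<X>" "X p = u" and Y: "Y \<in> \<X>" "Y p = \<phi> p w"
      using extension[OF u] extension[OF \<phi>_closed[OF w]] by (simp_all add: X_def Y_def)
    have "g p (\<phi> p w) (M u) - g p (M (\<phi> p w)) u + g p u (N (\<phi> p w)) = 0"
      using nabla_phi_cyclic[OF X(1) Y(1) Z(1), of p] nabla_phi_skew[OF Y(1) X(1) Z(1), of p]
        g_sym[of "nabla_phi Y X p" p "Z p"] g_sym[of "nabla_phi Y Z p" p "X p"] X Y Z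
      by (simp add: M_def N_def nabla_phi_at_closed \<phi>_closed u w z flip: nabla_phi_at_eq)
    then show ?thesis
      using g_\<phi>[OF w MT[OF u]] g_sym[OF u NT[OF \<phi>_closed[OF w]]] by simp
  qed
  have lin\<phi>M: "linear_between (T p) (T p) (\<lambda>u. \<phi> p (M u))"
    using linear_\<phi>[of p] linM unfolding linear_between_def by simp
  \<comment> \<open>Contract with \<open>w = c\<close>, \<open>u = tangent.dual p c\<close>. The
    first summand has basis and dual vector in exchanged places, hence the use of
    \<open>trace_adjoint\<close>.\<close>
  have "(\<Sum>c\<in>tangent.\<B> p. - g p c (\<phi> p (M (tangent.dual p c))) + - g p (M (\<phi> p c)) (tangent.dual p c)
      + g p (N (\<phi> p c)) (tangent.dual p c)) = 0"
    by (rule sum.neutral, rule ballI, rule cyc) (simp_all add: tangent.dual tangent.basis(4))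
  then have "trace_on (T p) (\<lambda>u. N (\<phi> p u)) = trace_on (T p) (\<lambda>u. \<phi> p (M u)) + trace_on (T p) (\<lambda>u. M (\<phi> p u))"
    using tangent.trace_adjoint[OF lin\<phi>M]
    by (simp add: sum.distrib sum_subtractf sum_negf tangent.trace_dual MT NT \<phi>_closed)
  also have "trace_on (T p) (\<lambda>u. M (\<phi> p u)) = trace_on (T p) (\<lambda>u. \<phi> p (M u))"
    by (rule tangent.trace_comp[OF linM linear_\<phi>])
  finally have 1: "trace_on (T p) (\<lambda>u. N (\<phi> p u)) = 2 * trace_on (T p) (\<lambda>u. \<phi> p (M u))" by simp
  \<comment> \<open>By cyclicity the trace of \<open>N\<close> after \<phi> is half that of the
    anticommutator of \<open>N\<close> and \<phi>. By \<open>nabla_phi_\<phi>\<close> the latter is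
    a sum of two rank-one maps, both traceless because the derivative of \<xi> is orthogonal to
    \<xi>.\<close>
  have "2 * trace_on (T p) (\<lambda>u. N (\<phi> p u)) = trace_on (T p) (\<lambda>u. N (\<phi> p u)) + trace_on (T p) (\<lambda>u. \<phi> p (N u))"
    using tangent.trace_comp[OF linN linear_\<phi>] by simp
  also have "\<dots> = trace_on (T p) (\<lambda>u. N (\<phi> p u) + \<phi> p (N u))"
    by (rule tangent.trace_add[symmetric]) (simp_all add: NT \<phi>_closed)
  also have "\<dots> = trace_on (T p) (\<lambda>u. (- 1) *\<^sub>R (g p u (D Z \<xi> p) *\<^sub>R \<xi> p + \<eta> p u *\<^sub>R D Z \<xi> p))"
  proof (rule tangent.trace_cong)
    fix u assume u: "u \<in> T p"
    show "N (\<phi> p u) + \<phi> p (N u) = (- 1) *\<^sub>R (g p u (D Z \<xi> p) *\<^sub>R \<xi> p + \<eta> p u *\<^sub>R D Z \<xi> p)"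
      using nabla_phi_\<phi>[OF Z(1) extension(1)[OF u], of p] nabla_phi_at_eq[OF Z(1) extension(1)[OF u], of p]
        nabla_phi_at_eq[OF Z(1) \<phi>_field[OF extension(1)[OF u]], of p]
      by (simp add: N_def Z extension(2) u)
  qed (simp add: NT \<phi>_closed T_simps)
  also have "\<dots> = - (trace_on (T p) (\<lambda>u. g p u (D Z \<xi> p) *\<^sub>R \<xi> p) + trace_on (T p) (\<lambda>u. \<eta> p u *\<^sub>R D Z \<xi> p))"
    by (subst tangent.trace_scale) (simp_all add: T_add B0 tangent.trace_add)
  also have "\<dots> = - (g p (\<xi> p) (D Z \<xi> p) + \<eta> p (D Z \<xi> p))"
    by (simp add: tangent.trace_rank_one tangent.linear_left linear_\<eta> field_at D_closed Z \<xi>)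
  also have "\<dots> = 0"
    using \<eta>_D_\<xi>[OF Z(1), of p] \<eta>_eq[of "D Z \<xi> p" p] g_sym[OF \<xi>_at, of "D Z \<xi> p"]
    by (simp add: field_at D_closed Z \<xi>)
  finally have 2: "trace_on (T p) (\<lambda>u. \<phi> p (M u)) = 0" using 1 by simp
  \<comment> \<open>The defect between \<open>M\<close> followed by \<phi> and the divergence
    integrand is \<open>\<omega> u *\<^sub>R \<xi> p\<close>; its trace
    \<open>\<omega> (\<xi> p)\<close> vanishes because \<xi> is geodesic.\<close>
  define \<omega> where "\<omega> u = g p z (D (extension A p u) \<xi> p)" for u
  have \<eta>z: "\<eta> p z = 0" unfolding z_def by (rule \<eta>_\<phi>[OF v])
  have \<phi>z: "\<phi> p z = v" unfolding z_def using \<phi>_\<phi>[OF v] assms(2) by simp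
  have D\<xi>: "D X \<xi> p = D X' \<xi> p" if "X \<in> \<X>" "X' \<in> \<X>" "X p = X' p" for X X'
    by (rule tensorial[where F="\<lambda>X. D X \<xi> p"]) (use that \<xi> in \<open>simp_all add: D_add D_fscale fscale_at\<close>)
  have "linear_between (T p) UNIV \<omega>"
    unfolding linear_between_def
  proof (intro conjI ballI allI)
    fix u w c assume u: "u \<in> T p"
    note E = extension[of _ p]
    { assume w: "w \<in> T p"
      have "D (extension A p (u + w)) \<xi> p = D (extension A p u + extension A p w) \<xi> p"
        by (rule D\<xi>) (simp_all add: E u w T_add vector_fields_add)
      then show "\<omega> (u + w) = \<omega> u + \<omega> w"
        by (simp add: \<omega>_def D_add E u w \<xi> g_linear field_at D_closed z) }
    have "D (extension A p (c *\<^sub>R u)) \<xi> p = D (c *\<^sub>R extension A p u) \<xi> p"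
      by (rule D\<xi>) (simp_all add: E u T_scale vector_fields_scaleR scaleR_at)
    then show "\<omega> (c *\<^sub>R u) = c *\<^sub>R \<omega> u"
      by (simp add: \<omega>_def D_scaleR E u \<xi> g_linear field_at D_closed z scaleR_at)
  qed simp
  then have tr\<omega>: "trace_on (T p) (\<lambda>u. \<omega> u *\<^sub>R \<xi> p) = \<omega> (\<xi> p)"
    by (rule tangent.trace_rank_one[OF _ \<xi>_at])
  have \<omega>\<xi>: "\<omega> (\<xi> p) = 0"
    unfolding \<omega>_def using D\<xi>[OF extension(1)[OF \<xi>_at] \<xi> extension(2)[OF \<xi>_at]] D_\<xi>_\<xi>[of p] z
    by (simp add: g_zero)
  have "trace_on (T p) (\<lambda>u. nabla_phi_at p u v) = trace_on (T p) (\<lambda>u. (- 1) *\<^sub>R (\<phi> p (M u) + \<omega> u *\<^sub>R \<xi> p))"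
  proof (rule tangent.trace_cong)
    fix u assume u: "u \<in> T p"
    have "nabla_phi_at p u v + \<phi> p (M u) = - (\<omega> u *\<^sub>R \<xi> p)"
      using nabla_phi_\<phi>[OF extension(1)[OF u] Z(1), of p] nabla_phi_at_eq[OF extension(1)[OF u] Z(1), of p]
        nabla_phi_at_eq[OF extension(1)[OF u] \<phi>_field[OF Z(1)], of p]
      by (simp add: M_def \<omega>_def Z extension(2) u \<eta>z \<phi>z)
    then have "nabla_phi_at p u v = - (\<omega> u *\<^sub>R \<xi> p) - \<phi> p (M u)"
      by (simp only: eq_diff_eq)
    then show "nabla_phi_at p u v = (- 1) *\<^sub>R (\<phi> p (M u) + \<omega> u *\<^sub>R \<xi> p)"
      by simp
  qed (simp add: nabla_phi_at_closed v)
  also have "\<dots> = - (trace_on (T p) (\<lambda>u. \<phi> p (M u)) + trace_on (T p) (\<lambda>u. \<omega> u *\<^sub>R \<xi> p))"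
    by (subst tangent.trace_scale) (simp_all add: T_simps MT \<phi>_closed \<xi>_at tangent.trace_add)
  also have "\<dots> = 0" by (simp add: 2 tr\<omega> \<omega>\<xi>)
  finally show ?thesis .
qed

end


section \<open>D-homothetic deformation\<close>

locale d_homothety = paracontact_manifold A g D n \<phi> \<xi> \<eta>
  for A :: "('m::{t2_space,second_countable_topology}, 'e::euclidean_space) chart set"
    and g :: "'m bform" and D :: "'m connection" and n :: nat
    and \<phi> :: "'m \<Rightarrow> 'm tvec \<Rightarrow> 'm tvec" and \<xi> :: "'m vfield" and \<eta> :: "'m \<Rightarrow> 'm tvec \<Rightarrow> real" +
  fixes \<alpha> :: real and D' :: "'m connection" and g' :: "'m bform"
  assumes \<alpha>: "\<alpha> > 0"
    and g'_eq: "g' = (\<lambda>p u v. \<alpha> * g p u v + \<alpha> * (\<alpha> - 1) * (\<eta> p u * \<eta> p v))"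
    and levi_civita': "levi_civita A g' D'"

sublocale d_homothety \<subseteq> deformed: levi_civita_manifold A g' D'
proof
  show "tensor_field_02 A g'"
    unfolding tensor_field_02_def
  proof (intro conjI allI ballI)
    fix X Y assume "X \<in> \<X>" "Y \<in> \<X>"
    then show "(\<lambda>p. g' p (X p) (Y p)) \<in> \<F>"
      unfolding g'_eq by (intro smooth_functions_add smooth_functions_mult smooth_functions_const g_smooth \<eta>_smooth)
  next
    show "bilinear_form_on (T p) (g' p)" for p
      unfolding bilinear_form_on_def linear_between_def g'_eq
      by (simp add: g_linear \<eta>_linear algebra_simps)
  qed
  show "u \<in> T p \<Longrightarrow> v \<in> T p \<Longrightarrow> g' p u v = g' p v u" for u v p
    by (simp add: g'_eq g_sym mult.commute)
  show "u = 0" if u: "u \<in> T p" and 0: "\<And>v. v \<in> T p \<Longrightarrow> g' p u v = 0" for u p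
  proof (rule g_nondegenerate[OF u])
    fix v assume v: "v \<in> T p"
    \<comment> \<open>Pairing with \<xi> gives \<open>\<alpha>^2 * \<eta> p u\<close>, so \<eta>
      vanishes on \<open>u\<close> and \<open>g'\<close> reduces to a multiple of \<open>g\<close>
      there.\<close>
    have "\<alpha> * \<alpha> * \<eta> p u = 0"
      using 0[OF \<xi>_at] by (simp add: g'_eq \<eta>_\<xi> algebra_simps flip: \<eta>_eq[OF u])
    then show "g p u v = 0" using 0[OF v] \<alpha> by (simp add: g'_eq)
  qed
  show "levi_civita A g' D'" by (rule levi_civita')
qed

context d_homothety
begin

section \<open>The Levi-Civita connection of the deformed metric\<close>

text \<open>Up to the factor this is the symmetric part of the covariant derivative of \<eta>: by
  \<open>contact_D_\<xi>\<close> its skew part is \<open>- g p (\<phi> p (X p)) (Y p)\<close>, which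
  the second summand removes.\<close>

definition c_form :: "'m vfield \<Rightarrow> 'm vfield \<Rightarrow> 'm \<Rightarrow> real" where
  "c_form X Y p = (\<alpha> - 1) / \<alpha> * (g p (D X \<xi> p) (Y p) + g p (\<phi> p (X p)) (Y p))"

lemma c_form_smooth: "X \<in> \<X> \<Longrightarrow> Y \<in> \<X> \<Longrightarrow> c_form X Y \<in> \<F>"
  unfolding c_form_def[abs_def]
  by (intro smooth_functions_add smooth_functions_mult smooth_functions_const g_smooth \<phi>_field D_closed \<xi>)

lemma c_form_sym:
  assumes "X \<in> \<X>" "Y \<in> \<X>"
  shows "c_form X Y p = c_form Y X p"
proof -
  note XY = field_at[OF assms(1)] field_at[OF assms(2)]
  have "2 * (g p (D X \<xi> p) (Y p) + g p (\<phi> p (X p)) (Y p)) = 2 * (g p (D Y \<xi> p) (X p) + g p (\<phi> p (Y p)) (X p))"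
    using contact_D_\<xi>[OF assms, of p] contact_D_\<xi>[OF assms(2,1), of p] g_\<phi>[OF XY] g_\<phi>[OF XY(2,1)]
      g_sym[OF XY(1) field_at[OF D_closed[OF assms(2) \<xi>]]] g_sym[OF XY(2) field_at[OF D_closed[OF assms(1) \<xi>]]]
    by simp
  then show ?thesis by (simp add: c_form_def)
qed

lemma c_form_\<xi>:
  assumes "X \<in> \<X>"
  shows "c_form \<xi> X p = 0"
  using assms by (simp add: c_form_def D_\<xi>_\<xi> \<phi>_\<xi> g_zero field_at)

lemma g_\<xi>: "u \<in> T p \<Longrightarrow> g p (\<xi> p) u = \<eta> p u"
  by (simp add: \<eta>_eq g_sym[OF \<xi>_at])

text \<open>The term with \<open>\<eta> p (X p)\<close> makes the difference from \<open>D\<close>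
  symmetric, so torsion stays 0; it drops out of the metric condition because \<phi> is skew. The
  term with \<open>\<eta> p (Y p)\<close> balances the skew part removed in
  \<open>c_form\<close>.\<close>

definition deformed_connection :: "'m vfield \<Rightarrow> 'm vfield \<Rightarrow> 'm vfield" where
  "deformed_connection X Y p = D X Y p + c_form X Y p *\<^sub>R \<xi> p -
    (\<alpha> - 1) *\<^sub>R (\<eta> p (Y p) *\<^sub>R \<phi> p (X p) + \<eta> p (X p) *\<^sub>R \<phi> p (Y p))"

lemma deformed_connection_closed: "X \<in> \<X> \<Longrightarrow> Y \<in> \<X> \<Longrightarrow> deformed_connection X Y p \<in> T p"
  unfolding deformed_connection_def by (simp add: T_simps field_at D_closed \<xi> \<phi>_closed)

lemma deformed_connection_compat:
  assumes X: "X \<in> \<X>" and Y: "Y \<in> \<X>" and Z: "Z \<in> \<X>"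
  shows "X p (\<lambda>q. g' q (Y q) (Z q)) =
    g' p (deformed_connection X Y p) (Z p) + g' p (Y p) (deformed_connection X Z p)"
proof -
  note at = field_at[OF X, of p] field_at[OF Y, of p] field_at[OF Z, of p]
  note Dat = field_at[OF D_closed[OF X Y], of p] field_at[OF D_closed[OF X Z], of p]
  have sm: "(\<lambda>q. g q (Y q) (Z q)) \<in> \<F>" "(\<lambda>q. \<eta> q (Y q)) \<in> \<F>" "(\<lambda>q. \<eta> q (Z q)) \<in> \<F>"
    by (intro g_smooth \<eta>_smooth Y Z)+
  have "X p (\<lambda>q. g' q (Y q) (Z q)) = \<alpha> * X p (\<lambda>q. g q (Y q) (Z q)) +
      \<alpha> * (\<alpha> - 1) * (\<eta> p (Y p) * X p (\<lambda>q. \<eta> q (Z q)) + X p (\<lambda>q. \<eta> q (Y q)) * \<eta> p (Z p))"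
    unfolding g'_eq
    by (simp add: tangent_space_D(1,2,3)[OF at(1)] smooth_functions_mult sm)
  also have "\<dots> = \<alpha> * (g p (D X Y p) (Z p) + g p (Y p) (D X Z p)) +
      \<alpha> * (\<alpha> - 1) * (\<eta> p (Y p) * (\<eta> p (D X Z p) + g p (D X \<xi> p) (Z p)) +
        (\<eta> p (D X Y p) + g p (D X \<xi> p) (Y p)) * \<eta> p (Z p))"
    unfolding compat[OF X Y Z] derivative_\<eta>[OF X Y] derivative_\<eta>[OF X Z]
    by (simp add: g_sym[of "D X \<xi> p"] at field_at D_closed X \<xi>)
  finally have 1: "X p (\<lambda>q. g' q (Y q) (Z q)) = \<dots>" .
  have 2: "g' p (deformed_connection X Y p) (Z p) =
      \<alpha> * (g p (D X Y p) (Z p) + c_form X Y p * \<eta> p (Z p) -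
        (\<alpha> - 1) * (\<eta> p (Y p) * g p (\<phi> p (X p)) (Z p) + \<eta> p (X p) * g p (\<phi> p (Y p)) (Z p))) +
      \<alpha> * (\<alpha> - 1) * ((\<eta> p (D X Y p) + c_form X Y p) * \<eta> p (Z p))"
    unfolding g'_eq deformed_connection_def
    by (simp add: g_linear \<eta>_linear T_simps at Dat \<phi>_closed \<xi>_at \<eta>_\<phi> \<eta>_\<xi> g_\<xi>)
  have 3: "g' p (Y p) (deformed_connection X Z p) =
      \<alpha> * (g p (Y p) (D X Z p) + c_form X Z p * \<eta> p (Y p) -
        (\<alpha> - 1) * (\<eta> p (Z p) * g p (\<phi> p (X p)) (Y p) - \<eta> p (X p) * g p (\<phi> p (Y p)) (Z p))) +
      \<alpha> * (\<alpha> - 1) * (\<eta> p (Y p) * (\<eta> p (D X Z p) + c_form X Z p))"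
    unfolding g'_eq deformed_connection_def
    using g_\<phi>[OF at(2,3)] g_sym[OF at(2) \<phi>_closed[OF at(1)]]
    by (simp add: g_linear \<eta>_linear T_simps at Dat \<phi>_closed \<xi>_at \<eta>_\<phi> \<eta>_\<xi> flip: \<eta>_eq[OF at(2)])
  have c: "\<alpha> * c_form X W p = (\<alpha> - 1) * (g p (D X \<xi> p) (W p) + g p (\<phi> p (X p)) (W p))" for W
    using \<alpha> by (simp add: c_form_def)
  \<comment> \<open>With \<open>c_form\<close> entering only through \<alpha> times its value, the
    claim is a polynomial identity. Index 1 belongs to \<open>Y\<close>, index 2 to
    \<open>Z\<close>: \<open>P\<close> and \<open>e\<close> come from \<open>D X Y\<close> and
    \<open>D X Z\<close>, \<open>m\<close> from the derivative of \<xi>, \<open>k\<close> is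
    \<open>c_form\<close>, \<open>f\<close> pairs \<open>\<phi> p (X p)\<close>, and
    \<open>w\<close> pairs \<open>\<phi> p (Y p)\<close> with \<open>Z p\<close>.\<close>
  have "\<alpha> * (P1 + P2) + \<alpha> * (\<alpha> - 1) * (y * (e2 + m2) + (e1 + m1) * z) =
      (\<alpha> * (P1 + k1 * z - (\<alpha> - 1) * (y * f2 + x * w)) + \<alpha> * (\<alpha> - 1) * ((e1 + k1) * z)) +
      (\<alpha> * (P2 + k2 * y - (\<alpha> - 1) * (z * f1 - x * w)) + \<alpha> * (\<alpha> - 1) * (y * (e2 + k2)))"
    if "\<alpha> * k1 = (\<alpha> - 1) * (m1 + f1)" "\<alpha> * k2 = (\<alpha> - 1) * (m2 + f2)"
    for P1 P2 e1 e2 m1 m2 k1 k2 f1 f2 x y z w :: real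
    using that by algebra
  from this[OF c c] show ?thesis unfolding 1 2 3 .
qed

text \<open>The difference of two torsion-free metric connections is symmetric in its arguments and skew with respect
  to the metric, hence zero.\<close>

lemma D'_eq:
  assumes X: "X \<in> \<X>" and Y: "Y \<in> \<X>"
  shows "D' X Y p = deformed_connection X Y p"
proof -
  define S where "S X Y = D' X Y p - deformed_connection X Y p" for X Y
  have ST: "S X Y \<in> T p" if "X \<in> \<X>" "Y \<in> \<X>" for X Y
    unfolding S_def using that by (intro T_diff deformed_connection_closed field_at deformed.D_closed)
  have sym: "S X Y = S Y X" if "X \<in> \<X>" "Y \<in> \<X>" for X Y
  proof -
    have "D' X Y p - D' Y X p = D X Y p - D Y X p"
      using fun_cong[OF deformed.torsion_free[OF that], of p] fun_cong[OF torsion_free[OF that], of p] by simp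
    then show ?thesis
      using c_form_sym[OF that, of p] by (simp add: S_def deformed_connection_def algebra_simps)
  qed
  have skew: "g' p (S X Y) (Z p) = - g' p (S X Z) (Y p)" if "X \<in> \<X>" "Y \<in> \<X>" "Z \<in> \<X>" for X Y Z
    using deformed.compat[OF that, of p] deformed_connection_compat[OF that, of p]
      deformed.g_sym[OF ST[OF that(1,3)] field_at[OF that(2)]]
    by (simp add: S_def deformed.g_linear field_at deformed.D_closed deformed_connection_closed that)
  have "S X Y = 0"
  proof (rule deformed.g_nondegenerate[OF ST[OF X Y]])
    fix v assume v: "v \<in> T p"
    define Z where "Z = extension A p v"
    have Z: "Z \<in> \<X>" "Z p = v" unfolding Z_def by (rule extension[OF v])+
    \<comment> \<open>Alternating the two symmetries runs through all six orders of the three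
      fields; three sign changes return the expression to its own negative.\<close>
    have "g' p (S X Y) (Z p) = - g' p (S X Y) (Z p)"
      using skew[OF X Y Z(1)] skew[OF Z(1) X Y] skew[OF Y Z(1) X] sym[OF X Y] sym[OF X Z(1)] sym[OF Y Z(1)] by simp
    then show "g' p (S X Y) v = 0" by (simp add: Z)
  qed
  then show ?thesis by (simp add: S_def)
qed

section \<open>Comparison of curvature and Ricci tensor\<close>

text \<open>For \<open>W\<close> in the kernel of \<eta> the term with \<open>\<phi> p (X p)\<close>
  disappears. The equation is between fields, so it can be differentiated again.\<close>

lemma D'_horizontal:
  assumes X: "X \<in> \<X>" and W: "W \<in> \<X>" and h: "\<And>q. \<eta> q (W q) = 0"
  shows "D' X W = D X W + fscale (c_form X W) \<xi> - (\<alpha> - 1) *\<^sub>R fscale (\<lambda>q. \<eta> q (X q)) (\<lambda>q. \<phi> q (W q))"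
  using D'_eq[OF X W] by (simp add: fun_eq_iff[of "D' X W"] deformed_connection_def h fscale_at scaleR_at)

lemma D'_\<xi>:
  assumes W: "W \<in> \<X>"
  shows "D' \<xi> W = D \<xi> W - (\<alpha> - 1) *\<^sub>R (\<lambda>q. \<phi> q (W q))"
  using D'_eq[OF \<xi> W] by (simp add: fun_eq_iff[of "D' \<xi> W"] deformed_connection_def c_form_\<xi>[OF W] \<eta>_\<xi> \<phi>_\<xi> scaleR_at)

lemma \<eta>_D_horizontal:
  assumes X: "X \<in> \<X>" and W: "W \<in> \<X>" and h: "\<And>q. \<eta> q (W q) = 0"
  shows "\<eta> p (D X W p) = - g p (W p) (D X \<xi> p)"
  using derivative_\<eta>[OF X W, of p] tangent_const[OF field_at[OF X], of p 0] by (simp add: h)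

text \<open>In the direct expansion the terms quadratic in \<open>\<alpha> - 1\<close> cancel, and
  so do those with the derivative of \<open>\<eta> q (X q)\<close> along \<xi>. All multiples of
  \<xi> are collected in \<open>s\<close>, whose value is left open because the trace argument does
  not see it.\<close>

lemma curvature_deformed:
  assumes X: "X \<in> \<X>" and V: "V \<in> \<X>" and h: "\<And>q. \<eta> q (V q) = 0"
  shows "\<exists>s. curvature D' X \<xi> V p = curvature D X \<xi> V p - (\<alpha> - 1) *\<^sub>R nabla_phi X V p +
    ((\<alpha> - 1) * \<eta> p (X p)) *\<^sub>R nabla_phi \<xi> V p + s *\<^sub>R \<xi> p"
proof -
  let ?b = "\<alpha> - 1"
  let ?\<phi> = "\<lambda>W q. \<phi> q (W q)" and ?\<eta> = "\<lambda>q. \<eta> q (X q)"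
  note closed = X V \<xi> D_closed \<phi>_field[OF V] \<phi>_field vector_fields_diff vector_fields_add vector_fields_scaleR
    vector_fields_fscale c_form_smooth \<eta>_smooth lie_bracket_closed
  \<comment> \<open>This is \<open>D' \<xi> V\<close>. It is again horizontal since \<xi> is
    geodesic, so \<open>D'_horizontal\<close> applies a second time.\<close>
  define W where "W = D \<xi> V - ?b *\<^sub>R ?\<phi> V"
  have W: "W \<in> \<X>" unfolding W_def by (simp add: closed)
  have hW: "\<eta> q (W q) = 0" for q
    by (simp add: W_def \<eta>_linear T_simps field_at closed \<phi>_closed \<eta>_\<phi> \<eta>_D_horizontal[OF \<xi> V h] D_\<xi>_\<xi> g_zero scaleR_at)
  have 1: "D' X (D' \<xi> V) p = D X (D \<xi> V) p - ?b *\<^sub>R D X (?\<phi> V) p + c_form X W p *\<^sub>R \<xi> p -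
      (?b * ?\<eta> p) *\<^sub>R (\<phi> p (D \<xi> V p) - ?b *\<^sub>R V p)"
  proof -
    have "D' X (D' \<xi> V) p = D X W p + c_form X W p *\<^sub>R \<xi> p - (?b * ?\<eta> p) *\<^sub>R \<phi> p (W p)"
      unfolding D'_\<xi>[OF V] W_def[symmetric] D'_horizontal[OF X W hW] by (simp add: fscale_at scaleR_at)
    moreover have "D X W p = D X (D \<xi> V) p - ?b *\<^sub>R D X (?\<phi> V) p"
      unfolding W_def by (simp add: D_diff D_scaleR closed scaleR_at)
    moreover have "\<phi> p (W p) = \<phi> p (D \<xi> V p) - ?b *\<^sub>R V p"
      unfolding W_def by (simp add: \<phi>_linear T_simps field_at closed \<phi>_closed \<phi>_\<phi> h scaleR_at)
    ultimately show ?thesis by simp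
  qed
  define U where "U = D X V + fscale (c_form X V) \<xi> - ?b *\<^sub>R fscale ?\<eta> (?\<phi> V)"
  have U: "U \<in> \<X>" unfolding U_def by (simp add: closed)
  have 2: "D' \<xi> (D' X V) p = D \<xi> (D X V) p + \<xi> p (c_form X V) *\<^sub>R \<xi> p -
      ?b *\<^sub>R (\<xi> p ?\<eta> *\<^sub>R \<phi> p (V p) + ?\<eta> p *\<^sub>R D \<xi> (?\<phi> V) p) - ?b *\<^sub>R (\<phi> p (D X V p) - (?b * ?\<eta> p) *\<^sub>R V p)"
  proof -
    have "D' \<xi> (D' X V) p = D \<xi> U p - ?b *\<^sub>R \<phi> p (U p)"
      unfolding D'_horizontal[OF X V h] U_def[symmetric] D'_\<xi>[OF U] by (simp add: scaleR_at)
    moreover have "D \<xi> U p = D \<xi> (D X V) p + \<xi> p (c_form X V) *\<^sub>R \<xi> p -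
        ?b *\<^sub>R (\<xi> p ?\<eta> *\<^sub>R \<phi> p (V p) + ?\<eta> p *\<^sub>R D \<xi> (?\<phi> V) p)"
      unfolding U_def by (simp add: D_diff D_add D_scaleR D_fscale closed scaleR_at fscale_at D_\<xi>_\<xi>) (simp add: act_def)
    moreover have "\<phi> p (U p) = \<phi> p (D X V p) - (?b * ?\<eta> p) *\<^sub>R V p"
      unfolding U_def by (simp add: \<phi>_linear T_simps field_at closed \<phi>_closed \<phi>_\<phi> \<phi>_\<xi> h scaleR_at fscale_at)
    ultimately show ?thesis by simp
  qed
  \<comment> \<open>This value makes the bracket term cancel the derivative of
    \<open>\<eta> q (X q)\<close> produced in the second iterated derivative.\<close>
  have "\<eta> p (lie_bracket X \<xi> p) = - \<xi> p ?\<eta>"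
    using derivative_\<eta>[OF \<xi> X, of p] \<eta>_D_\<xi>[OF X, of p]
    by (simp add: torsion_free X \<xi> \<eta>_linear field_at closed D_\<xi>_\<xi> g_zero)
  then have 3: "D' (lie_bracket X \<xi>) V p = D (lie_bracket X \<xi>) V p + c_form (lie_bracket X \<xi>) V p *\<^sub>R \<xi> p +
      (?b * \<xi> p ?\<eta>) *\<^sub>R \<phi> p (V p)"
    unfolding D'_horizontal[OF lie_bracket_closed[OF X \<xi>] V h] by (simp add: fscale_at scaleR_at)
  let ?s = "c_form X W p - \<xi> p (c_form X V) - c_form (lie_bracket X \<xi>) V p"
  have "curvature D' X \<xi> V p = curvature D X \<xi> V p - ?b *\<^sub>R nabla_phi X V p +
    (?b * ?\<eta> p) *\<^sub>R nabla_phi \<xi> V p + ?s *\<^sub>R \<xi> p"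
    unfolding curvature_def nabla_phi_def
    by (simp add: 1 2 3 algebra_simps)
  then show ?thesis by blast
qed

lemma ricci_deformed:
  assumes v: "v \<in> T p" and h: "\<eta> p v = 0"
  shows "ricci A D' p (\<xi> p) v = ricci A D p (\<xi> p) v"
proof -
  let ?b = "\<alpha> - 1"
  define Y where "Y = extension A p v"
  \<comment> \<open>The horizontal projection of the extension: \<open>curvature_deformed\<close>
    requires a field in the kernel of \<eta> at every point, not only at \<open>p\<close>.\<close>
  define V where "V = Y - fscale (\<lambda>q. \<eta> q (Y q)) \<xi>"
  have Y: "Y \<in> \<X>" "Y p = v" unfolding Y_def by (rule extension[OF v])+
  have V: "V \<in> \<X>" unfolding V_def by (intro vector_fields_diff vector_fields_fscale \<eta>_smooth Y \<xi>)
  have Vp: "V p = v" by (simp add: V_def Y fscale_at h)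
  have hV: "\<eta> q (V q) = 0" for q
    by (simp add: V_def \<eta>_linear T_simps field_at Y \<xi> fscale_at \<eta>_\<xi>)
  note \<xi>p = \<xi>_at[of p]
  define N where "N = nabla_phi \<xi> V p"
  have N: "N \<in> T p" unfolding N_def by (intro field_at nabla_phi_closed \<xi> V)
  have \<eta>N: "\<eta> p N = 0"
  proof -
    have "\<eta> p (D \<xi> (\<lambda>q. \<phi> q (V q)) p) = 0"
      using \<eta>_D_horizontal[OF \<xi> \<phi>_field[OF V] \<eta>_\<phi>[OF field_at[OF V]]]
      by (simp add: D_\<xi>_\<xi> g_zero \<phi>_closed field_at V)
    then show ?thesis
      by (simp add: N_def nabla_phi_def \<eta>_linear field_at D_closed \<xi> V \<phi>_field \<phi>_closed \<eta>_\<phi>)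
  qed
  define R where "R u = curvature_at A D p u (\<xi> p) v" for u
  define R' where "R' u = curvature_at A D' p u (\<xi> p) v" for u
  define M where "M u = nabla_phi_at p u v" for u
  have lin: "linear_between (T p) (T p) R" "linear_between (T p) (T p) R'" "linear_between (T p) (T p) M"
    unfolding R_def R'_def M_def
    by (rule linear_curvature_at deformed.linear_curvature_at linear_nabla_phi_at; rule \<xi>p v)+
  have closed: "R u \<in> T p" "R' u \<in> T p" "M u \<in> T p" if "u \<in> T p" for u
    using lin that unfolding linear_between_def by blast+
  \<comment> \<open>All terms of \<open>curvature_deformed\<close> except the multiple of \<xi>.
    Hence \<open>Q\<close> takes values in the line of \<xi>, and its trace is the \<xi>-coefficient
    of \<open>Q (\<xi> p)\<close>.\<close>
  define Q where "Q u = R' u + ((- 1) *\<^sub>R R u + (?b *\<^sub>R M u + (- ?b) *\<^sub>R (\<eta> p u *\<^sub>R N)))" for u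
  have QT: "Q u \<in> T p" if "u \<in> T p" for u
    unfolding Q_def by (intro T_add T_scale closed N that)
  have "\<exists>s. Q u = s *\<^sub>R \<xi> p" if u: "u \<in> T p" for u
  proof -
    define X where "X = extension A p u"
    have X: "X \<in> \<X>" "X p = u" unfolding X_def by (rule extension[OF u])+
    obtain s where "curvature D' X \<xi> V p = curvature D X \<xi> V p - ?b *\<^sub>R nabla_phi X V p +
        (?b * \<eta> p (X p)) *\<^sub>R nabla_phi \<xi> V p + s *\<^sub>R \<xi> p"
      using curvature_deformed[OF X(1) V hV] by blast
    moreover have "(1 - \<alpha>) * t = - ((\<alpha> - 1) * t)" for t by (simp add: algebra_simps)
    ultimately have "Q u = s *\<^sub>R \<xi> p"
      using curvature_at_eq[OF X(1) \<xi> V, of p] deformed.curvature_at_eq[OF X(1) \<xi> V, of p]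
        nabla_phi_at_eq[OF X(1) V, of p]
      by (simp add: Q_def R_def R'_def M_def N_def X Vp)
    then show ?thesis by blast
  qed
  then have Q\<xi>: "Q u = \<eta> p (Q u) *\<^sub>R \<xi> p" if "u \<in> T p" for u
    using that \<eta>_scale[OF \<xi>p] by (metis \<eta>_\<xi> mult.right_neutral)
  have "linear_between (T p) UNIV (\<lambda>u. \<eta> p (Q u))"
    unfolding linear_between_def
  proof (intro conjI ballI allI)
    fix u w a assume u: "u \<in> T p"
    { assume w: "w \<in> T p"
      have "R (u + w) = R u + R w" "R' (u + w) = R' u + R' w" "M (u + w) = M u + M w"
        using lin u w unfolding linear_between_def by blast+
      then show "\<eta> p (Q (u + w)) = \<eta> p (Q u) + \<eta> p (Q w)"
        by (simp add: Q_def \<eta>_linear T_simps closed N u w \<eta>N algebra_simps) }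
    have "R (a *\<^sub>R u) = a *\<^sub>R R u" "R' (a *\<^sub>R u) = a *\<^sub>R R' u" "M (a *\<^sub>R u) = a *\<^sub>R M u"
      using lin u unfolding linear_between_def by blast+
    then show "\<eta> p (Q (a *\<^sub>R u)) = a *\<^sub>R \<eta> p (Q u)"
      by (simp add: Q_def \<eta>_linear T_simps closed N u \<eta>N algebra_simps)
  qed simp
  then have "trace_on (T p) (\<lambda>u. \<eta> p (Q u) *\<^sub>R \<xi> p) = \<eta> p (Q (\<xi> p))"
    by (rule tangent.trace_rank_one[OF _ \<xi>p])
  \<comment> \<open>Both curvatures vanish here by antisymmetry, and the two derivatives of \<phi>
    cancel because \<eta> is 1 on \<xi>.\<close>
  also have "Q (\<xi> p) = 0"
  proof -
    have "R (\<xi> p) = 0" "R' (\<xi> p) = 0" "M (\<xi> p) = N"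
      using curvature_at_eq[OF \<xi> \<xi> V, of p] deformed.curvature_at_eq[OF \<xi> \<xi> V, of p] nabla_phi_at_eq[OF \<xi> V, of p]
      by (simp_all add: R_def R'_def M_def N_def Vp curvature_eq deformed.curvature_eq \<xi> V)
    then show ?thesis by (simp add: Q_def \<eta>_\<xi> flip: scaleR_left_distrib)
  qed
  also have "\<eta> p 0 = 0" using \<eta>_scale[OF \<xi>p, of 0] by simp
  finally have "trace_on (T p) Q = 0"
    using tangent.trace_cong[of p Q "\<lambda>u. \<eta> p (Q u) *\<^sub>R \<xi> p"] Q\<xi> QT by simp
  moreover have "trace_on (T p) Q = trace_on (T p) R' + ((- 1) * trace_on (T p) R +
      (?b * trace_on (T p) M + (- ?b) * trace_on (T p) (\<lambda>u. \<eta> p u *\<^sub>R N)))"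
    unfolding Q_def[abs_def]
    by (simp only: tangent.trace_add tangent.trace_scale T_add T_scale closed N)
  moreover have "trace_on (T p) M = 0"
    unfolding M_def[abs_def] by (rule divergence_\<phi>[OF v h])
  moreover have "trace_on (T p) (\<lambda>u. \<eta> p u *\<^sub>R N) = 0"
    using tangent.trace_rank_one[OF linear_\<eta> N] \<eta>N by simp
  ultimately have "trace_on (T p) R' = trace_on (T p) R" by simp
  then show ?thesis by (simp add: ricci_def R_def[abs_def] R'_def[abs_def])
qed

text \<open>Both conditions test the same hyperplane: the \<open>g'\<close>-orthogonal complement of
  the rescaled field is again the kernel of \<eta>. There the Ricci values agree by
  \<open>ricci_deformed\<close> up to the nonzero factor \<open>1 / \<alpha>\<close>.\<close>

lemma ricci_xi_condition_deformed:
  "ricci_xi_condition A g D \<xi> \<longleftrightarrow> ricci_xi_condition A g' D' (\<lambda>p. (1 / \<alpha>) *\<^sub>R \<xi> p)"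
proof -
  let ?\<xi>' = "\<lambda>p. (1 / \<alpha>) *\<^sub>R \<xi> p"
  have "?\<xi>' = (1 / \<alpha>) *\<^sub>R \<xi>" by (simp add: fun_eq_iff[of ?\<xi>'] scaleR_at)
  then have \<xi>': "?\<xi>' \<in> \<X>" using vector_fields_scaleR[OF \<xi>] by simp
  have g'\<xi>': "g' p (?\<xi>' p) v = \<alpha> * \<eta> p v" if "v \<in> T p" for p v
    using \<alpha> that by (simp add: g'_eq g_linear \<eta>_linear \<xi>_at g_\<xi> \<eta>_\<xi> field_simps)
  have unit: "g' p (?\<xi>' p) (?\<xi>' p) = 1" for p
    using \<alpha> g'\<xi>'[OF T_scale[OF \<xi>_at], of p "1 / \<alpha>"] by (simp add: \<eta>_scale \<xi>_at \<eta>_\<xi>)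
  have ric: "ricci A D' p (?\<xi>' p) v = 0 \<longleftrightarrow> ricci A D p (\<xi> p) v = 0" if v: "v \<in> T p" "\<eta> p v = 0" for p v
  proof -
    have "ricci A D' p (?\<xi>' p) v = (1 / \<alpha>) * ricci A D' p (\<xi> p) v"
      using deformed.linear_ricci(2)[OF v(1)] \<xi>_at unfolding linear_between_def by simp
    then show ?thesis using \<alpha> by (simp add: ricci_deformed v)
  qed
  have "ricci_xi_condition A g D \<xi> \<longleftrightarrow> (\<forall>p. \<forall>v\<in>T p. \<eta> p v = 0 \<longrightarrow> ricci A D p (\<xi> p) v = 0)"
    by (subst ricci_xi_condition_iff[OF \<xi>]) (simp_all add: g_\<xi> \<xi>_at \<eta>_\<xi>)
  also have "\<dots> \<longleftrightarrow> ricci_xi_condition A g' D' ?\<xi>'"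
    by (subst deformed.ricci_xi_condition_iff[OF \<xi>' unit]) (use g'\<xi>' ric \<alpha> in auto)
  finally show ?thesis .
qed

end

theorem proposition4p9:
  fixes A :: "('m::{t2_space,second_countable_topology}, 'e::euclidean_space) chart set"
    and n :: nat and \<alpha> :: real
    and \<phi> \<phi>' :: "'m \<Rightarrow> 'm tvec \<Rightarrow> 'm tvec"
    and \<xi> \<xi>' :: "'m vfield"
    and \<eta> \<eta>' :: "'m \<Rightarrow> 'm tvec \<Rightarrow> real"
    and g g' :: "'m bform"
    and D D' :: "'m connection"
  assumes "smooth_manifold A" and "DIM('e) = 2 * n + 1"
    and "paracontact_metric A n \<phi> \<xi> \<eta> g"
    and "\<alpha> > 0"
    and "\<eta>' = (\<lambda>p u. \<alpha> * \<eta> p u)"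
    and "\<xi>' = (\<lambda>p. (1 / \<alpha>) *\<^sub>R \<xi> p)"
    and "\<phi>' = \<phi>"
    and "g' = (\<lambda>p u v. \<alpha> * g p u v + \<alpha> * (\<alpha> - 1) * (\<eta> p u * \<eta> p v))"
    and "levi_civita A g D" and "levi_civita A g' D'"
  shows "ricci_xi_condition A g D \<xi> \<longleftrightarrow> ricci_xi_condition A g' D' \<xi>'"
proof -
  have g: "pseudo_riemannian_metric A g"
    using assms(3) unfolding paracontact_metric_def compatible_metric_def by blast
  interpret d_homothety A g D n \<phi> \<xi> \<eta> \<alpha> D' g'
  proof
    show "tensor_field_02 A g"
      using g unfolding pseudo_riemannian_metric_def by blast
    show "g p u v = g p v u" if "u \<in> tangent_space A p" "v \<in> tangent_space A p" for u v p
      using g that unfolding pseudo_riemannian_metric_def by blast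
    show "u = 0" if "u \<in> tangent_space A p" "\<And>v. v \<in> tangent_space A p \<Longrightarrow> g p u v = 0" for u p
      using g that unfolding pseudo_riemannian_metric_def by blast
  qed (fact assms)+
  show ?thesis unfolding assms(6) by (rule ricci_xi_condition_deformed)
qed

end
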